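(* Let $K$ be a commutative ring, $\delta,\delta_e,\kappa\in K$ with $\delta_e$ invertible, and $n\ge1$. The map $\rho_1:B^e_n\to B_{n-1}$ extends $K$-linearly to an algebra isomorphism from the subalgebra $b^e_n$ of the blob algebra $b_n(\delta,\delta_e,\kappa)$ spanned by $B^e_n$ (with unit $\frac1{\delta_e}e$) to the blob algebra $b_{n-1}(\delta,\kappa,\delta_e)$ (i.e. with the roles of $\delta_e$ and $\kappa$ interchanged).
   Context: A Temperley--Lieb (TL) diagram on $n$ vertices is a non-crossing pairing of vertices $1,\dots,n$ (left to right on the northern edge of a rectangle) and $1',\dots,n'$ (left to right on the southern edge), realised by disjoint lines inside the rectangle, up to isotopy. $B_n$ is the set of blob diagrams: TL diagrams in which each line that can be deformed to touch the western edge without crossings (western exposed line) may be decorated with at most one blob, and no other line is decorated. For $\alpha,\beta,\gamma\in K$, the blob algebra $b_n(\alpha,\beta,\gamma)$ is the free $K$-module on $B_n$ with product by concatenation ($d_1$ stacked above $d_2$), where two blobs on the same line are replaced by one blob and a factor $\beta$, an undecorated closed loop is replaced by the factor $\alpha$, and a closed loop decorated by one blob by the factor $\gamma$. $e\in B_n$ is the identity diagram with its leftmost line $\{1,1'\}$ decorated. $B'_n\subset B_n$ is the set of diagrams in which the line containing vertex $1$ and the line containing vertex $1'$ are both decorated (possibly the same line), and $B_n^e=\{\frac1{\delta_e}d: d\in B'_n\}\subset b_n(\delta,\delta_e,\kappa)$. The map $\rho_1$: for $d\in B_n'$, list the decorated lines clockwise around the region having the western edge in its closure, starting from vertex $1$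 (i.e. in increasing order with respect to the order $1<2<\dots<n<n'<\dots<1'$ of the vertices): the list is either just $\{1,1'\}$, or $\{1,i_1\},\{i_2,i_3\},\dots,\{i_l,1'\}$. In the first case erase the line $\{1,1'\}$; otherwise erase all the listed lines and replace them with decorated lines $\{i_1,i_2\},\{i_3,i_4\},\dots,\{i_{l-1},i_l\}$. All other lines are unchanged. After deleting the vertices $1,1'$ and renumbering, the result is an element of $B_{n-1}$, which is $\rho_1(\frac1{\delta_e}d)$. The map $\rho_1$ is a bijection. *)

theory Defs
  imports "HOL-Algebra.Algebra" "HOL-Library.Disjoint_Sets"
begin

section \<open>Blob diagrams\<close>

text \<open>
  \<open>North i\<close> is the vertex \<open>i\<close> on the northern edge, \<open>South i\<close> the vertex \<open>i'\<close> on the southern edge.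
\<close>

datatype vertex = North nat | South nat

definition vertices :: "nat \<Rightarrow> vertex set" where
  "vertices n = North ` {1..n} \<union> South ` {1..n}"

text \<open>
  The clockwise order \<open>1 < 2 < \<dots> < n < n' < \<dots> < 1'\<close>. The western edge of the rectangle is the
  boundary arc between the last vertex \<open>1'\<close> and the first vertex \<open>1\<close>.
\<close>

fun position :: "nat \<Rightarrow> vertex \<Rightarrow> nat" where
  "position n (North i) = i"
| "position n (South i) = 2 * n + 1 - i"

definition noncrossing :: "nat \<Rightarrow> vertex set set \<Rightarrow> bool" where
  "noncrossing n L \<longleftrightarrow>
     (\<forall>a b c d. {a, c} \<in> L \<and> {b, d} \<in> L \<longrightarrow>
        \<not> (position n a < position n b \<and> position n b < position n c \<and> position n c < position n d))"

text \<open>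
  Temperley--Lieb diagrams: up to isotopy a diagram is determined by the pairing of the vertices
  that its lines induce.
\<close>

definition TL_diagrams :: "nat \<Rightarrow> vertex set set set" where
  "TL_diagrams n = {L. partition_on (vertices n) L \<and> (\<forall>l\<in>L. card l = 2) \<and> noncrossing n L}"

text \<open>
  A line can be deformed to touch the western edge iff no line \<open>{a, b}\<close> of the diagram cuts it off
  from that edge, that is, iff no line has one end before and the other end after it.
\<close>

definition western_exposed :: "nat \<Rightarrow> vertex set set \<Rightarrow> vertex set \<Rightarrow> bool" where
  "western_exposed n L l \<longleftrightarrow>
     \<not> (\<exists>a b. {a, b} \<in> L \<and> (\<forall>v\<in>l. position n a < position n v \<and> position n v < position n b))"

text \<open>A blob diagram is given by its set of lines and its set of decorated lines.\<close>

type_synonym blob_diagram = "vertex set set \<times> vertex set set"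

definition blob_diagrams :: "nat \<Rightarrow> blob_diagram set" where
  "blob_diagrams n =
     {(L, D). L \<in> TL_diagrams n \<and> D \<subseteq> L \<and> (\<forall>l\<in>D. western_exposed n L l)}"

definition id_lines :: "nat \<Rightarrow> vertex set set" where
  "id_lines n = {{North i, South i} | i. i \<in> {1..n}}"

definition id_diagram :: "nat \<Rightarrow> blob_diagram" where
  "id_diagram n = (id_lines n, {})"

definition e_diagram :: "nat \<Rightarrow> blob_diagram" where
  "e_diagram n = (id_lines n, {{North 1, South 1}})"


section \<open>Concatenation\<close>

text \<open>
  When \<open>d\<^sub>1\<close> is stacked above \<open>d\<^sub>2\<close>, the points of the stack are \<open>(0, i)\<close> (northern edge of \<open>d\<^sub>1\<close>),
  \<open>(1, i)\<close> (southern edge of \<open>d\<^sub>1\<close> glued to the northern edge of \<open>d\<^sub>2\<close>) and \<open>(2, i)\<close> (southern edge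
  of \<open>d\<^sub>2\<close>). A vertex of a diagram whose northern edge is at level \<open>k\<close> becomes \<open>place k v\<close>.
\<close>

fun place :: "nat \<Rightarrow> vertex \<Rightarrow> nat \<times> nat" where
  "place k (North i) = (k, i)"
| "place k (South i) = (Suc k, i)"

definition stack_joined :: "blob_diagram \<Rightarrow> blob_diagram \<Rightarrow> ((nat \<times> nat) \<times> (nat \<times> nat)) set" where
  "stack_joined d1 d2 =
     {(p, q). (\<exists>l \<in> fst d1. p \<in> place 0 ` l \<and> q \<in> place 0 ` l) \<or>
              (\<exists>l \<in> fst d2. p \<in> place 1 ` l \<and> q \<in> place 1 ` l)}"

text \<open>The lines and closed loops of the stack are its connected components.\<close>

definition stack_components :: "nat \<Rightarrow> blob_diagram \<Rightarrow> blob_diagram \<Rightarrow> (nat \<times> nat) set set" where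
  "stack_components n d1 d2 = ({0, 1, 2} \<times> {1..n}) // (stack_joined d1 d2)\<^sup>*"

text \<open>
  The blobs of the two factors are counted separately: in a closed loop the same pair of points of
  level 1 may be joined both by a line of \<open>d\<^sub>1\<close> and by a line of \<open>d\<^sub>2\<close>.
\<close>

definition blobs_on :: "blob_diagram \<Rightarrow> blob_diagram \<Rightarrow> (nat \<times> nat) set \<Rightarrow> nat" where
  "blobs_on d1 d2 C =
     card {l \<in> snd d1. place 0 ` l \<subseteq> C} + card {l \<in> snd d2. place 1 ` l \<subseteq> C}"

text \<open>The ends of a component on the outer edges of the stack; a closed loop has none.\<close>

definition outer_ends :: "(nat \<times> nat) set \<Rightarrow> vertex set" where
  "outer_ends C = {North i | i. (0, i) \<in> C} \<union> {South i | i. (2, i) \<in> C}"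

definition concat_diagram :: "nat \<Rightarrow> blob_diagram \<Rightarrow> blob_diagram \<Rightarrow> blob_diagram" where
  "concat_diagram n d1 d2 =
     ({outer_ends C | C. C \<in> stack_components n d1 d2 \<and> outer_ends C \<noteq> {}},
      {outer_ends C | C. C \<in> stack_components n d1 d2 \<and> outer_ends C \<noteq> {} \<and> blobs_on d1 d2 C > 0})"

text \<open>
  If a component carries \<open>k \<ge> 1\<close> blobs, merging them into one gives the factor \<open>\<beta>\<^sup>k\<^sup>-\<^sup>1\<close>. For
  \<open>k = 0\<close> the truncated exponent makes the factor of an undecorated line equal to 1.
\<close>

definition component_factor ::
    "('k, 'm) ring_scheme \<Rightarrow> 'k \<Rightarrow> 'k \<Rightarrow> 'k \<Rightarrow> blob_diagram \<Rightarrow> blob_diagram \<Rightarrow> (nat \<times> nat) set \<Rightarrow> 'k" where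
  "component_factor K \<alpha> \<beta> \<gamma> d1 d2 C =
     (let k = blobs_on d1 d2 C in
        if outer_ends C \<noteq> {} then \<beta> [^]\<^bsub>K\<^esub> (k - 1)
        else if k = 0 then \<alpha>
        else \<beta> [^]\<^bsub>K\<^esub> (k - 1) \<otimes>\<^bsub>K\<^esub> \<gamma>)"

definition concat_factor ::
    "('k, 'm) ring_scheme \<Rightarrow> nat \<Rightarrow> 'k \<Rightarrow> 'k \<Rightarrow> 'k \<Rightarrow> blob_diagram \<Rightarrow> blob_diagram \<Rightarrow> 'k" where
  "concat_factor K n \<alpha> \<beta> \<gamma> d1 d2 =
     (\<Otimes>\<^bsub>K\<^esub>C\<in>stack_components n d1 d2. component_factor K \<alpha> \<beta> \<gamma> d1 d2 C)"


section \<open>The blob algebra\<close>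

text \<open>
  The free module on \<open>blob_diagrams n\<close> (a finite set) consists of all coefficient functions on it;
  \<open>diagram_vec K n d\<close> is the basis vector belonging to \<open>d\<close>.
\<close>

definition diagram_vec :: "('k, 'm) ring_scheme \<Rightarrow> nat \<Rightarrow> blob_diagram \<Rightarrow> (blob_diagram \<Rightarrow> 'k)" where
  "diagram_vec K n d = (\<lambda>d' \<in> blob_diagrams n. if d' = d then \<one>\<^bsub>K\<^esub> else \<zero>\<^bsub>K\<^esub>)"

definition blob_algebra ::
    "('k, 'm) ring_scheme \<Rightarrow> nat \<Rightarrow> 'k \<Rightarrow> 'k \<Rightarrow> 'k \<Rightarrow> ('k, blob_diagram \<Rightarrow> 'k) module" where
  "blob_algebra K n \<alpha> \<beta> \<gamma> =
     \<lparr>carrier = blob_diagrams n \<rightarrow>\<^sub>E carrier K,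
      monoid.mult = (\<lambda>x y. \<lambda>d \<in> blob_diagrams n.
        \<Oplus>\<^bsub>K\<^esub>p \<in> {p \<in> blob_diagrams n \<times> blob_diagrams n. concat_diagram n (fst p) (snd p) = d}.
          concat_factor K n \<alpha> \<beta> \<gamma> (fst p) (snd p) \<otimes>\<^bsub>K\<^esub> (x (fst p) \<otimes>\<^bsub>K\<^esub> y (snd p))),
      one = diagram_vec K n (id_diagram n),
      ring.zero = (\<lambda>d \<in> blob_diagrams n. \<zero>\<^bsub>K\<^esub>),
      ring.add = (\<lambda>x y. \<lambda>d \<in> blob_diagrams n. x d \<oplus>\<^bsub>K\<^esub> y d),
      smult = (\<lambda>a x. \<lambda>d \<in> blob_diagrams n. a \<otimes>\<^bsub>K\<^esub> x d)\<rparr>"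

definition module_span ::
    "('k, 'm) ring_scheme \<Rightarrow> ('k, 'v, 'n) module_scheme \<Rightarrow> 'v set \<Rightarrow> 'v set" where
  "module_span K M S = \<Inter>{N. submodule N K M \<and> S \<subseteq> N}"

text \<open>
  Isomorphisms of not necessarily commutative \<open>K\<close>-algebras: \<open>K\<close>-linear bijections preserving
  product and unit (additivity, product, unit and bijectivity are part of \<open>ring_iso\<close>).
\<close>

definition algebra_iso ::
    "('k, 'm) ring_scheme \<Rightarrow> ('k, 'v, 'p) module_scheme \<Rightarrow> ('k, 'w, 'q) module_scheme \<Rightarrow> ('v \<Rightarrow> 'w) set"
  where
  "algebra_iso K A B =
     {h \<in> ring_iso A B. \<forall>a \<in> carrier K. \<forall>x \<in> carrier A. h (a \<odot>\<^bsub>A\<^esub> x) = a \<odot>\<^bsub>B\<^esub> h x}"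


section \<open>The subalgebra \<open>b\<^sub>n\<^sup>e\<close> and the map \<open>\<rho>\<^sub>1\<close>\<close>

text \<open>The set \<open>B'\<^sub>n\<close>.\<close>

definition corner_diagrams :: "nat \<Rightarrow> blob_diagram set" where
  "corner_diagrams n =
     {(L, D) \<in> blob_diagrams n. (\<exists>l\<in>D. North 1 \<in> l) \<and> (\<exists>l\<in>D. South 1 \<in> l)}"

text \<open>The vector \<open>(1/\<delta>\<^sub>e) d\<close>.\<close>

definition corner_vec ::
    "('k, 'm) ring_scheme \<Rightarrow> nat \<Rightarrow> 'k \<Rightarrow> 'k \<Rightarrow> 'k \<Rightarrow> blob_diagram \<Rightarrow> (blob_diagram \<Rightarrow> 'k)" where
  "corner_vec K n \<delta> \<delta>\<^sub>e \<kappa> d = inv\<^bsub>K\<^esub> \<delta>\<^sub>e \<odot>\<^bsub>blob_algebra K n \<delta> \<delta>\<^sub>e \<kappa>\<^esub> diagram_vec K n d"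

definition corner_algebra ::
    "('k, 'm) ring_scheme \<Rightarrow> nat \<Rightarrow> 'k \<Rightarrow> 'k \<Rightarrow> 'k \<Rightarrow> ('k, blob_diagram \<Rightarrow> 'k) module" where
  "corner_algebra K n \<delta> \<delta>\<^sub>e \<kappa> =
     (blob_algebra K n \<delta> \<delta>\<^sub>e \<kappa>)
       \<lparr>carrier := module_span K (blob_algebra K n \<delta> \<delta>\<^sub>e \<kappa>)
                    (corner_vec K n \<delta> \<delta>\<^sub>e \<kappa> ` corner_diagrams n),
        one := corner_vec K n \<delta> \<delta>\<^sub>e \<kappa> (e_diagram n)\<rparr>"

fun pair_up :: "'a list \<Rightarrow> 'a set set" where
  "pair_up (a # b # xs) = insert {a, b} (pair_up xs)"
| "pair_up _ = {}"

fun drop_first :: "vertex \<Rightarrow> vertex" where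
  "drop_first (North i) = North (i - 1)"
| "drop_first (South i) = South (i - 1)"

text \<open>
  Decorated lines are western exposed, hence occupy disjoint intervals of the clockwise order. So
  listing them in clockwise order as \<open>{1, i\<^sub>1}, {i\<^sub>2, i\<^sub>3}, \<dots>, {i\<^sub>l, 1'}\<close> amounts to listing
  their endpoints as \<open>1, i\<^sub>1, i\<^sub>2, \<dots>, i\<^sub>l, 1'\<close>. Without its first and last entry this list is
  \<open>i\<^sub>1, \<dots>, i\<^sub>l\<close>; it is empty if \<open>{1, 1'}\<close> is the only decorated line.
\<close>

definition rho1 :: "nat \<Rightarrow> blob_diagram \<Rightarrow> blob_diagram" where
  "rho1 n d =
     (let D = snd d;
          new = pair_up (butlast (tl (sorted_key_list_of_set (position n) (\<Union>D))))
      in ((`) drop_first ` ((fst d - D) \<union> new), (`) drop_first ` new))"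

end

theory Submission
  imports Defs
begin

text \<open>
  Cutting every decorated line at its blob turns a blob diagram into a non-crossing partial matching
  of the vertices whose unmatched vertices (defects) are exposed to the western edge; conversely the
  decorated lines are recovered by joining consecutive defects in clockwise order. In this picture
  \<open>\<rho>\<^sub>1\<close> just deletes the first and the last defect, \<open>1\<close> and \<open>1'\<close>.

  For the product, place \<open>d\<^sub>1\<close> and \<open>d\<^sub>2\<close> next to each other on a line and contract the glued pairs
  of vertices one after the other, from the western edge inwards; each pair is adjacent when it is
  contracted. A contraction produces a factor in three cases only: \<open>\<alpha>\<close> if it closes an undecorated
  line, and, if both points are defects, \<open>\<gamma>\<close> or \<open>\<beta>\<close> according to whether the number of defects
  before them is even (they are the two ends of one decorated line) or odd (two blobs are merged).
  Deleting the first defect changes this parity, so \<open>\<beta>\<close> and \<open>\<gamma>\<close> are exchanged. The pair formed by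
  \<open>1'\<close> of \<open>d\<^sub>1\<close> and \<open>1\<close> of \<open>d\<^sub>2\<close>, which \<open>\<rho>\<^sub>1\<close> removes, contributes one extra factor \<open>\<delta>\<^sub>e\<close>, which the
  normalisation by \<open>1/\<delta>\<^sub>e\<close> cancels.
\<close>


section \<open>Components of glued line diagrams\<close>

text \<open>Components of a stack are global, whereas the parity of defects is local information;
  contracting one pair at a time bridges the two, and adjacency of the contracted points does all
  the work. No line separates them, so planarity survives. If both are defects, they are consecutive
  ones. If only one is a defect, it slides along the undecorated line of the other without passing
  any defect, so the order of the defects is kept. A contraction acts on the set of undecorated
  lines alone, and this set is the same for a diagram and for its image under \<open>rho1\<close>.
  Hence one sequence of contractions serves both stacks: once the extra pair is gone, their point
  sets differ by the two outermost defects only. To make this literal, diagrams are transported to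
  natural numbers along order preserving numberings of the vertices, and a diagram and its image
  keep the same numbers. The factor is recorded by three exponents, so that exchanging two
  parameters means exchanging two numbers.\<close>

definition joined :: "'a set set \<Rightarrow> ('a \<times> 'a) set" where
  "joined E = {(x, y). \<exists>e\<in>E. x \<in> e \<and> y \<in> e}"

lemma disjoint_unique:
  "disjoint P \<Longrightarrow> e \<in> P \<Longrightarrow> e' \<in> P \<Longrightarrow> x \<in> e \<Longrightarrow> x \<in> e' \<Longrightarrow> e = e'"
  unfolding disjoint_def by blast

definition components :: "'a set \<Rightarrow> 'a set set \<Rightarrow> 'a set set" where
  "components V E = V // (joined E)\<^sup>*"

lemma sym_joined_rtrancl: "sym ((joined E)\<^sup>*)"
  by (rule sym_rtrancl) (auto simp: sym_def joined_def)

lemma joined_rtrancl_closed: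
  assumes "(x, y) \<in> (joined E)\<^sup>*" "x \<in> B" "\<And>e. e \<in> E \<Longrightarrow> e \<inter> B \<noteq> {} \<Longrightarrow> e \<subseteq> B"
  shows "y \<in> B"
  using assms(1,2)
proof (induction rule: rtrancl_induct)
  case (step y z)
  then obtain e where "e \<in> E" "y \<in> e" "z \<in> e" by (auto simp: joined_def)
  with step assms(3)[of e] show ?case by auto
qed

lemma joined_edge: "e \<in> E \<Longrightarrow> x \<in> e \<Longrightarrow> y \<in> e \<Longrightarrow> (x, y) \<in> (joined E)\<^sup>*"
  by (rule r_into_rtrancl) (auto simp: joined_def)

lemma joined_rtrancl_trans:
  "(x, y) \<in> (joined E)\<^sup>* \<Longrightarrow> (y, z) \<in> (joined E)\<^sup>* \<Longrightarrow> (x, z) \<in> (joined E)\<^sup>*"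
  by (rule rtrancl_trans)

lemma joined_rtrancl_sym: "(x, y) \<in> (joined E)\<^sup>* \<Longrightarrow> (y, x) \<in> (joined E)\<^sup>*"
  using sym_joined_rtrancl by (metis symD)

text \<open>Closure under edges puts each component inside a block, and connectedness puts each
  block inside a component.\<close>

lemma components_eqI:
  assumes P: "partition_on V P"
    and edge: "\<And>e B. e \<in> E \<Longrightarrow> B \<in> P \<Longrightarrow> e \<inter> B \<noteq> {} \<Longrightarrow> e \<subseteq> B"
    and conn: "\<And>B x y. B \<in> P \<Longrightarrow> x \<in> B \<Longrightarrow> y \<in> B \<Longrightarrow> (x, y) \<in> (joined E)\<^sup>*"
  shows "components V E = P"
proof -
  have cls: "(joined E)\<^sup>* `` {x} = B" if "B \<in> P" "x \<in> B" for B x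
    using joined_rtrancl_closed[of x _ E B] edge conn that by blast
  have U: "\<Union>P = V" and ne: "{} \<notin> P" using P by (auto simp: partition_on_def)
  show ?thesis
  proof (intro subset_antisym subsetI)
    fix C assume "C \<in> components V E"
    then obtain x where x: "x \<in> V" "C = (joined E)\<^sup>* `` {x}"
      by (auto simp: components_def quotient_def)
    then obtain B where "B \<in> P" "x \<in> B" using U by blast
    with x cls show "C \<in> P" by metis
  next
    fix B assume B: "B \<in> P"
    then obtain x where "x \<in> B" using ne by (metis equals0I)
    moreover from this have "x \<in> V" using U B by blast
    ultimately show "B \<in> components V E" using cls[OF B]
      unfolding components_def quotient_def by blast
  qed
qed

lemma component_edge:
  assumes "C \<in> components V E" "e \<in> E" "e \<inter> C \<noteq> {}"
  shows "e \<subseteq> C"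
proof -
  obtain x where C: "C = (joined E)\<^sup>* `` {x}" using assms(1) by (auto simp: components_def quotient_def)
  obtain y where y: "y \<in> e" "y \<in> C" using assms(3) by blast
  have "(x, z) \<in> (joined E)\<^sup>*" if "z \<in> e" for z
  proof -
    have "(y, z) \<in> joined E" using y that assms(2) by (auto simp: joined_def)
    with y C show ?thesis by (auto intro: rtrancl_into_rtrancl)
  qed
  then show ?thesis using C by auto
qed

lemma component_connected:
  assumes "C \<in> components V E" "x \<in> C" "y \<in> C"
  shows "(x, y) \<in> (joined E)\<^sup>*"
  using assms unfolding components_def quotient_def
  by (auto intro: joined_rtrancl_trans joined_rtrancl_sym)

lemma component_closed:
  assumes "C \<in> components V E" "x \<in> C" "(x, y) \<in> (joined E)\<^sup>*"
  shows "y \<in> C"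
  using assms unfolding components_def quotient_def
  by (auto intro: joined_rtrancl_trans)

lemma components_partition_on:
  assumes "\<Union>E \<subseteq> V"
  shows "partition_on V (components V E)"
  unfolding partition_on_def
proof (intro conjI)
  have sub: "y \<in> V" if "(x, y) \<in> (joined E)\<^sup>*" "x \<in> V" for x y
    using joined_rtrancl_closed[OF that] assms by blast
  then show "\<Union> (components V E) = V"
    unfolding components_def quotient_def by auto
  show "disjoint (components V E)"
  proof (rule disjointI)
    fix C C' assume C: "C \<in> components V E" "C' \<in> components V E" "C \<noteq> C'"
    show "C \<inter> C' = {}"
    proof (rule ccontr)
      assume "C \<inter> C' \<noteq> {}"
      then obtain x where x: "x \<in> C" "x \<in> C'" by blast
      have "y \<in> C \<longleftrightarrow> y \<in> C'" for y
        using component_connected[OF C(1) x(1), of y] component_closed[OF C(1) x(1), of y]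
          component_connected[OF C(2) x(2), of y] component_closed[OF C(2) x(2), of y] by blast
      with C(3) show False by blast
    qed
  qed
  show "{} \<notin> components V E" unfolding components_def quotient_def by auto
qed

lemma components_partition_lines:
  assumes "partition_on V L"
  shows "components V L = L"
proof (rule components_eqI[OF assms])
  show "e \<subseteq> B" if "e \<in> L" "B \<in> L" "e \<inter> B \<noteq> {}" for e B
    using assms that by (auto simp: partition_on_def disjoint_def)
  show "(x, y) \<in> (joined L)\<^sup>*" if "B \<in> L" "x \<in> B" "y \<in> B" for B x y
    using that by (auto simp: joined_def)
qed

text \<open>A quotient map with connected fibres neither merges nor splits components, so taking
  preimages matches them up. It serves three times: to shrink two lines that are glued together, to
  identify the glued points of two diagrams, and to straighten the strands of an identity
  diagram.\<close>

lemma components_pullback: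
  assumes f: "f ` V = V'" and E': "\<Union>E' \<subseteq> V'" and E: "\<Union>E \<subseteq> V"
    and edge: "\<And>e x y. e \<in> E \<Longrightarrow> x \<in> e \<Longrightarrow> y \<in> e \<Longrightarrow> (f x, f y) \<in> (joined E')\<^sup>*"
    and lift: "\<And>e x' y'. e \<in> E' \<Longrightarrow> x' \<in> e \<Longrightarrow> y' \<in> e \<Longrightarrow>
        \<exists>x\<in>V. \<exists>y\<in>V. f x = x' \<and> f y = y' \<and> (x, y) \<in> (joined E)\<^sup>*"
    and fibre: "\<And>x y. x \<in> V \<Longrightarrow> y \<in> V \<Longrightarrow> f x = f y \<Longrightarrow> (x, y) \<in> (joined E)\<^sup>*"
  shows "bij_betw (\<lambda>C'. V \<inter> f -` C') (components V' E') (components V E)"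
proof -
  let ?\<phi> = "\<lambda>C'. V \<inter> f -` C'"
  have P': "partition_on V' (components V' E')" by (rule components_partition_on[OF E'])
  have V'U: "\<Union>(components V' E') = V'" and ne: "{} \<notin> components V' E'"
    and disj: "disjoint (components V' E')" using P' by (auto simp: partition_on_def)
  have img: "f ` ?\<phi> C' = C'" if "C' \<in> components V' E'" for C'
  proof -
    have "C' \<subseteq> f ` V" using that V'U f by blast
    then show ?thesis by blast
  qed
  have inj: "inj_on ?\<phi> (components V' E')"
    by (rule inj_on_inverseI[where g = "image f"]) (rule img)
  have reach: "(x, y) \<in> (joined E)\<^sup>*" if xy: "x \<in> V" "y \<in> V" "(f x, f y) \<in> (joined E')\<^sup>*" for x y
  proof -
    \<comment> \<open>The claim covers the whole fibre over \<open>z\<close>, because the lift of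
      the next edge may start at any point of that fibre.\<close>
    have "\<forall>y\<in>V. f y = z \<longrightarrow> (x, y) \<in> (joined E)\<^sup>*" if "(f x, z) \<in> (joined E')\<^sup>*" for z
      using that
    proof (induction rule: rtrancl_induct)
      case base
      then show ?case using fibre xy by auto
    next
      case (step u w)
      then obtain e where "e \<in> E'" "u \<in> e" "w \<in> e" by (auto simp: joined_def)
      then obtain s t where st: "s \<in> V" "t \<in> V" "f s = u" "f t = w" "(s, t) \<in> (joined E)\<^sup>*"
        using lift by blast
      show ?case
      proof (intro ballI impI)
        fix y assume "y \<in> V" "f y = w"
        then have "(t, y) \<in> (joined E)\<^sup>*" using fibre st by auto
        moreover have "(x, s) \<in> (joined E)\<^sup>*" using step.IH st by blast
        ultimately show "(x, y) \<in> (joined E)\<^sup>*" using st(5) joined_rtrancl_trans by metis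
      qed
    qed
    with xy show ?thesis by blast
  qed
  have "components V E = ?\<phi> ` components V' E'"
  proof (rule components_eqI)
    show "partition_on V (?\<phi> ` components V' E')"
      unfolding partition_on_def
    proof (intro conjI)
      show "\<Union> (?\<phi> ` components V' E') = V" using V'U f by blast
      show "disjoint (?\<phi> ` components V' E')"
      proof (rule disjointI)
        fix A B assume "A \<in> ?\<phi> ` components V' E'" "B \<in> ?\<phi> ` components V' E'" "A \<noteq> B"
        then obtain C C' where "C \<in> components V' E'" "C' \<in> components V' E'"
          "A = ?\<phi> C" "B = ?\<phi> C'" "C \<noteq> C'" by blast
        then show "A \<inter> B = {}" using disj unfolding disjoint_def by blast
      qed
      show "{} \<notin> ?\<phi> ` components V' E'" using img ne by fastforce
    qed
  next
    fix e B assume e: "e \<in> E" "B \<in> ?\<phi> ` components V' E'" "e \<inter> B \<noteq> {}"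
    then obtain C where C: "C \<in> components V' E'" "B = ?\<phi> C" by blast
    obtain x where x: "x \<in> e" "f x \<in> C" using e C by blast
    show "e \<subseteq> B"
    proof
      fix y assume "y \<in> e"
      then have "f y \<in> C" using component_closed[OF C(1) x(2)] edge[OF e(1) x(1)] by blast
      with \<open>y \<in> e\<close> e(1) E C show "y \<in> B" by blast
    qed
  next
    fix B x y assume "B \<in> ?\<phi> ` components V' E'" and xy: "x \<in> B" "y \<in> B"
    then obtain C where C: "C \<in> components V' E'" "B = ?\<phi> C" by blast
    show "(x, y) \<in> (joined E)\<^sup>*"
      using reach component_connected[OF C(1)] xy C(2) by blast
  qed
  with inj show ?thesis by (simp add: bij_betw_def)
qed

text \<open>
  The last three entries are the exponents of \<open>\<alpha>\<close>, \<open>\<beta>\<close> and \<open>\<gamma>\<close> in the factor of a product.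
\<close>

definition outcome ::
    "'c set \<Rightarrow> ('c \<Rightarrow> 'a set) \<Rightarrow> ('c \<Rightarrow> nat) \<Rightarrow> ('a set set \<times> 'a set set) \<times> nat \<times> nat \<times> nat" where
  "outcome Cs ends k =
     (({ends C | C. C \<in> Cs \<and> ends C \<noteq> {}}, {ends C | C. C \<in> Cs \<and> ends C \<noteq> {} \<and> k C > 0}),
      card {C \<in> Cs. ends C = {} \<and> k C = 0},
      (\<Sum>C\<in>Cs. k C - 1),
      card {C \<in> Cs. ends C = {} \<and> k C > 0})"

fun scale :: "nat \<Rightarrow> nat \<Rightarrow> nat \<Rightarrow> 'd \<times> nat \<times> nat \<times> nat \<Rightarrow> 'd \<times> nat \<times> nat \<times> nat" where
  "scale i j k (d, a, b, c) = (d, a + i, b + j, c + k)"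

lemma Collect_image_eq: "{f x |x. P x} = f ` {x. P x}"
  by blast

lemma outcome_reindex:
  assumes "bij_betw \<phi> Cs' Cs"
    and "\<And>C. C \<in> Cs' \<Longrightarrow> ends (\<phi> C) = ends' C" "\<And>C. C \<in> Cs' \<Longrightarrow> k (\<phi> C) = k' C"
  shows "outcome Cs ends k = outcome Cs' ends' k'"
proof -
  have Cs: "Cs = \<phi> ` Cs'" and inj: "inj_on \<phi> Cs'" using assms(1) by (auto simp: bij_betw_def)
  have S: "{C \<in> Cs. P (ends C) (k C)} = \<phi> ` {C \<in> Cs'. P (ends' C) (k' C)}" for P
    unfolding Cs using assms(2,3) by (auto simp: image_iff)
  have img: "ends ` {C \<in> Cs. P (ends C) (k C)} = ends' ` {C \<in> Cs'. P (ends' C) (k' C)}" for P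
    unfolding S image_image using assms(2) by (intro image_cong) auto
  have 1: "{ends C | C. C \<in> Cs \<and> ends C \<noteq> {}} = {ends' C | C. C \<in> Cs' \<and> ends' C \<noteq> {}}"
    unfolding Collect_image_eq using img[of "\<lambda>e k. e \<noteq> {}"] by simp
  have 2: "{ends C | C. C \<in> Cs \<and> ends C \<noteq> {} \<and> k C > 0}
      = {ends' C | C. C \<in> Cs' \<and> ends' C \<noteq> {} \<and> k' C > 0}"
    unfolding Collect_image_eq using img[of "\<lambda>e k. e \<noteq> {} \<and> k > 0"] by simp
  have card: "card {C \<in> Cs. P (ends C) (k C)} = card {C \<in> Cs'. P (ends' C) (k' C)}" for P
  proof -
    have "inj_on \<phi> {C \<in> Cs'. P (ends' C) (k' C)}"
      using inj by (auto simp: inj_on_def)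
    then show ?thesis unfolding S by (simp add: card_image)
  qed
  have 3: "(\<Sum>C\<in>Cs. k C - 1) = (\<Sum>C\<in>Cs'. k' C - 1)"
    unfolding Cs by (subst sum.reindex[OF inj]) (auto intro!: sum.cong simp: assms(3))
  show ?thesis unfolding outcome_def 1 2 3
    using card[of "\<lambda>e k. e = {} \<and> k = 0"] card[of "\<lambda>e k. e = {} \<and> k > 0"] by simp
qed

text \<open>The truncated difference \<open>k C0 - 1\<close> grows with \<open>k C0\<close> only if
  a blob is already present; this is why \<open>k' C0 > 0\<close> is required. Under this condition
  the decorated components stay the same.\<close>

lemma outcome_merge:
  assumes "finite Cs" "C0 \<in> Cs" "k C0 = Suc (k' C0)" "k' C0 > 0"
    and "\<And>C. C \<in> Cs \<Longrightarrow> C \<noteq> C0 \<Longrightarrow> k C = k' C"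
  shows "outcome Cs ends k = scale 0 1 0 (outcome Cs ends k')"
proof -
  have pos: "k C > 0 \<longleftrightarrow> k' C > 0" "k C = 0 \<longleftrightarrow> k' C = 0" if "C \<in> Cs" for C
    using assms that by (cases "C = C0"; simp)+
  have "(\<Sum>C\<in>Cs. k C - 1) = (k C0 - 1) + (\<Sum>C\<in>Cs - {C0}. k C - 1)"
    using assms by (intro sum.remove) auto
  also have "(\<Sum>C\<in>Cs - {C0}. k C - 1) = (\<Sum>C\<in>Cs - {C0}. k' C - 1)"
    using assms by (intro sum.cong) auto
  also have "(k C0 - 1) = Suc (k' C0 - 1)" using assms by simp
  also have "Suc (k' C0 - 1) + (\<Sum>C\<in>Cs - {C0}. k' C - 1) = Suc (\<Sum>C\<in>Cs. k' C - 1)"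
    using sum.remove[of Cs C0 "\<lambda>C. k' C - 1"] assms by simp
  finally show ?thesis
    unfolding outcome_def using pos by (auto cong: conj_cong intro!: arg_cong[where f = card])
qed

text \<open>With at most one blob, the new closed component adds nothing to the exponent of \<beta>;
  it counts for \<alpha> or for \<gamma>.\<close>

lemma outcome_insert_closed:
  assumes "finite Cs" "C0 \<notin> Cs" "ends C0 = {}" "k C0 \<le> 1"
  shows "outcome (insert C0 Cs) ends k = scale (1 - k C0) 0 (k C0) (outcome Cs ends k)"
proof -
  have 1: "{C \<in> insert C0 Cs. ends C = {} \<and> k C = 0} =
      (if k C0 = 0 then insert C0 {C \<in> Cs. ends C = {} \<and> k C = 0}
       else {C \<in> Cs. ends C = {} \<and> k C = 0})"
    and 2: "{C \<in> insert C0 Cs. ends C = {} \<and> 0 < k C} =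
      (if k C0 = 0 then {C \<in> Cs. ends C = {} \<and> 0 < k C}
       else insert C0 {C \<in> Cs. ends C = {} \<and> 0 < k C})"
    using assms(3) by (cases "k C0 = 0"; auto)+
  have 3: "{ends C |C. C \<in> insert C0 Cs \<and> ends C \<noteq> {}} = {ends C |C. C \<in> Cs \<and> ends C \<noteq> {}}"
    and 4: "{ends C |C. C \<in> insert C0 Cs \<and> ends C \<noteq> {} \<and> 0 < k C} =
      {ends C |C. C \<in> Cs \<and> ends C \<noteq> {} \<and> 0 < k C}"
    using assms(3) by (intro Collect_cong, metis insert_iff)+
  have 5: "(\<Sum>C\<in>insert C0 Cs. k C - 1) = (\<Sum>C\<in>Cs. k C - 1)" using assms by simp
  have "k C0 = 0 \<or> k C0 = 1" using assms by linarith
  moreover have "card (insert C0 {C \<in> Cs. P C}) = Suc (card {C \<in> Cs. P C})" for P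
    using assms(1,2) by simp
  ultimately show ?thesis unfolding outcome_def 1 2 3 4 5 by (elim disjE) (simp_all only: scale.simps, simp_all)
qed

section \<open>Gluing a diagram along pairs of its points\<close>

definition blobs :: "'a set set \<Rightarrow> 'a set \<Rightarrow> nat" where
  "blobs D C = card {l \<in> D. l \<subseteq> C}"

text \<open>Glued points stay distinct and are joined by the pairs in \<open>M\<close>, whereas in
  the stack they coincide. Lines of two juxtaposed factors are therefore never equal as sets, and a
  single set of decorated lines suffices to count blobs. The ends of a component are its points
  outside all pairs.\<close>

definition glue ::
    "'a set \<Rightarrow> 'a set set \<times> 'a set set \<Rightarrow> 'a set set \<Rightarrow> ('a set set \<times> 'a set set) \<times> nat \<times> nat \<times> nat"
  where
  "glue V d M = outcome (components V (fst d \<union> M)) (\<lambda>C. C - \<Union>M) (blobs (snd d))"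

text \<open>Final stage of every sequence of contractions: each line is a component and contains no
  other line, so it carries at most its own blob and no factor arises.\<close>

lemma glue_empty:
  assumes P: "partition_on V L" and "D \<subseteq> L"
  shows "glue V (L, D) {} = ((L, D), 0, 0, 0)"
proof -
  have ne: "{} \<notin> L" and dis: "disjoint L" using P by (auto simp: partition_on_def)
  have eq: "{l \<in> D. l \<subseteq> C} = (if C \<in> D then {C} else {})" if "C \<in> L" for C
  proof -
    have "l = C" if "l \<in> D" "l \<subseteq> C" for l
    proof (rule ccontr)
      assume "l \<noteq> C"
      then have "l \<inter> C = {}" using dis that \<open>C \<in> L\<close> \<open>D \<subseteq> L\<close> by (auto simp: disjoint_def)
      with that ne \<open>D \<subseteq> L\<close> show False by (metis Int_absorb2 subsetD)
    qed
    then show ?thesis by auto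
  qed
  have b: "blobs D C = (if C \<in> D then 1 else 0)" if "C \<in> L" for C
    unfolding blobs_def using eq[OF that] by simp
  have "{C. C \<in> L \<and> C \<noteq> {} \<and> C \<in> D} = D" using assms ne by auto
  then have "{C |C. C \<in> L \<and> C \<noteq> {} \<and> 0 < blobs D C} = D"
    using b by (auto split: if_splits cong: conj_cong)
  moreover have "{C |C. C \<in> L \<and> C \<noteq> {}} = L" using ne by auto
  ultimately show ?thesis
    unfolding glue_def outcome_def fst_conv snd_conv using b ne
    by (simp add: components_partition_lines[OF P] card_eq_0_iff)
qed

text \<open>The line and the pair \<open>{p, q}\<close> form a component of their own, cut off from
  the rest because lines are disjoint and so are pairs. It is a closed loop with at most one
  blob.\<close>

lemma glue_loop:
  assumes P: "partition_on V L" and fin: "finite V" and D: "D \<subseteq> L"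
    and pq: "{p, q} \<in> L" "{p, q} \<in> M" and M: "disjoint M" "\<Union>M \<subseteq> V"
  shows "glue V (L, D) M =
    scale (if {p, q} \<in> D then 0 else 1) 0 (if {p, q} \<in> D then 1 else 0)
      (glue (V - {p, q}) (L - {{p, q}}, D - {{p, q}}) (M - {{p, q}}))"
proof -
  let ?l = "{p, q}" and ?L = "L - {{p, q}}" and ?M = "M - {{p, q}}" and ?V = "V - {p, q}"
  have UL: "\<Union>L = V" and dis: "disjoint L" and ne: "{} \<notin> L" using P by (auto simp: partition_on_def)
  have out: "\<Union>?L \<inter> ?l = {}" "\<Union>?M \<inter> ?l = {}"
    using disjoint_unique[OF dis pq(1)] disjoint_unique[OF M(1) pq(2)] by auto
  have E': "\<Union>(?L \<union> ?M) \<subseteq> ?V" using out UL M by blast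
  let ?Cs = "components ?V (?L \<union> ?M)"
  have P': "partition_on ?V ?Cs" by (rule components_partition_on[OF E'])
  have disC: "C \<inter> ?l = {}" if "C \<in> ?Cs" for C using P' that unfolding partition_on_def by blast
  have Cs: "components V (L \<union> M) = insert ?l ?Cs"
  proof (rule components_eqI)
    have "\<Union>(insert ?l ?Cs) = V" using P' pq UL by (auto simp: partition_on_def)
    moreover have "disjoint (insert ?l ?Cs)"
      using P' disC by (auto simp: partition_on_def pairwise_insert disjnt_def disjoint_def)
    ultimately show "partition_on V (insert ?l ?Cs)" using P' by (auto simp: partition_on_def)
  next
    fix e B assume e: "e \<in> L \<union> M" "B \<in> insert ?l ?Cs" "e \<inter> B \<noteq> {}"
    show "e \<subseteq> B"
    proof (cases "B = ?l")
      case True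
      then show ?thesis using e out by blast
    next
      case False
      then have "B \<in> ?Cs" using e by blast
      moreover have "e \<noteq> ?l" using disC[OF \<open>B \<in> ?Cs\<close>] e by blast
      ultimately show ?thesis using component_edge[of B ?V "?L \<union> ?M" e] e by blast
    qed
  next
    fix B x y assume B: "B \<in> insert ?l ?Cs" "x \<in> B" "y \<in> B"
    have mono: "(joined (?L \<union> ?M))\<^sup>* \<subseteq> (joined (L \<union> M))\<^sup>*"
      by (rule rtrancl_mono) (auto simp: joined_def)
    show "(x, y) \<in> (joined (L \<union> M))\<^sup>*"
    proof (cases "B = ?l")
      case True
      then show ?thesis using B pq by (intro r_into_rtrancl) (auto simp: joined_def)
    next
      case False
      then show ?thesis using component_connected[of B ?V "?L \<union> ?M" x y] B mono by blast
    qed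
  qed
  have fin': "finite ?Cs" using P' fin finite_elements by (metis finite_Diff)
  have notin: "?l \<notin> ?Cs" using disC by blast
  have kb: "blobs D C = blobs (D - {?l}) C" if "C \<in> ?Cs" for C
    unfolding blobs_def using disC[OF that] by (intro arg_cong[where f = card]) auto
  have "{l \<in> D. l \<subseteq> ?l} = (if ?l \<in> D then {?l} else {})"
  proof -
    have "l = ?l" if "l \<in> D" "l \<subseteq> ?l" for l
    proof (rule ccontr)
      assume "l \<noteq> ?l"
      then have "l \<subseteq> \<Union>?L" using that D by blast
      then have "l = {}" using that out(1) by blast
      then show False using that D ne by blast
    qed
    then show ?thesis by auto
  qed
  then have k0: "blobs D ?l = (if ?l \<in> D then 1 else 0)" unfolding blobs_def by simp
  have "glue V (L, D) M = outcome (insert ?l ?Cs) (\<lambda>C. C - \<Union>M) (blobs D)"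
    unfolding glue_def fst_conv snd_conv Cs ..
  also have "\<dots> = scale (1 - blobs D ?l) 0 (blobs D ?l) (outcome ?Cs (\<lambda>C. C - \<Union>M) (blobs D))"
    by (rule outcome_insert_closed) (use fin' notin pq k0 in auto)
  also have "outcome ?Cs (\<lambda>C. C - \<Union>M) (blobs D) = outcome ?Cs (\<lambda>C. C - \<Union>?M) (blobs (D - {?l}))"
    by (rule outcome_reindex[where \<phi> = id]) (use kb disC pq in \<open>auto simp: bij_betw_def\<close>)
  finally show ?thesis using k0 unfolding glue_def by simp
qed

lemma Collect_subset_split:
  assumes "A \<subseteq> S \<longleftrightarrow> t" "B \<subseteq> S \<longleftrightarrow> t" "\<And>l. l \<in> D - {A, B} \<Longrightarrow> l \<subseteq> S \<longleftrightarrow> l \<subseteq> C"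
  shows "{l \<in> D. l \<subseteq> S} = {l \<in> D - {A, B}. l \<subseteq> C} \<union> (if t then D \<inter> {A, B} else {})"
proof -
  have "l \<in> D \<and> l \<subseteq> S \<longleftrightarrow> (l \<in> D - {A, B} \<and> l \<subseteq> C) \<or> (t \<and> l \<in> D \<inter> {A, B})" for l
    using assms by blast
  then show ?thesis by (cases t) (simp_all add: set_eq_iff)
qed

text \<open>Both lines and the pair \<open>{p, q}\<close> lie on one component, and shrinking them
  to \<open>{a, b}\<close> changes neither the components nor their free ends. If both lines are
  decorated, one blob disappears from a component that keeps another one, and this accounts for the
  factor \<beta>.\<close>

lemma glue_join:
  assumes P: "partition_on V L" and fin: "finite V" and D: "D \<subseteq> L"
    and lines: "{p, a} \<in> L" "{q, b} \<in> L" "{p, a} \<noteq> {q, b}" "p \<noteq> a" "q \<noteq> b"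
    and pq: "{p, q} \<in> M" and M: "disjoint M" "\<Union>M \<subseteq> V"
    and L': "L' = insert {a, b} (L - {{p, a}, {q, b}})"
    and D': "D' = (D - {{p, a}, {q, b}}) \<union> (if {p, a} \<in> D \<or> {q, b} \<in> D then {{a, b}} else {})"
  shows "glue V (L, D) M =
    scale 0 (if {p, a} \<in> D \<and> {q, b} \<in> D then 1 else 0) 0 (glue (V - {p, q}) (L', D') (M - {{p, q}}))"
proof -
  let ?M = "M - {{p, q}}" and ?V = "V - {p, q}"
  have UL: "\<Union>L = V" and dis: "disjoint L" and ne: "{} \<notin> L" using P by (auto simp: partition_on_def)
  have "{p, a} \<inter> {q, b} = {}" using dis lines by (auto simp: disjoint_def)
  then have dist: "p \<noteq> q" "p \<noteq> b" "a \<noteq> q" "a \<noteq> b" "p \<noteq> a" "q \<noteq> b" using lines by auto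
  have inV: "p \<in> V" "q \<in> V" "a \<in> V" "b \<in> V" using UL lines by auto
  have away: "e \<inter> {p, q, a, b} = {}" if "e \<in> L" "e \<noteq> {p, a}" "e \<noteq> {q, b}" for e
    using disjoint_unique[OF dis that(1) lines(1)] disjoint_unique[OF dis that(1) lines(2)] that by auto
  have outM: "\<Union>?M \<inter> {p, q} = {}" using disjoint_unique[OF M(1) pq] by auto
  have E: "\<Union>(L \<union> M) \<subseteq> V" using UL M by blast
  have UL': "\<Union>L' \<subseteq> ?V" using L' away UL inV dist by blast
  have E': "\<Union>(L' \<union> ?M) \<subseteq> ?V" using UL' outM M by blast
  \<comment> \<open>Each of the two lines is shrunk to its far end, so the fibres are these two
    lines and single points.\<close>
  define f where "f = id(p := a, q := b)"
  have fs: "f p = a" "f q = b" "f a = a" "f b = b" using dist by (auto simp: f_def)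
  have fid: "f x = x" if "x \<noteq> p" "x \<noteq> q" for x using that by (auto simp: f_def)
  let ?R = "(joined (L \<union> M))\<^sup>*"
  have pa: "(p, a) \<in> ?R" and qb: "(q, b) \<in> ?R" and pq': "(p, q) \<in> ?R"
    using joined_edge[of "{p, a}"] joined_edge[of "{q, b}"] joined_edge[of "{p, q}"] lines pq by auto
  have tof: "(x, f x) \<in> ?R" for x
    using pa qb by (cases "x = p"; cases "x = q") (auto simp: fs fid)
  have ab': "(a, b) \<in> (joined (L' \<union> ?M))\<^sup>*" by (rule joined_edge[of "{a, b}"]) (auto simp: L')
  have ab: "(a, b) \<in> ?R" using pa qb pq' by (meson joined_rtrancl_sym joined_rtrancl_trans)
  have bij: "bij_betw (\<lambda>C'. V \<inter> f -` C') (components ?V (L' \<union> ?M)) (components V (L \<union> M))"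
  proof (rule components_pullback)
    have "f x \<in> ?V" if "x \<in> V" for x using that inV dist by (auto simp: f_def)
    moreover have "x = f x" "x \<in> V" if "x \<in> ?V" for x using that fid by auto
    ultimately show "f ` V = ?V" by blast
    show "\<Union> (L' \<union> ?M) \<subseteq> ?V" "\<Union> (L \<union> M) \<subseteq> V" by fact+
  next
    fix e x y assume e: "e \<in> L \<union> M" "x \<in> e" "y \<in> e"
    show "(f x, f y) \<in> (joined (L' \<union> ?M))\<^sup>*"
    proof (cases "e = {p, a} \<or> e = {q, b} \<or> e = {p, q}")
      case True
      then have "{f x, f y} \<subseteq> {a, b}" using e fs by auto
      then show ?thesis using ab' joined_rtrancl_sym[OF ab'] by auto
    next
      case False
      then have "e \<in> L' \<union> ?M" using e L' by auto
      moreover from this have "p \<notin> e" "q \<notin> e" using E' by blast+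
      then have "f x = x" "f y = y" using fid e by metis+
      ultimately show ?thesis using e by (auto intro!: r_into_rtrancl simp: joined_def)
    qed
  next
    fix e x y assume e: "e \<in> L' \<union> ?M" "x \<in> e" "y \<in> e"
    then have xy: "x \<in> ?V" "y \<in> ?V" using E' by blast+
    moreover have "(x, y) \<in> ?R"
    proof (cases "e = {a, b}")
      case True
      then show ?thesis using e ab joined_rtrancl_sym[OF ab] by auto
    next
      case False
      then have "e \<in> L \<union> M" using e L' by auto
      then show ?thesis using e joined_edge by metis
    qed
    ultimately show "\<exists>u\<in>V. \<exists>v\<in>V. f u = x \<and> f v = y \<and> (u, v) \<in> ?R"
      using fid[of x] fid[of y] by blast
  next
    fix x y assume "f x = f y"
    then show "(x, y) \<in> ?R" using tof[of x] tof[of y]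
      by (metis joined_rtrancl_sym joined_rtrancl_trans)
  qed
  let ?Cs = "components ?V (L' \<union> ?M)"
  have P': "partition_on ?V ?Cs" by (rule components_partition_on[OF E'])
  have subC: "C \<subseteq> ?V" if "C \<in> ?Cs" for C using P' that unfolding partition_on_def by blast
  have fin': "finite ?Cs" using P' fin finite_elements by (metis finite_Diff)
  have abC: "a \<in> C \<longleftrightarrow> b \<in> C" if "C \<in> ?Cs" for C
    using component_closed[OF that _ ab'] component_closed[OF that _ joined_rtrancl_sym[OF ab']] by blast
  let ?D0 = "D - {{p, a}, {q, b}}"
  define k where "k = (\<lambda>C'. blobs D (V \<inter> f -` C'))"
  have base: "l \<subseteq> V \<inter> f -` C \<longleftrightarrow> l \<subseteq> C" if "l \<in> ?D0" "C \<in> ?Cs" for l C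
  proof -
    have "l \<in> L" "l \<inter> {p, q, a, b} = {}" using away that D by auto
    then have "l \<subseteq> V" "\<And>x. x \<in> l \<Longrightarrow> f x = x" using UL fid by blast+
    then show ?thesis using subC that by auto
  qed
  have ends: "{p, a} \<subseteq> V \<inter> f -` C \<longleftrightarrow> a \<in> C" "{q, b} \<subseteq> V \<inter> f -` C \<longleftrightarrow> a \<in> C"
    if "C \<in> ?Cs" for C using abC[OF that] fs inV by auto
  have finD: "finite D" using D finite_elements[OF fin P] finite_subset by blast
  \<comment> \<open>The joined line is really new, as it meets two different old lines; it therefore
    raises the blob count by exactly one when it is decorated.\<close>
  have abnot: "{a, b} \<notin> D" using D away[of "{a, b}"] dist lines by (auto simp: doubleton_eq_iff)
  have k: "k C = blobs ?D0 C + (if a \<in> C then card (D \<inter> {{p, a}, {q, b}}) else 0)" if "C \<in> ?Cs" for C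
  proof -
    have "{l \<in> D. l \<subseteq> V \<inter> f -` C} = {l \<in> ?D0. l \<subseteq> C} \<union> (if a \<in> C then D \<inter> {{p, a}, {q, b}} else {})"
      by (rule Collect_subset_split[OF ends[OF that]]) (rule base[OF _ that])
    moreover have "card \<dots> = card {l \<in> ?D0. l \<subseteq> C} + card (if a \<in> C then D \<inter> {{p, a}, {q, b}} else {})"
      using finD by (intro card_Un_disjoint) auto
    ultimately show ?thesis unfolding k_def blobs_def by simp
  qed
  have k': "blobs D' C = blobs ?D0 C + (if a \<in> C \<and> ({p, a} \<in> D \<or> {q, b} \<in> D) then 1 else 0)"
    if "C \<in> ?Cs" for C
  proof -
    have "{l \<in> D'. l \<subseteq> C} = {l \<in> ?D0. l \<subseteq> C} \<union> (if a \<in> C \<and> ({p, a} \<in> D \<or> {q, b} \<in> D) then {{a, b}} else {})"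
      using abC[OF that] unfolding D' by auto
    moreover have "card \<dots> = card {l \<in> ?D0. l \<subseteq> C} +
        card (if a \<in> C \<and> ({p, a} \<in> D \<or> {q, b} \<in> D) then {{a, b}} else {})"
      using finD abnot by (intro card_Un_disjoint) auto
    ultimately show ?thesis unfolding blobs_def by simp
  qed
  have "glue V (L, D) M = outcome ?Cs (\<lambda>C. C - \<Union>?M) k"
    unfolding glue_def
  proof (rule outcome_reindex)
    show "bij_betw (\<lambda>C'. V \<inter> f -` C') ?Cs (components V (fst (L, D) \<union> M))" using bij by simp
    fix C assume C: "C \<in> ?Cs"
    show "blobs (snd (L, D)) (V \<inter> f -` C) = k C" by (simp add: k_def)
    have "x \<in> V \<inter> f -` C - \<Union> M \<longleftrightarrow> x \<in> C - \<Union> ?M" for x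
    proof (cases "x = p \<or> x = q")
      case True
      then show ?thesis using pq subC[OF C] by blast
    next
      case False
      then have "f x = x" "x \<in> \<Union>M \<longleftrightarrow> x \<in> \<Union>?M" using fid by auto
      then show ?thesis using subC[OF C] by auto
    qed
    then show "V \<inter> f -` C - \<Union> M = C - \<Union> ?M" by blast
  qed
  also have "\<dots> = scale 0 (if {p, a} \<in> D \<and> {q, b} \<in> D then 1 else 0) 0
      (outcome ?Cs (\<lambda>C. C - \<Union>?M) (blobs D'))"
  proof (cases "{p, a} \<in> D \<and> {q, b} \<in> D")
    case True
    then have c2: "card (D \<inter> {{p, a}, {q, b}}) = 2" using lines by (simp add: Int_absorb1)
    \<comment> \<open>Only the component through \<open>a\<close> changes its count: two blobs from
      the old lines become one on the new line.\<close>
    obtain C0 where C0: "C0 \<in> ?Cs" "a \<in> C0"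
      using P' inV dist unfolding partition_on_def by blast
    have uniq: "a \<notin> C" if "C \<in> ?Cs" "C \<noteq> C0" for C
      using that C0 P' unfolding partition_on_def disjoint_def by blast
    have "outcome ?Cs (\<lambda>C. C - \<Union>?M) k = scale 0 1 0 (outcome ?Cs (\<lambda>C. C - \<Union>?M) (blobs D'))"
      by (rule outcome_merge[where ?C0.0 = C0]) (use fin' C0 uniq k k' True c2 in auto)
    with True show ?thesis by simp
  next
    case False
    have "k C = blobs D' C" if "C \<in> ?Cs" for C
    proof -
      have "D \<inter> {{p, a}, {q, b}} = (if {p, a} \<in> D then {{p, a}} else if {q, b} \<in> D then {{q, b}} else {})"
        using False by auto
      then have "card (D \<inter> {{p, a}, {q, b}}) = (if {p, a} \<in> D \<or> {q, b} \<in> D then 1 else 0)"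
        by simp
      then show ?thesis using k[OF that] k'[OF that] by simp
    qed
    then have "outcome ?Cs (\<lambda>C. C - \<Union>?M) k = outcome ?Cs (\<lambda>C. C - \<Union>?M) (blobs D')"
      by (intro outcome_reindex[where \<phi> = id]) auto
    with False show ?thesis by (cases "outcome ?Cs (\<lambda>C. C - \<Union>?M) (blobs D')") simp
  qed
  finally show ?thesis unfolding glue_def by simp
qed

section \<open>Planar diagrams on a line\<close>

text \<open>For a set of even size this is \<open>pair_up\<close> of its increasing list. Ranks are
  expressed by cardinalities instead of list positions, which makes the effect of deleting or moving
  points easy to compute.\<close>

definition consecutive_pairs :: "nat set \<Rightarrow> nat set set" where
  "consecutive_pairs T =
     {{x, y} | x y. x \<in> T \<and> y \<in> T \<and> x < y \<and> T \<inter> {x<..<y} = {} \<and> even (card (T \<inter> {..<x}))}"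

lemma consecutive_pairsE:
  assumes "l \<in> consecutive_pairs T"
  obtains x y where "l = {x, y}" "x \<in> T" "y \<in> T" "x < y" "T \<inter> {x<..<y} = {}"
    "even (card (T \<inter> {..<x}))"
  using assms unfolding consecutive_pairs_def by blast

lemma consecutive_pairsI:
  "x \<in> T \<Longrightarrow> y \<in> T \<Longrightarrow> x < y \<Longrightarrow> T \<inter> {x<..<y} = {} \<Longrightarrow> even (card (T \<inter> {..<x})) \<Longrightarrow>
   {x, y} \<in> consecutive_pairs T"
  unfolding consecutive_pairs_def by blast

lemma rank_Suc:
  fixes x y :: nat
  assumes "x \<in> T" "x < y" "T \<inter> {x<..<y} = {}"
  shows "card (T \<inter> {..<y}) = Suc (card (T \<inter> {..<x}))"
proof -
  have "T \<inter> {..<y} = insert x (T \<inter> {..<x})"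
    using assms by (auto simp: disjoint_iff)
  then show ?thesis by simp
qed

lemma consecutive_pairs_Union_subset: "\<Union>(consecutive_pairs T) \<subseteq> T"
  unfolding consecutive_pairs_def by blast

lemma consecutive_pairs_card: "l \<in> consecutive_pairs T \<Longrightarrow> card l = 2"
  by (erule consecutive_pairsE) auto

text \<open>Left ends have even rank and right ends odd rank, so no point is both; and a point
  determines its neighbour on either side.\<close>

lemma disjoint_consecutive_pairs: "disjoint (consecutive_pairs T)"
proof (rule disjointI)
  fix l m assume "l \<in> consecutive_pairs T" "m \<in> consecutive_pairs T" "l \<noteq> m"
  then obtain x y u v where 1: "l = {x, y}" "x \<in> T" "y \<in> T" "x < y" "T \<inter> {x<..<y} = {}"
    "even (card (T \<inter> {..<x}))" and 2: "m = {u, v}" "u \<in> T" "v \<in> T" "u < v" "T \<inter> {u<..<v} = {}"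
    "even (card (T \<inter> {..<u}))" by (elim consecutive_pairsE) auto
  have o: "odd (card (T \<inter> {..<y}))" "odd (card (T \<inter> {..<v}))"
    using rank_Suc[OF 1(2,4,5)] rank_Suc[OF 2(2,4,5)] 1(6) 2(6) by auto
  have "y \<noteq> u" "x \<noteq> v" using o 1(6) 2(6) by auto
  moreover have "x \<noteq> u"
  proof
    assume "x = u"
    then have "\<not> v < y" "\<not> y < v" using 1 2 by (auto simp: disjoint_iff)
    with \<open>x = u\<close> \<open>l \<noteq> m\<close> 1(1) 2(1) show False by auto
  qed
  moreover have "y \<noteq> v"
  proof
    assume "y = v"
    then have "\<not> u < x" "\<not> x < u" using 1 2 by (auto simp: disjoint_iff)
    with \<open>y = v\<close> \<open>l \<noteq> m\<close> 1(1) 2(1) show False by auto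
  qed
  ultimately show "l \<inter> m = {}" using 1(1) 2(1) by auto
qed

text \<open>The parity of its rank tells a point on which side to look for its partner. Only a last
  point of even rank would find none, and then \<open>T\<close> would have odd size.\<close>

lemma Union_consecutive_pairs:
  assumes "finite T" "even (card T)"
  shows "\<Union>(consecutive_pairs T) = T"
proof
  show "T \<subseteq> \<Union>(consecutive_pairs T)"
  proof
    fix x assume x: "x \<in> T"
    show "x \<in> \<Union>(consecutive_pairs T)"
    proof (cases "even (card (T \<inter> {..<x}))")
      case True
      have "T \<inter> {x<..} \<noteq> {}"
      proof
        assume "T \<inter> {x<..} = {}"
        then have "T = insert x (T \<inter> {..<x})" using x by (auto simp: disjoint_iff)
        then have "card T = card (insert x (T \<inter> {..<x}))" by simp
        also have "\<dots> = Suc (card (T \<inter> {..<x}))" by simp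
        finally show False using True assms(2) by simp
      qed
      then have y: "Min (T \<inter> {x<..}) \<in> T \<inter> {x<..}" using assms(1) by (intro Min_in) auto
      have "T \<inter> {x<..<Min (T \<inter> {x<..})} = {}"
        using assms(1) by (auto simp: disjoint_iff) (metis IntI Min_le finite_Int greaterThan_iff leD)
      with y x True have "{x, Min (T \<inter> {x<..})} \<in> consecutive_pairs T"
        by (intro consecutive_pairsI) auto
      then show ?thesis by blast
    next
      case False
      then have "T \<inter> {..<x} \<noteq> {}" by (metis card.empty even_zero)
      then have y: "Max (T \<inter> {..<x}) \<in> T \<inter> {..<x}" using assms(1) by (intro Max_in) auto
      have n: "T \<inter> {Max (T \<inter> {..<x})<..<x} = {}"
        using assms(1) by (auto simp: disjoint_iff) (metis IntI Max_ge finite_Int lessThan_iff leD)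
      with y False rank_Suc[OF _ _ n] have "{Max (T \<inter> {..<x}), x} \<in> consecutive_pairs T"
        by (intro consecutive_pairsI x n) auto
      then show ?thesis by blast
    qed
  qed
qed (rule consecutive_pairs_Union_subset)

text \<open>By disjointness, a pair that shares a point with a member of \<open>P\<close> is that
  member. Later equations are thereby reduced to one inclusion and a covering.\<close>

lemma consecutive_pairs_eqI:
  assumes "P \<subseteq> consecutive_pairs T" "T \<subseteq> \<Union>P"
  shows "consecutive_pairs T = P"
proof
  show "consecutive_pairs T \<subseteq> P"
  proof
    fix l assume l: "l \<in> consecutive_pairs T"
    then obtain x where x: "x \<in> l" "x \<in> T" by (auto elim: consecutive_pairsE)
    then obtain m where "m \<in> P" "x \<in> m" using assms(2) by blast
    with l x assms(1) disjoint_unique[OF disjoint_consecutive_pairs l] show "l \<in> P" by blast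
  qed
qed fact

lemma consecutive_pairs_image:
  assumes mono: "\<And>x y. x \<in> T \<Longrightarrow> y \<in> T \<Longrightarrow> x < y \<Longrightarrow> f x < f y"
  shows "consecutive_pairs (f ` T) = (`) f ` consecutive_pairs T"
proof -
  have iff: "f x < f y \<longleftrightarrow> x < y" if "x \<in> T" "y \<in> T" for x y
    using mono that by (metis linorder_neqE_nat order_less_asym order_less_irrefl)
  have inj: "inj_on f T" by (rule inj_onI) (metis iff linorder_neqE_nat order_less_irrefl)
  have rank: "card (f ` T \<inter> {..<f x}) = card (T \<inter> {..<x})" if "x \<in> T" for x
  proof -
    have "f ` T \<inter> {..<f x} = f ` (T \<inter> {..<x})" using iff that by auto
    moreover have "inj_on f (T \<inter> {..<x})" using inj by (rule inj_on_subset) auto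
    ultimately show ?thesis by (simp add: card_image)
  qed
  have gap: "f ` T \<inter> {f x<..<f y} = {} \<longleftrightarrow> T \<inter> {x<..<y} = {}" if "x \<in> T" "y \<in> T" for x y
    using iff that by (auto simp: disjoint_iff)
  show ?thesis
  proof (intro subset_antisym subsetI)
    fix l assume "l \<in> consecutive_pairs (f ` T)"
    then obtain x y where "l = {f x, f y}" "x \<in> T" "y \<in> T" "f x < f y" "f ` T \<inter> {f x<..<f y} = {}"
      "even (card (f ` T \<inter> {..<f x}))" by (elim consecutive_pairsE imageE) blast
    then have "{x, y} \<in> consecutive_pairs T" "l = f ` {x, y}"
      using iff rank gap by (auto intro!: consecutive_pairsI)
    then show "l \<in> (`) f ` consecutive_pairs T" by blast
  next
    fix l assume "l \<in> (`) f ` consecutive_pairs T"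
    then obtain x y where "l = {f x, f y}" "x \<in> T" "y \<in> T" "x < y" "T \<inter> {x<..<y} = {}"
      "even (card (T \<inter> {..<x}))" by (auto elim!: consecutive_pairsE)
    then show "l \<in> consecutive_pairs (f ` T)"
      using iff rank gap by (auto intro!: consecutive_pairsI)
  qed
qed

text \<open>Ranks of points of \<open>Y\<close> grow by \<open>card T\<close>; as this number is
  even, their parities are kept.\<close>

lemma consecutive_pairs_Un:
  assumes fin: "finite T" "finite Y" and ev: "even (card T)" "even (card Y)"
    and less: "\<And>x y. x \<in> T \<Longrightarrow> y \<in> Y \<Longrightarrow> x < y"
  shows "consecutive_pairs (T \<union> Y) = consecutive_pairs T \<union> consecutive_pairs Y"
proof (rule consecutive_pairs_eqI)
  show "T \<union> Y \<subseteq> \<Union> (consecutive_pairs T \<union> consecutive_pairs Y)"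
    using Union_consecutive_pairs fin ev by auto
  have "l \<in> consecutive_pairs (T \<union> Y)" if "l \<in> consecutive_pairs T" for l
    using that
  proof (elim consecutive_pairsE)
    fix x y assume l: "l = {x, y}" "x \<in> T" "y \<in> T" "x < y" "T \<inter> {x<..<y} = {}"
      "even (card (T \<inter> {..<x}))"
    have "z \<notin> Y" if "z < x \<or> z < y" for z using less[OF l(2), of z] less[OF l(3), of z] that by auto
    then have "(T \<union> Y) \<inter> {..<x} = T \<inter> {..<x}" "(T \<union> Y) \<inter> {x<..<y} = T \<inter> {x<..<y}"
      by auto
    with l show ?thesis by (auto intro!: consecutive_pairsI)
  qed
  moreover have "l \<in> consecutive_pairs (T \<union> Y)" if "l \<in> consecutive_pairs Y" for l
    using that
  proof (elim consecutive_pairsE)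
    fix x y assume l: "l = {x, y}" "x \<in> Y" "y \<in> Y" "x < y" "Y \<inter> {x<..<y} = {}"
      "even (card (Y \<inter> {..<x}))"
    have "z < x" if "z \<in> T" for z using less[OF that l(2)] .
    then have e: "(T \<union> Y) \<inter> {..<x} = T \<union> (Y \<inter> {..<x})" "(T \<union> Y) \<inter> {x<..<y} = Y \<inter> {x<..<y}"
      by force+
    moreover have "T \<inter> (Y \<inter> {..<x}) = {}" using less by auto
    then have "card (T \<union> (Y \<inter> {..<x})) = card T + card (Y \<inter> {..<x})"
      using fin by (intro card_Un_disjoint) auto
    ultimately have "even (card ((T \<union> Y) \<inter> {..<x}))" "(T \<union> Y) \<inter> {x<..<y} = {}"
      using l(5,6) ev(1) by simp_all
    then show ?thesis unfolding l(1) using l(2-4) by (intro consecutive_pairsI) simp_all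
  qed
  ultimately show "consecutive_pairs T \<union> consecutive_pairs Y \<subseteq> consecutive_pairs (T \<union> Y)" by blast
qed

lemma pair_in_consecutive_pairs:
  assumes "{x, y} \<in> consecutive_pairs T" "x < y"
  shows "x \<in> T" "y \<in> T" "T \<inter> {x<..<y} = {}" "even (card (T \<inter> {..<x}))"
proof -
  obtain u v where uv: "{x, y} = {u, v}" "u \<in> T" "v \<in> T" "u < v" "T \<inter> {u<..<v} = {}"
    "even (card (T \<inter> {..<u}))" by (rule consecutive_pairsE[OF assms(1)])
  then have "x = u" "y = v" using assms(2) by (auto simp: doubleton_eq_iff)
  with uv show "x \<in> T" "y \<in> T" "T \<inter> {x<..<y} = {}" "even (card (T \<inter> {..<x}))" by simp_all
qed

text \<open>Two neighbours leave together, so every other rank drops by zero or by two.\<close>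

lemma consecutive_pairs_mono_remove:
  assumes l: "l \<in> consecutive_pairs T" and lpq: "l \<inter> {p, q} = {}"
    and pq: "p \<in> T" "q \<in> T" "p < q" "T \<inter> {p<..<q} = {}"
  shows "l \<in> consecutive_pairs (T - {p, q})"
  using l
proof (elim consecutive_pairsE)
  fix x y assume xy: "l = {x, y}" "x \<in> T" "y \<in> T" "x < y" "T \<inter> {x<..<y} = {}"
    "even (card (T \<inter> {..<x}))"
  have "even (card ((T - {p, q}) \<inter> {..<x}))"
  proof (cases "p < x")
    case True
    then have "\<not> x < q" "x \<noteq> q" using xy(1,2) lpq pq(4) by (auto simp: disjoint_iff)
    then have "q < x" by simp
    then have "T \<inter> {..<x} = insert p (insert q ((T - {p, q}) \<inter> {..<x}))" using True pq by auto
    then have "card (T \<inter> {..<x}) = Suc (Suc (card ((T - {p, q}) \<inter> {..<x})))" using pq(3) by simp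
    with xy(6) show ?thesis by simp
  next
    case False
    then have "T \<inter> {..<x} = (T - {p, q}) \<inter> {..<x}" using pq by auto
    with xy(6) show ?thesis by simp
  qed
  with xy lpq show ?thesis by (auto intro!: consecutive_pairsI)
qed

lemma consecutive_pairs_remove:
  assumes fin: "finite T" and ev: "even (card T)" and pq: "{p, q} \<in> consecutive_pairs T" "p < q"
  shows "consecutive_pairs (T - {p, q}) = consecutive_pairs T - {{p, q}}"
proof (rule consecutive_pairs_eqI)
  note pq' = pair_in_consecutive_pairs[OF pq]
  have away: "l \<inter> {p, q} = {}" if "l \<in> consecutive_pairs T" "l \<noteq> {p, q}" for l
    using disjoint_consecutive_pairs that pq(1) by (auto simp: disjoint_def)
  show "consecutive_pairs T - {{p, q}} \<subseteq> consecutive_pairs (T - {p, q})"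
    using consecutive_pairs_mono_remove[OF _ away pq'(1,2) pq(2) pq'(3)] by blast
  show "T - {p, q} \<subseteq> \<Union> (consecutive_pairs T - {{p, q}})"
    using Union_consecutive_pairs[OF fin ev] by blast
qed

text \<open>As neighbours in different pairs, \<open>p\<close> is the right end of its pair and
  \<open>q\<close> the left end of the next one, so \<open>a < p < q < b\<close> with no further
  point of \<open>T\<close> in this range. Deleting \<open>p\<close> and \<open>q\<close> makes
  \<open>a\<close> and \<open>b\<close> neighbours. This is the merging of two blobs.\<close>

lemma consecutive_pairs_merge:
  assumes fin: "finite T" and ev: "even (card T)" and pq: "p < q" "T \<inter> {p<..<q} = {}"
    and lines: "{p, a} \<in> consecutive_pairs T" "{q, b} \<in> consecutive_pairs T" "{p, a} \<noteq> {q, b}"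
  shows "consecutive_pairs (T - {p, q}) = insert {a, b} (consecutive_pairs T - {{p, a}, {q, b}})"
proof (rule consecutive_pairs_eqI)
  have in_X: "p \<in> T" "q \<in> T" "a \<in> T" "b \<in> T"
    using lines consecutive_pairs_Union_subset by auto
  have "{p, a} \<inter> {q, b} = {}" using disjoint_consecutive_pairs lines by (auto simp: disjoint_def)
  then have dist: "a \<noteq> q" "b \<noteq> p" "a \<noteq> b" by auto
  have "p \<noteq> a" "q \<noteq> b" using consecutive_pairs_card lines by force+
  have "a < p"
  proof (rule ccontr)
    assume "\<not> a < p"
    with \<open>p \<noteq> a\<close> have "p < a" by simp
    from pair_in_consecutive_pairs(3)[OF lines(1) this] pq dist in_X \<open>p < a\<close> show False
      by (auto simp: disjoint_iff) (metis linorder_neqE_nat)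
  qed
  have "q < b"
  proof (rule ccontr)
    assume "\<not> q < b"
    with \<open>q \<noteq> b\<close> have "b < q" by simp
    moreover have "{b, q} \<in> consecutive_pairs T" using lines(2) by (simp add: insert_commute)
    note pair_in_consecutive_pairs(3)[OF this \<open>b < q\<close>]
    ultimately show False using pq dist in_X
      by (auto simp: disjoint_iff)
  qed
  have "{a, p} \<in> consecutive_pairs T" using lines(1) by (simp add: insert_commute)
  note a = pair_in_consecutive_pairs[OF this \<open>a < p\<close>]
  note b = pair_in_consecutive_pairs[OF lines(2) \<open>q < b\<close>]
  have "(T - {p, q}) \<inter> {a<..<b} = {}"
    using a(3) b(3) pq by (auto simp: disjoint_iff) (metis linorder_neqE_nat)
  moreover have "(T - {p, q}) \<inter> {..<a} = T \<inter> {..<a}" using \<open>a < p\<close> pq by auto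
  ultimately have ab: "{a, b} \<in> consecutive_pairs (T - {p, q})"
    using a(4) \<open>a < p\<close> \<open>p < q\<close> \<open>q < b\<close> in_X by (intro consecutive_pairsI) auto
  have "l \<in> consecutive_pairs (T - {p, q})"
    if "l \<in> consecutive_pairs T" "l \<noteq> {p, a}" "l \<noteq> {q, b}" for l
  proof (rule consecutive_pairs_mono_remove[OF that(1) _ in_X(1,2) pq])
    have "l \<inter> {p, a} = {}" "l \<inter> {q, b} = {}"
      using disjoint_consecutive_pairs that lines by (auto simp: disjoint_def)
    then show "l \<inter> {p, q} = {}" by auto
  qed
  with ab show "insert {a, b} (consecutive_pairs T - {{p, a}, {q, b}}) \<subseteq> consecutive_pairs (T - {p, q})"
    by blast
  show "T - {p, q} \<subseteq> \<Union> (insert {a, b} (consecutive_pairs T - {{p, a}, {q, b}}))"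
    using Union_consecutive_pairs[OF fin ev] by blast
qed

section \<open>Undecorated lines and defects\<close>

definition between :: "nat \<Rightarrow> nat \<Rightarrow> nat \<Rightarrow> bool" where
  "between c d x \<longleftrightarrow> c < x \<and> x < d \<or> d < x \<and> x < c"

lemma between_commute: "between c d = between d c"
  by (auto simp: between_def fun_eq_iff)

text \<open>Moving \<open>p\<close> to \<open>b\<close> passes no point of \<open>T\<close>, hence
  is strictly increasing on \<open>T\<close> and carries the pairs along. This is a defect sliding
  along an undecorated line.\<close>

lemma consecutive_pairs_replace:
  assumes "p \<in> T" "b \<notin> T" "\<And>x. x \<in> T \<Longrightarrow> \<not> between p b x" "{p, a} \<in> consecutive_pairs T"
  shows "consecutive_pairs (insert b (T - {p})) = insert {a, b} (consecutive_pairs T - {{p, a}})"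
proof -
  define f where "f = id(p := b)"
  have f: "f p = b" "\<And>x. x \<noteq> p \<Longrightarrow> f x = x" by (auto simp: f_def)
  have mono: "f x < f y" if "x \<in> T" "y \<in> T" "x < y" for x y
    using assms(2) assms(3)[OF that(1)] assms(3)[OF that(2)] that
    by (cases "x = p"; cases "y = p") (auto simp: f between_def, metis linorder_neqE_nat, metis linorder_neqE_nat)
  have "f ` T = insert b (T - {p})" using assms(1) f by (auto simp: image_iff) metis+
  then have "consecutive_pairs (insert b (T - {p})) = (`) f ` consecutive_pairs T"
    using consecutive_pairs_image[of T f] mono by simp
  also have "\<dots> = insert {a, b} (consecutive_pairs T - {{p, a}})"
  proof -
    have "p \<noteq> a" using consecutive_pairs_card[OF assms(4)] by auto
    then have "f ` {p, a} = {a, b}" using f by auto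
    moreover have "f ` l = l" if "l \<in> consecutive_pairs T" "l \<noteq> {p, a}" for l
    proof -
      have "p \<notin> l" using disjoint_unique[OF disjoint_consecutive_pairs assms(4) that(1)] that(2) by auto
      then have "\<And>x. x \<in> l \<Longrightarrow> f x = x" using f(2) by metis
      then show ?thesis by simp
    qed
    moreover have "consecutive_pairs T = insert {p, a} (consecutive_pairs T - {{p, a}})"
      using assms(4) by blast
    moreover have "(`) f ` (consecutive_pairs T - {{p, a}}) = consecutive_pairs T - {{p, a}}"
    proof -
      have "(`) f ` (consecutive_pairs T - {{p, a}}) = id ` (consecutive_pairs T - {{p, a}})"
        using calculation(2) by (intro image_cong) auto
      then show ?thesis by simp
    qed
    ultimately show ?thesis by (metis image_insert)
  qed
  finally show ?thesis .
qed

text \<open>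
  A blob diagram is encoded by its set \<open>U\<close> of undecorated lines: the remaining points of \<open>V\<close> are the
  ends of the decorated lines, which by planarity are joined in consecutive pairs.
\<close>

definition planar :: "nat set \<Rightarrow> nat set set \<Rightarrow> bool" where
  "planar V U \<longleftrightarrow> finite V \<and> \<Union>U \<subseteq> V \<and> (\<forall>l\<in>U. card l = 2) \<and> disjoint U \<and> even (card (V - \<Union>U)) \<and>
     (\<forall>c d x. {c, d} \<in> U \<longrightarrow> x \<in> V \<longrightarrow> between c d x \<longrightarrow> (\<exists>y. {x, y} \<in> U \<and> between c d y))"

definition diagram :: "nat set \<Rightarrow> nat set set \<Rightarrow> nat set set \<times> nat set set" where
  "diagram V U = (U \<union> consecutive_pairs (V - \<Union>U), consecutive_pairs (V - \<Union>U))"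

lemma planarD:
  assumes "planar V U"
  shows "finite V" "\<Union>U \<subseteq> V" "\<And>l. l \<in> U \<Longrightarrow> card l = 2" "disjoint U" "even (card (V - \<Union>U))"
    "\<And>c d x. {c, d} \<in> U \<Longrightarrow> x \<in> V \<Longrightarrow> between c d x \<Longrightarrow> \<exists>y. {x, y} \<in> U \<and> between c d y"
  using assms unfolding planar_def by blast+

lemma planar_partner_unique:
  assumes "planar V U" "{x, y} \<in> U" "{x, z} \<in> U"
  shows "y = z"
  using disjoint_unique[OF planarD(4)[OF assms(1)] assms(2,3), of x] by (auto simp: doubleton_eq_iff)

lemma planar_partner_ex:
  assumes "planar V U" "x \<in> \<Union>U"
  obtains y where "y \<noteq> x" "{x, y} \<in> U"
proof -
  obtain l where l: "l \<in> U" "x \<in> l" using assms(2) by blast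
  then obtain u v where "l = {u, v}" "u \<noteq> v"
    using planarD(3)[OF assms(1) l(1)] by (auto simp: card_2_iff)
  with l that[of u] that[of v] show ?thesis by (auto simp: insert_commute)
qed

lemma planar_diagram_partition_on:
  assumes "planar V U"
  shows "partition_on V (U \<union> consecutive_pairs (V - \<Union>U))"
proof -
  note p = planarD[OF assms]
  have c: "\<Union>(consecutive_pairs (V - \<Union>U)) = V - \<Union>U"
    using p by (intro Union_consecutive_pairs) auto
  have "{} \<notin> U" using p(3) by force
  moreover have "{} \<notin> consecutive_pairs (V - \<Union>U)" using consecutive_pairs_card by force
  moreover have "disjoint (U \<union> consecutive_pairs (V - \<Union>U))"
    using p(4) disjoint_consecutive_pairs c by (intro disjoint_union) auto
  ultimately show ?thesis using c p(2) unfolding partition_on_def by auto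
qed

section \<open>Contraction of two adjacent points\<close>

text \<open>If one of the points is a defect and the other lies on an undecorated line, that line is
  dropped and nothing is added: its far end turns into a defect by being left uncovered. The
  condition \<open>a \<noteq> q\<close> prevents a closed loop \<open>{p, q}\<close> from being
  reinserted.\<close>

definition contract :: "nat \<Rightarrow> nat \<Rightarrow> nat set set \<Rightarrow> nat set set" where
  "contract p q U = {l \<in> U. l \<inter> {p, q} = {}} \<union> {{a, b} | a b. {p, a} \<in> U \<and> {q, b} \<in> U \<and> a \<noteq> q}"

text \<open>Partners are unique, so the set of new lines has at most one element, and
  \<open>contract\<close> becomes an explicit deletion or replacement in each case.\<close>

lemma contract_cases:
  assumes U: "planar V U" and "p \<noteq> q"
  obtains (loop) "{p, q} \<in> U" "contract p q U = U - {{p, q}}"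
    | (defects) "p \<notin> \<Union>U" "q \<notin> \<Union>U" "contract p q U = U"
    | (left) b where "p \<notin> \<Union>U" "{q, b} \<in> U" "q \<noteq> b" "p \<noteq> b" "contract p q U = U - {{q, b}}"
    | (right) a where "q \<notin> \<Union>U" "{p, a} \<in> U" "p \<noteq> a" "q \<noteq> a" "contract p q U = U - {{p, a}}"
    | (join) a b where "{p, a} \<in> U" "{q, b} \<in> U" "{p, a} \<noteq> {q, b}" "p \<noteq> a" "q \<noteq> b" "a \<noteq> q" "b \<noteq> p" "a \<noteq> b"
      "contract p q U = insert {a, b} (U - {{p, a}, {q, b}})"
proof -
  have dis: "disjoint U" using planarD[OF U] by blast
  have away: "l \<inter> m = {}" if "l \<in> U" "m \<in> U" "l \<noteq> m" for l m
    using dis that by (auto simp: disjoint_def)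
  note uniq = planar_partner_unique[OF U]
  consider "{p, q} \<in> U" | "p \<notin> \<Union>U" "q \<notin> \<Union>U" | b where "p \<notin> \<Union>U" "{q, b} \<in> U" "b \<noteq> q"
    | a where "q \<notin> \<Union>U" "{p, a} \<in> U" "a \<noteq> p"
    | a b where "{p, a} \<in> U" "{q, b} \<in> U" "a \<noteq> p" "b \<noteq> q" "{p, q} \<notin> U"
    using planar_partner_ex[OF U] by metis
  then show ?thesis
  proof cases
    case 1
    then have "{l \<in> U. l \<inter> {p, q} = {}} = U - {{p, q}}" using away[OF _ 1] by auto
    moreover have "{{a, b} | a b. {p, a} \<in> U \<and> {q, b} \<in> U \<and> a \<noteq> q} = {}" using uniq 1 by blast
    ultimately have "contract p q U = U - {{p, q}}" unfolding contract_def by (metis Un_empty_right)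
    with loop 1 show ?thesis by blast
  next
    case 2
    then have "{l \<in> U. l \<inter> {p, q} = {}} = U"
      "{{a, b} | a b. {p, a} \<in> U \<and> {q, b} \<in> U \<and> a \<noteq> q} = {}" by auto
    then have "contract p q U = U" unfolding contract_def by (metis Un_empty_right)
    with 2 defects show ?thesis by blast
  next
    case (3 b)
    have "l \<inter> {p, q} = {} \<longleftrightarrow> l \<noteq> {q, b}" if "l \<in> U" for l
      using 3(1) away[OF that 3(2)] that by auto
    then have "{l \<in> U. l \<inter> {p, q} = {}} = U - {{q, b}}" by auto
    moreover have "{{a, b} | a b. {p, a} \<in> U \<and> {q, b} \<in> U \<and> a \<noteq> q} = {}" using 3 by blast
    ultimately have "contract p q U = U - {{q, b}}" unfolding contract_def by (metis Un_empty_right)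
    moreover have "q \<noteq> b" "p \<noteq> b" using 3 by auto
    ultimately show ?thesis using left[of b] 3 by blast
  next
    case (4 a)
    have "l \<inter> {p, q} = {} \<longleftrightarrow> l \<noteq> {p, a}" if "l \<in> U" for l
      using 4(1) away[OF that 4(2)] that by auto
    then have "{l \<in> U. l \<inter> {p, q} = {}} = U - {{p, a}}" by auto
    moreover have "{{a, b} | a b. {p, a} \<in> U \<and> {q, b} \<in> U \<and> a \<noteq> q} = {}" using 4 by blast
    ultimately have "contract p q U = U - {{p, a}}" unfolding contract_def by (metis Un_empty_right)
    moreover have "p \<noteq> a" "q \<noteq> a" using 4 by auto
    ultimately show ?thesis using right[of a] 4 by blast
  next
    case (5 a b)
    have ne: "{p, a} \<noteq> {q, b}" using 5 \<open>p \<noteq> q\<close> by (auto simp: doubleton_eq_iff)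
    have "{p, a} \<inter> {q, b} = {}" using away[OF 5(1,2) ne] .
    then have d: "a \<noteq> q" "b \<noteq> p" "a \<noteq> b" by auto
    have "l \<inter> {p, q} = {} \<longleftrightarrow> l \<noteq> {p, a} \<and> l \<noteq> {q, b}" if "l \<in> U" for l
      using away[OF that 5(1)] away[OF that 5(2)] that by auto
    then have "{l \<in> U. l \<inter> {p, q} = {}} = U - {{p, a}, {q, b}}" by auto
    moreover have "{{a, b} | a b. {p, a} \<in> U \<and> {q, b} \<in> U \<and> a \<noteq> q} = {{a, b}}"
      using uniq[OF 5(1)] uniq[OF 5(2)] 5(1,2) d by blast
    ultimately show ?thesis using join[of a b] 5 ne d by (simp add: contract_def)
  qed
qed

text \<open>The far end \<open>b\<close> takes over the role of the defect \<open>p\<close>.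
  Exchanging the names \<open>p\<close> and \<open>q\<close> gives the mirrored case as
  well.\<close>

lemma defects_contract_left:
  assumes "planar V U" "p \<in> V - \<Union>U" "{q, b} \<in> U" "q \<noteq> b"
  shows "(V - {p, q}) - \<Union>(U - {{q, b}}) = insert b (V - \<Union>U - {p})"
proof -
  have "\<Union>(U - {{q, b}}) = \<Union>U - {q, b}"
    using disjoint_unique[OF planarD(4)[OF assms(1)] assms(3)] by auto
  moreover have "b \<in> V" "b \<noteq> p" using assms planarD(2)[OF assms(1)] by auto
  ultimately show ?thesis using assms by auto
qed

lemma card_replace: "finite A \<Longrightarrow> p \<in> A \<Longrightarrow> b \<notin> A \<Longrightarrow> card (insert b (A - {p})) = card A"
  by (simp add: card_Suc_Diff1 del: card_Diff_insert)

text \<open>No point lies between \<open>p\<close> and \<open>q\<close>, so a line that avoids both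
  encloses both or neither. The number of defects is unchanged, except that it drops by two when
  both points are defects.\<close>

lemma planar_contract:
  assumes U: "planar V U" and pq: "p \<in> V" "q \<in> V" "p < q" "V \<inter> {p<..<q} = {}"
  shows "planar (V - {p, q}) (contract p q U)"
proof -
  note P = planarD[OF U]
  have dis: "l \<inter> m = {}" if "l \<in> U" "m \<in> U" "l \<noteq> m" for l m
    using P(4) that by (auto simp: disjoint_def)
  have sep: "between c d p \<longleftrightarrow> between c d q" if "{c, d} \<inter> {p, q} = {}" "{c, d} \<subseteq> V" for c d
    using pq that unfolding between_def by (auto simp: disjoint_iff)
  have uniq: "y = z" if "{x, y} \<in> U" "{x, z} \<in> U" for x y z using planar_partner_unique[OF U that] .
  have inner: "between c d x \<Longrightarrow> between c d y" if "{c, d} \<in> U" "{x, y} \<in> U" for c d x y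
    using P(6)[OF that(1), of x] uniq[OF that(2)] that(2) P(2) by blast
  show ?thesis
    using U pq(3)[THEN less_imp_neq]
  proof (cases rule: contract_cases)
    case loop
    have "\<Union>(U - {{p, q}}) = \<Union>U - {p, q}" using dis loop(1) by blast
    then have "V - {p, q} - \<Union>(U - {{p, q}}) = V - \<Union>U" "\<Union>(U - {{p, q}}) \<subseteq> V - {p, q}"
      using loop P(2) by auto
    moreover have "\<exists>y. {x, y} \<in> U - {{p, q}} \<and> between c d y"
      if "{c, d} \<in> U - {{p, q}}" "x \<in> V - {p, q}" "between c d x" for c d x
      using P(6)[of c d x] that by blast
    ultimately show ?thesis unfolding planar_def loop(2) using P
      by (auto simp: disjoint_def)
  next
    case defects
    have "card (V - {p, q} - \<Union>U) = card ((V - \<Union>U) - {p, q})" by (rule arg_cong[where f = card]) auto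
    also have "\<dots> = card (V - \<Union>U) - 2"
      using defects pq P(1) by (subst card_Diff_subset) auto
    finally show ?thesis unfolding planar_def defects(3) using P defects
      by auto
  next
    case (left b)
    have b: "b \<in> V" "b \<in> \<Union>U" using left P(2) by auto
    have "V - {p, q} - \<Union>(U - {{q, b}}) = insert b (V - \<Union>U - {p})"
      using defects_contract_left[OF U _ left(2,3)] left pq by auto
    then have "card (V - {p, q} - \<Union>(U - {{q, b}})) = card (V - \<Union>U)"
      using card_replace[of "V - \<Union>U" p b] b left pq P(1) by simp
    moreover have "l \<subseteq> V - {p, q}" if "l \<in> U" "l \<noteq> {q, b}" for l
      using dis[OF that(1) left(2) that(2)] left(1) P(2) that(1) by blast
    then have "\<Union>(U - {{q, b}}) \<subseteq> V - {p, q}" by blast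
    moreover have "\<exists>y. {x, y} \<in> U - {{q, b}} \<and> between c d y"
      if x: "{c, d} \<in> U - {{q, b}}" "x \<in> V - {p, q}" "between c d x" for c d x
    proof -
      obtain y where y: "{x, y} \<in> U" "between c d y" using P(6)[of c d x] x by blast
      have "{c, d} \<inter> {q, b} = {}" using dis[OF _ left(2)] x(1) by blast
      moreover have "p \<notin> {c, d}" "{c, d} \<subseteq> V" using x(1) left(1) P(2) by blast+
      ultimately have cd: "{c, d} \<inter> {p, q} = {}" "{c, d} \<subseteq> V" by auto
      \<comment> \<open>A line enclosing \<open>q\<close> would also enclose its neighbour
        \<open>p\<close>, but no undecorated line encloses a defect.\<close>
      have "{x, y} \<noteq> {q, b}"
      proof
        assume "{x, y} = {q, b}"
        then have "y = q" using x by (auto simp: doubleton_eq_iff)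
        then have "between c d p" using sep[OF cd] y by simp
        then show False using P(6)[of c d p] x pq left by blast
      qed
      with y show ?thesis by blast
    qed
    ultimately show ?thesis unfolding planar_def left(5) using P
      by (auto simp: disjoint_def)
  next
    case (right a)
    have a: "a \<in> V" "a \<in> \<Union>U" using right P(2) by auto
    have "V - {p, q} - \<Union>(U - {{p, a}}) = insert a (V - \<Union>U - {q})"
      using defects_contract_left[OF U _ right(2,3), of q] right pq by (auto simp: insert_commute)
    then have "card (V - {p, q} - \<Union>(U - {{p, a}})) = card (V - \<Union>U)"
      using card_replace[of "V - \<Union>U" q a] a right pq P(1) by simp
    moreover have "l \<subseteq> V - {p, q}" if "l \<in> U" "l \<noteq> {p, a}" for l
      using dis[OF that(1) right(2) that(2)] right(1) P(2) that(1) by blast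
    then have "\<Union>(U - {{p, a}}) \<subseteq> V - {p, q}" by blast
    moreover have "\<exists>y. {x, y} \<in> U - {{p, a}} \<and> between c d y"
      if x: "{c, d} \<in> U - {{p, a}}" "x \<in> V - {p, q}" "between c d x" for c d x
    proof -
      obtain y where y: "{x, y} \<in> U" "between c d y" using P(6)[of c d x] x by blast
      have "{c, d} \<inter> {p, a} = {}" using dis[OF _ right(2)] x(1) by blast
      moreover have "q \<notin> {c, d}" "{c, d} \<subseteq> V" using x(1) right(1) P(2) by blast+
      ultimately have cd: "{c, d} \<inter> {p, q} = {}" "{c, d} \<subseteq> V" by auto
      have "{x, y} \<noteq> {p, a}"
      proof
        assume "{x, y} = {p, a}"
        then have "y = p" using x by (auto simp: doubleton_eq_iff)
        then have "between c d q" using sep[OF cd] y by simp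
        then show False using P(6)[of c d q] x pq right by blast
      qed
      with y show ?thesis by blast
    qed
    ultimately show ?thesis unfolding planar_def right(5) using P
      by (auto simp: disjoint_def)
  next
    case (join a b)
    let ?U = "insert {a, b} (U - {{p, a}, {q, b}})"
    have in_V: "a \<in> V" "b \<in> V" using join P(2) by auto
    have away: "l \<inter> {p, q, a, b} = {}" if "l \<in> U" "l \<noteq> {p, a}" "l \<noteq> {q, b}" for l
      using dis[OF that(1) join(1) that(2)] dis[OF that(1) join(2) that(3)] by blast
    have UU: "\<Union>(U - {{p, a}, {q, b}}) = \<Union>U - {p, q, a, b}"
    proof (intro subset_antisym subsetI)
      show "x \<in> \<Union>U - {p, q, a, b}" if "x \<in> \<Union>(U - {{p, a}, {q, b}})" for x
        using that away by blast
      show "x \<in> \<Union>(U - {{p, a}, {q, b}})" if "x \<in> \<Union>U - {p, q, a, b}" for x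
        using that by blast
    qed
    then have "\<Union>?U = {a, b} \<union> (\<Union>U - {p, q, a, b})" by simp
    also have "\<dots> = \<Union>U - {p, q}" using join(1,2,4-8) by auto
    finally have UU': "\<Union>?U = \<Union>U - {p, q}" .
    have "{p, q} \<subseteq> \<Union>U" using join(1,2) by auto
    then have "V - {p, q} - \<Union>?U = V - \<Union>U" unfolding UU' by blast
    moreover have "\<Union>?U \<subseteq> V - {p, q}" unfolding UU' using P(2) by blast
    moreover have "disjoint ?U"
    proof -
      have "disjoint (U - {{p, a}, {q, b}})" using P(4) by (auto simp: disjoint_def)
      moreover have "{a, b} \<inter> \<Union>(U - {{p, a}, {q, b}}) = {}" using UU by auto
      ultimately show ?thesis by (auto simp: pairwise_insert disjnt_def)
    qed
    moreover have "card l = 2" if "l \<in> ?U" for l using that P(3) join by auto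
    moreover have "\<exists>y. {x, y} \<in> ?U \<and> between c d y"
      if x: "{c, d} \<in> ?U" "x \<in> V - {p, q}" "between c d x" for c d x
    proof (cases "{c, d} = {a, b}")
      case False
      then have cd: "{c, d} \<in> U" "{c, d} \<noteq> {p, a}" "{c, d} \<noteq> {q, b}" using x by auto
      from away[OF this] have cd': "{c, d} \<inter> {p, q} = {}" "{c, d} \<subseteq> V" using cd P(2) by blast+
      obtain y where y: "{x, y} \<in> U" "between c d y" using P(6)[of c d x] x cd by blast
      \<comment> \<open>If the old partner of \<open>x\<close> is one of the contracted points, then
        \<open>{c, d}\<close> encloses the other contracted point too, hence also the far end of its
        line, which is the new partner of \<open>x\<close>.\<close>
      consider "{x, y} = {p, a}" | "{x, y} = {q, b}" | "{x, y} \<in> ?U" using y by blast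
      then show ?thesis
      proof cases
        case 1
        then have "x = a" "y = p" using x by (auto simp: doubleton_eq_iff)
        then have "between c d q" using sep[OF cd'] y by simp
        then have "between c d b" using inner[OF cd(1) join(2)] by blast
        with \<open>x = a\<close> show ?thesis by blast
      next
        case 2
        then have "x = b" "y = q" using x by (auto simp: doubleton_eq_iff)
        then have "between c d p" using sep[OF cd'] y by simp
        then have "between c d a" using inner[OF cd(1) join(1)] by blast
        with \<open>x = b\<close> show ?thesis by (auto simp: insert_commute)
      qed (use y in blast)
    next
      case True
      then have bw: "between c d = between a b"
        using between_commute by (auto simp: doubleton_eq_iff)
      \<comment> \<open>Since \<open>p\<close> and \<open>q\<close> are adjacent, the region under
        the joined line is the symmetric difference of the regions under the two old lines, apart
        from the four ends.\<close>
      have split: "between a b z \<longleftrightarrow> between p a z \<noteq> between q b z" if "z \<in> V" "z \<notin> {p, q, a, b}" for z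
      proof -
        have "z < p \<longleftrightarrow> z < q" using pq(3,4) that by (auto simp: disjoint_iff)
        moreover have "between u v z \<longleftrightarrow> (z < u) \<noteq> (z < v)" if "z \<noteq> u" "z \<noteq> v" for u v
          using that unfolding between_def by auto
        ultimately show ?thesis using that(2) by auto
      qed
      have "x \<notin> {a, b}" using x bw by (auto simp: between_def)
      then have x': "x \<in> V" "x \<notin> {p, q, a, b}" using x by auto
      then have "between p a x \<or> between q b x" using split x bw by metis
      then obtain y where y: "{x, y} \<in> U" using P(6)[OF join(1)] P(6)[OF join(2)] x' by blast
      then have y': "y \<notin> {p, q, a, b}" "y \<in> V" and l: "{x, y} \<noteq> {p, a}" "{x, y} \<noteq> {q, b}"
        using away[OF y] x' P(2) by (auto simp: doubleton_eq_iff)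
      have yx: "{y, x} \<in> U" using y by (simp add: insert_commute)
      have "between p a x \<longleftrightarrow> between p a y" "between q b x \<longleftrightarrow> between q b y"
        using inner[OF join(1) y] inner[OF join(2) y] inner[OF join(1) yx] inner[OF join(2) yx] by blast+
      then have "between a b y" using split[OF x'] split[OF y'(2,1)] x bw by auto
      with y l bw show ?thesis by auto
    qed
    ultimately show ?thesis unfolding planar_def join(9) using P
      by auto
  qed
qed

text \<open>The rules \<open>glue_loop\<close> and \<open>glue_join\<close> replace lines of either
  kind, whereas \<open>contract\<close> sees the undecorated ones only. Each case amounts to showing
  that the consecutive pairs of the new set of defects are the decorated lines produced by these
  rules: the old pairs, the old pairs without one, two of them merged, or one of them with an end
  moved.\<close>

lemma planar_glue_contract:
  assumes U: "planar V U" and pq: "p \<in> V" "q \<in> V" "p < q" "V \<inter> {p<..<q} = {}"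
    and M: "{p, q} \<in> M" "disjoint M" "\<Union>M \<subseteq> V"
  defines "T \<equiv> V - \<Union>U"
  shows "glue V (diagram V U) M =
    scale (if {p, q} \<in> U then 1 else 0)
      (if p \<in> T \<and> q \<in> T \<and> odd (card (T \<inter> {..<p})) then 1 else 0)
      (if p \<in> T \<and> q \<in> T \<and> even (card (T \<inter> {..<p})) then 1 else 0)
      (glue (V - {p, q}) (diagram (V - {p, q}) (contract p q U)) (M - {{p, q}}))"
proof -
  note P = planarD[OF U]
  let ?V = "V - {p, q}" and ?M = "M - {{p, q}}"
  let ?D = "consecutive_pairs T"
  let ?L = "U \<union> ?D"
  have part: "partition_on V ?L" using planar_diagram_partition_on[OF U] unfolding T_def .
  have finT: "finite T" "even (card T)" using P by (auto simp: T_def)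
  have UD: "\<Union>?D = T" by (rule Union_consecutive_pairs[OF finT])
  have TU: "T \<inter> \<Union>U = {}" by (auto simp: T_def)
  have disU: "l \<inter> m = {}" if "l \<in> U" "m \<in> U" "l \<noteq> m" for l m
    using P(4) that by (auto simp: disjoint_def)
  have ne_U: "l \<noteq> {}" if "l \<in> U" for l using P(3)[OF that] by auto
  have disj: "l \<notin> U" if "l \<in> ?D" for l
    using that ne_U TU UD by blast
  have diag: "diagram V U = (?L, ?D)" by (simp add: diagram_def T_def)
  have finV: "finite V" by fact
  note loop_rule = glue_loop[OF part finV Un_upper2 _ M(1) M(2,3)]
  note join_rule = glue_join[OF part finV Un_upper2 _ _ _ _ _ M(1) M(2,3)]
  have partner: "\<exists>a. a \<noteq> x \<and> {x, a} \<in> ?D" if "x \<in> T" for x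
  proof -
    have "x \<in> \<Union>?D" using UD that by simp
    then obtain l where l: "l \<in> ?D" "x \<in> l" by (rule UnionE)
    then obtain u v where "l = {u, v}" "u \<noteq> v"
      using consecutive_pairs_card[OF l(1)] by (auto simp: card_2_iff)
    with l show ?thesis by (auto simp: insert_commute)
  qed
  show ?thesis
    using U pq(3)[THEN less_imp_neq]
  proof (cases rule: contract_cases)
    case loop
    have "\<Union>(U - {{p, q}}) = \<Union>U - {p, q}" using disjoint_unique[OF P(4) loop(1)] by auto
    then have T': "?V - \<Union>(U - {{p, q}}) = T" using loop by (auto simp: T_def)
    have nD: "{p, q} \<notin> ?D" using disj loop by blast
    then have "?L - {{p, q}} = (U - {{p, q}}) \<union> ?D" "?D - {{p, q}} = ?D" by auto
    then have "diagram ?V (contract p q U) = (?L - {{p, q}}, ?D - {{p, q}})"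
      unfolding diagram_def loop(2) T' by simp
    moreover have "p \<notin> T" using loop by (auto simp: T_def)
    ultimately show ?thesis using loop_rule loop nD unfolding diag by simp
  next
    case defects
    then have pT: "p \<in> T" "q \<in> T" using pq by (auto simp: T_def)
    have T': "?V - \<Union>U = T - {p, q}" by (auto simp: T_def)
    have nU: "{p, q} \<notin> U" using defects by blast
    have gap: "T \<inter> {p<..<q} = {}" using pq(4) by (auto simp: T_def)
    show ?thesis
    proof (cases "even (card (T \<inter> {..<p}))")
      case True
      then have D: "{p, q} \<in> ?D" using pT pq(3) gap by (intro consecutive_pairsI)
      have "?L - {{p, q}} = U \<union> (?D - {{p, q}})" using nU by auto
      then have "diagram ?V (contract p q U) = (?L - {{p, q}}, ?D - {{p, q}})"
        unfolding diagram_def defects(3) T' consecutive_pairs_remove[OF finT D pq(3)] by simp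
      then show ?thesis using loop_rule D nU True pT unfolding diag by simp
    next
      case False
      then have D: "{p, q} \<notin> ?D" using pair_in_consecutive_pairs(4)[OF _ pq(3)] by blast
      obtain a b where ab: "{p, a} \<in> ?D" "{q, b} \<in> ?D" "p \<noteq> a" "q \<noteq> b" using partner pT by metis
      have ne: "{p, a} \<noteq> {q, b}" using ab D pq(3) by (auto simp: doubleton_eq_iff insert_commute)
      have "U \<union> insert {a, b} (?D - {{p, a}, {q, b}}) = insert {a, b} (?L - {{p, a}, {q, b}})"
        using disj ab by blast
      then have "diagram ?V (contract p q U) =
         (insert {a, b} (?L - {{p, a}, {q, b}}), (?D - {{p, a}, {q, b}}) \<union> {{a, b}})"
        unfolding diagram_def defects(3) T' consecutive_pairs_merge[OF finT pq(3) gap ab(1,2) ne] by simp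
      then show ?thesis
        using join_rule[where a = a and b = b and L' = "insert {a, b} (?L - {{p, a}, {q, b}})" and D' = "(?D - {{p, a}, {q, b}}) \<union> {{a, b}}"]
          ab ne nU False pT unfolding diag by simp
    qed
  next
    case (left b)
    then have pT: "p \<in> T" "q \<notin> T" using pq by (auto simp: T_def)
    have T': "?V - \<Union>(U - {{q, b}}) = insert b (T - {p})"
      using defects_contract_left[OF U _ left(2,3)] left pq by (simp add: T_def)
    obtain a where a: "{p, a} \<in> ?D" "p \<noteq> a" using partner pT by metis
    have bV: "b \<in> V" "b \<notin> T" using left P(2) by (auto simp: T_def)
    \<comment> \<open>A defect between \<open>p\<close> and \<open>b\<close> would lie under the
      undecorated line \<open>{q, b}\<close>, as nothing separates \<open>p\<close> from
      \<open>q\<close>. So the defect at \<open>p\<close> can slide to \<open>b\<close>.\<close>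
    have btw: "\<not> between p b x" if "x \<in> T" for x
    proof
      assume "between p b x"
      moreover have "x \<noteq> p" "x \<noteq> q" "x \<noteq> b" "x \<in> V" using that bV pT calculation
        by (auto simp: between_def T_def)
      moreover have "\<not> between q b p" using P(6)[OF left(2) pq(1)] left(1) by blast
      ultimately have "between q b x" using pq(3,4) left(3,4) unfolding between_def by (auto simp: disjoint_iff)
      then show False using P(6)[OF left(2) \<open>x \<in> V\<close>] that by (auto simp: T_def)
    qed
    have ne: "{p, a} \<noteq> {q, b}" and nD: "{q, b} \<notin> ?D" and nU: "{p, a} \<notin> U" "{p, q} \<notin> U"
      using disj a left by blast+
    have D': "consecutive_pairs (insert b (T - {p})) = insert {a, b} (?D - {{p, a}})"
      by (rule consecutive_pairs_replace[OF pT(1) bV(2) btw a(1)])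
    have "(U - {{q, b}}) \<union> insert {a, b} (?D - {{p, a}}) = insert {a, b} (?L - {{p, a}, {q, b}})"
      "insert {a, b} (?D - {{p, a}}) = (?D - {{p, a}, {q, b}}) \<union> {{a, b}}"
      using nD nU by auto
    then have "diagram ?V (contract p q U) =
       (insert {a, b} (?L - {{p, a}, {q, b}}), (?D - {{p, a}, {q, b}}) \<union> {{a, b}})"
      unfolding diagram_def left(5) T' D' by simp
    then show ?thesis
      using join_rule[where a = a and b = b and L' = "insert {a, b} (?L - {{p, a}, {q, b}})" and D' = "(?D - {{p, a}, {q, b}}) \<union> {{a, b}}"]
        a left ne nD nU pT unfolding diag by simp
  next
    case (right a)
    then have pT: "q \<in> T" "p \<notin> T" using pq by (auto simp: T_def)
    have T': "?V - \<Union>(U - {{p, a}}) = insert a (T - {q})"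
      using defects_contract_left[OF U _ right(2,3), of q] right pq by (simp add: T_def insert_commute)
    obtain b where b: "{q, b} \<in> ?D" "q \<noteq> b" using partner pT by metis
    have aV: "a \<in> V" "a \<notin> T" using right P(2) by (auto simp: T_def)
    have btw: "\<not> between q a x" if "x \<in> T" for x
    proof
      assume "between q a x"
      moreover have "x \<noteq> p" "x \<noteq> q" "x \<noteq> a" "x \<in> V" using that aV pT calculation
        by (auto simp: between_def T_def)
      moreover have "\<not> between p a q" using P(6)[OF right(2) pq(2)] right(1) by blast
      ultimately have "between p a x" using pq(3,4) right(3,4) unfolding between_def by (auto simp: disjoint_iff)
      then show False using P(6)[OF right(2) \<open>x \<in> V\<close>] that by (auto simp: T_def)
    qed
    have ne: "{p, a} \<noteq> {q, b}" and nD: "{p, a} \<notin> ?D" and nU: "{q, b} \<notin> U" "{p, q} \<notin> U"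
      using disj b right by blast+
    have D': "consecutive_pairs (insert a (T - {q})) = insert {b, a} (?D - {{q, b}})"
      by (rule consecutive_pairs_replace[OF pT(1) aV(2) btw b(1)])
    have "(U - {{p, a}}) \<union> insert {b, a} (?D - {{q, b}}) = insert {a, b} (?L - {{p, a}, {q, b}})"
      "insert {b, a} (?D - {{q, b}}) = (?D - {{p, a}, {q, b}}) \<union> {{a, b}}"
      using nD nU by (auto simp: insert_commute)
    then have "diagram ?V (contract p q U) =
       (insert {a, b} (?L - {{p, a}, {q, b}}), (?D - {{p, a}, {q, b}}) \<union> {{a, b}})"
      unfolding diagram_def right(5) T' D' by simp
    then show ?thesis
      using join_rule[where a = a and b = b and L' = "insert {a, b} (?L - {{p, a}, {q, b}})" and D' = "(?D - {{p, a}, {q, b}}) \<union> {{a, b}}"]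
        b right ne nD nU pT unfolding diag by simp
  next
    case (join a b)
    have pT: "p \<notin> T" using join by (auto simp: T_def)
    have nU: "{p, q} \<notin> U" using planar_partner_unique[OF U join(1)] join(6) by blast
    have nD: "{p, a} \<notin> ?D" "{q, b} \<notin> ?D" using disj join by blast+
    have UU: "\<Union>(contract p q U) = \<Union>U - {p, q}"
    proof (intro subset_antisym subsetI)
      fix x assume "x \<in> \<Union>(contract p q U)"
      then consider "x = a \<or> x = b" | l where "l \<in> U" "l \<noteq> {p, a}" "l \<noteq> {q, b}" "x \<in> l"
        unfolding join(9) by blast
      then show "x \<in> \<Union>U - {p, q}"
      proof cases
        case 2
        then show ?thesis using disU[OF 2(1) join(1) 2(2)] disU[OF 2(1) join(2) 2(3)] by blast
      qed (use join in auto)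
    next
      fix x assume "x \<in> \<Union>U - {p, q}"
      then show "x \<in> \<Union>(contract p q U)" unfolding join(9) by blast
    qed
    then have T': "?V - \<Union>(contract p q U) = T" using join by (auto simp: T_def)
    have "insert {a, b} (U - {{p, a}, {q, b}}) \<union> ?D = insert {a, b} (?L - {{p, a}, {q, b}})"
      "?D - {{p, a}, {q, b}} = ?D"
      using nD by auto
    then have "diagram ?V (contract p q U) =
       (insert {a, b} (?L - {{p, a}, {q, b}}), ?D - {{p, a}, {q, b}})"
      unfolding diagram_def T' unfolding join(9) by simp
    then show ?thesis
      using join_rule[where a = a and b = b and L' = "insert {a, b} (?L - {{p, a}, {q, b}})" and D' = "?D - {{p, a}, {q, b}}"]
        join nD nU pT unfolding diag by simp
  qed
qed

lemma planar_glue_empty: "planar V U \<Longrightarrow> glue V (diagram V U) {} = (diagram V U, 0, 0, 0)"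
  unfolding diagram_def by (rule glue_empty[OF planar_diagram_partition_on]) auto

section \<open>Gluings that are contracted pair by pair\<close>

lemma disjoint_insertI: "disjoint P \<Longrightarrow> l \<inter> \<Union>P = {} \<Longrightarrow> disjoint (insert l P)"
  by (simp add: pairwise_insert disjnt_def) blast

text \<open>Abstracts from the coordinates of the stack: the induction over contractions sees
  nothing but adjacency in the points that are left.\<close>

inductive nested :: "nat set \<Rightarrow> nat set set \<Rightarrow> bool" where
  nested_empty: "nested V {}"
| nested_step: "p < q \<Longrightarrow> p \<in> V \<Longrightarrow> q \<in> V \<Longrightarrow> V \<inter> {p<..<q} = {} \<Longrightarrow> {p, q} \<in> M \<Longrightarrow>
    nested (V - {p, q}) (M - {{p, q}}) \<Longrightarrow> nested V M"

lemma nested_disjoint: "nested V M \<Longrightarrow> disjoint M \<and> \<Union>M \<subseteq> V"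
proof (induction rule: nested.induct)
  case (nested_step p q V M)
  have M: "M = insert {p, q} (M - {{p, q}})" using nested_step.hyps(5) by blast
  have "{p, q} \<inter> \<Union>(M - {{p, q}}) = {}" using nested_step.IH by blast
  then have "disjoint (insert {p, q} (M - {{p, q}}))"
    using nested_step.IH by (intro disjoint_insertI) auto
  moreover have "\<Union>(insert {p, q} (M - {{p, q}})) \<subseteq> V"
    using nested_step.IH nested_step.hyps(2,3) by blast
  ultimately show ?case using M by simp
qed auto

text \<open>The undecorated lines do not meet the deleted points, and parity survives because two
  defects leave at once.\<close>

lemma planar_remove_ends:
  assumes U: "planar V U" and ends: "v \<in> V - \<Union>U" "w \<in> V - \<Union>U" "v \<noteq> w"
  shows "planar (V - {v, w}) U"
proof -
  have "V - {v, w} - \<Union>U = (V - \<Union>U) - {v, w}" by auto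
  moreover have "card ((V - \<Union>U) - {v, w}) = card (V - \<Union>U) - 2"
    using ends planarD(1)[OF U] by (subst card_Diff_subset) auto
  moreover have "\<Union>U \<subseteq> V - {v, w}" using planarD(2)[OF U] ends by blast
  ultimately show ?thesis using U unfolding planar_def by auto
qed

lemma contract_outside: "x \<notin> \<Union>U \<Longrightarrow> x \<notin> \<Union>(contract p q U)"
  unfolding contract_def by blast

text \<open>
  Removing the first and the last defect shifts the position of every other defect among the
  defects by one. This exchanges the two ways in which adjacent defects can be joined: closing a
  loop with a single blob and merging two blobs.
\<close>

lemma planar_glue_nested:
  assumes "nested V M" "planar V U" "v \<in> V - \<Union>U - \<Union>M" "w \<in> V - \<Union>U - \<Union>M" "v < w"
    and "\<And>x. x \<in> V \<Longrightarrow> v \<le> x \<and> x \<le> w"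
  shows "\<exists>U' i j k. planar (V - \<Union>M) U' \<and> v \<notin> \<Union>U' \<and> w \<notin> \<Union>U' \<and>
    glue V (diagram V U) M = (diagram (V - \<Union>M) U', i, j, k) \<and>
    glue (V - {v, w}) (diagram (V - {v, w}) U) M = (diagram (V - \<Union>M - {v, w}) U', i, k, j)"
  using assms
proof (induction arbitrary: U rule: nested.induct)
  case (nested_empty V)
  have "planar (V - {v, w}) U" using nested_empty by (intro planar_remove_ends) auto
  with nested_empty show ?case
    by (intro exI[of _ U] exI[of _ 0]) (simp add: planar_glue_empty)
next
  case (nested_step p q V M)
  let ?V = "V - {p, q}" and ?M = "M - {{p, q}}" and ?U = "contract p q U" and ?W = "V - {v, w}"
  have "nested V M" by (rule nested.nested_step[OF nested_step.hyps])
  then have M: "disjoint M" "\<Union>M \<subseteq> V" using nested_disjoint by blast+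
  have pqvw: "{p, q} \<inter> {v, w} = {}" using nested_step.hyps(5) nested_step.prems(2,3) by blast
  have MW: "\<Union>M \<subseteq> ?W" using M nested_step.prems(2,3) by blast
  have vM: "V - \<Union>M = ?V - \<Union>?M" using nested_step.hyps(5) by auto
  have pU: "planar ?V ?U" by (rule planar_contract[OF nested_step.prems(1) nested_step.hyps(2,3,1,4)])
  have out: "v \<in> ?V - \<Union>?U - \<Union>?M" "w \<in> ?V - \<Union>?U - \<Union>?M"
    using nested_step.prems(2,3) pqvw contract_outside by auto
  obtain U' i j k where IH: "planar (?V - \<Union>?M) U'" "v \<notin> \<Union>U'" "w \<notin> \<Union>U'"
    "glue ?V (diagram ?V ?U) ?M = (diagram (?V - \<Union>?M) U', i, j, k)"
    "glue (?V - {v, w}) (diagram (?V - {v, w}) ?U) ?M = (diagram (?V - \<Union>?M - {v, w}) U', i, k, j)"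
  proof -
    have le: "v \<le> x \<and> x \<le> w" if "x \<in> ?V" for x using nested_step.prems(5) that by blast
    note IH = nested_step.IH[OF pU out nested_step.prems(4) le]
    show ?thesis by (insert IH, drule meta_mp, assumption, elim exE conjE, rule that)
  qed
  have W: "?W - {p, q} = ?V - {v, w}" by auto
  have planarW: "planar ?W U" using nested_step.prems by (intro planar_remove_ends) auto
  let ?T = "V - \<Union>U"
  have TW: "?W - \<Union>U = ?T - {v, w}" by auto
  \<comment> \<open>Glued points differ from \<open>v\<close> and \<open>w\<close>, so they lie
    strictly between these extremes: below \<open>p\<close> exactly one defect is lost.\<close>
  have vp: "v < p" "p < w"
    using nested_step.prems(5)[OF nested_step.hyps(2)] pqvw by (auto simp: order_less_le)
  have "?T \<inter> {..<p} = insert v ((?T - {v, w}) \<inter> {..<p})"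
    using vp nested_step.prems(2) by auto
  then have "card (?T \<inter> {..<p}) = card (insert v ((?T - {v, w}) \<inter> {..<p}))" by simp
  also have "\<dots> = Suc (card ((?T - {v, w}) \<inter> {..<p}))" by simp
  finally have flip: "even (card (?T \<inter> {..<p})) \<longleftrightarrow> odd (card ((?T - {v, w}) \<inter> {..<p}))" by simp
  have defect: "x \<in> ?T - {v, w} \<longleftrightarrow> x \<in> ?T" if "x \<in> {p, q}" for x using pqvw that by auto
  have pW: "p \<in> ?W" "q \<in> ?W" "?W \<inter> {p<..<q} = {}" using nested_step.hyps pqvw by auto
  note g1 = planar_glue_contract[OF nested_step.prems(1) nested_step.hyps(2,3,1,4,5) M]
  note g2 = planar_glue_contract[OF planarW pW(1,2) nested_step.hyps(1) pW(3) nested_step.hyps(5) M(1) MW]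
  let ?i = "if {p, q} \<in> U then 1 else 0 :: nat"
    and ?j = "if p \<in> ?T \<and> q \<in> ?T \<and> odd (card (?T \<inter> {..<p})) then 1 else 0 :: nat"
    and ?k = "if p \<in> ?T \<and> q \<in> ?T \<and> even (card (?T \<inter> {..<p})) then 1 else 0 :: nat"
  have "glue V (diagram V U) M = (diagram (V - \<Union>M) U', i + ?i, j + ?j, k + ?k)"
    unfolding g1 IH(4) vM scale.simps ..
  moreover have "glue ?W (diagram ?W U) M = (diagram (V - \<Union>M - {v, w}) U', i + ?i, k + ?k, j + ?j)"
    unfolding g2 W IH(5) vM scale.simps unfolding TW using flip defect[of p] defect[of q] by simp
  ultimately show ?case using IH(1-3) unfolding vM by blast
qed

section \<open>Blob diagrams as planar diagrams\<close>

text \<open>The conditions of \<open>blob_diagrams\<close> with numbers in place of vertices, on an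
  arbitrary set of numbers, so that a diagram can be placed anywhere on the line.\<close>

definition ordered_blob_diagrams :: "nat set \<Rightarrow> (nat set set \<times> nat set set) set" where
  "ordered_blob_diagrams V = {(L, D). partition_on V L \<and> (\<forall>l\<in>L. card l = 2) \<and>
     (\<forall>a b c d. {a, c} \<in> L \<and> {b, d} \<in> L \<longrightarrow> \<not> (a < b \<and> b < c \<and> c < d)) \<and>
     D \<subseteq> L \<and> (\<forall>l\<in>D. \<not> (\<exists>a b. {a, b} \<in> L \<and> (\<forall>v\<in>l. a < v \<and> v < b)))}"

lemma even_card_Union_pairs:
  assumes "disjoint D" "\<And>l. l \<in> D \<Longrightarrow> card l = 2"
  shows "even (card (\<Union>D))"
proof -
  have "finite l" if "l \<in> D" for l using assms(2)[OF that] by (intro card_ge_0_finite) simp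
  then have "card (\<Union>D) = (\<Sum>l\<in>D. card l)"
    using assms(1) by (intro card_Union_disjoint) (auto simp: disjoint_def pairwise_def disjnt_def)
  also have "\<dots> = (\<Sum>l\<in>D. 2)" using assms(2) by (intro sum.cong) auto
  finally show ?thesis by simp
qed

text \<open>Noncrossing lines are nested or apart, and a nested line is not exposed, hence
  undecorated. Thus everything enclosed by a line is undecorated, which gives the planarity of
  \<open>L - D\<close> and shows that no decorated end lies between the two ends of a decorated
  line.\<close>

lemma ordered_blob_diagrams_imp_planar:
  assumes fin: "finite V" and LD: "(L, D) \<in> ordered_blob_diagrams V"
  shows "planar V (L - D)" "(L, D) = diagram V (L - D)"
proof -
  have part: "partition_on V L" and c2: "\<And>l. l \<in> L \<Longrightarrow> card l = 2" and DL: "D \<subseteq> L"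
    and nc: "\<And>a b c d. {a, c} \<in> L \<Longrightarrow> {b, d} \<in> L \<Longrightarrow> a < b \<Longrightarrow> b < c \<Longrightarrow> c < d \<Longrightarrow> False"
    and ex: "\<And>l a b. l \<in> D \<Longrightarrow> {a, b} \<in> L \<Longrightarrow> (\<And>v. v \<in> l \<Longrightarrow> a < v \<and> v < b) \<Longrightarrow> False"
  proof -
    have *: "partition_on V L \<and> (\<forall>l\<in>L. card l = 2) \<and>
      (\<forall>a b c d. {a, c} \<in> L \<and> {b, d} \<in> L \<longrightarrow> \<not> (a < b \<and> b < c \<and> c < d)) \<and>
      D \<subseteq> L \<and> (\<forall>l\<in>D. \<not> (\<exists>a b. {a, b} \<in> L \<and> (\<forall>v\<in>l. a < v \<and> v < b)))"
      using LD by (simp add: ordered_blob_diagrams_def)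
    show "partition_on V L" "\<And>l. l \<in> L \<Longrightarrow> card l = 2" "D \<subseteq> L" using * by simp_all
    show "False" if "{a, c} \<in> L" "{b, d} \<in> L" "a < b" "b < c" "c < d" for a b c d
      using * that by metis
    show "False" if "l \<in> D" "{a, b} \<in> L" "\<And>v. v \<in> l \<Longrightarrow> a < v \<and> v < b" for l a b
      using * that by metis
  qed
  have UL: "\<Union>L = V" and dis: "disjoint L" using part by (auto simp: partition_on_def)
  have away: "l \<inter> m = {}" if "l \<in> L" "m \<in> L" "l \<noteq> m" for l m
    using dis that by (auto simp: disjoint_def)
  have line: "\<exists>y. y \<noteq> x \<and> {x, y} = l" if l: "l \<in> L" "x \<in> l" for x l
  proof -
    obtain u v where "l = {u, v}" "u \<noteq> v" using c2[OF l(1)] by (auto simp: card_2_iff)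
    with l show ?thesis by (auto simp: insert_commute)
  qed
  have inside: "c < y \<and> y < d \<and> {x, y} \<notin> D" if "{c, d} \<in> L" "{x, y} \<in> L" "c < x" "x < d" for c d x y
  proof -
    have "{c, d} \<noteq> {x, y}" using that(3,4) by (auto simp: doubleton_eq_iff)
    then have "y \<noteq> c" "y \<noteq> d" using away[OF that(1,2)] by auto
    moreover have "\<not> y < c"
      using nc[of y x c d] that by (auto simp: insert_commute)
    moreover have "\<not> d < y" using nc[of c d x y] that by auto
    ultimately have "c < y" "y < d" by auto
    moreover have "{x, y} \<notin> D" using ex[of "{x, y}" c d] that calculation by auto
    ultimately show ?thesis by blast
  qed
  have T: "V - \<Union>(L - D) = \<Union>D"
  proof (intro subset_antisym subsetI)
    show "x \<in> \<Union>D" if "x \<in> V - \<Union>(L - D)" for x using that UL by blast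
    fix x assume "x \<in> \<Union>D"
    then obtain l where l: "l \<in> D" "x \<in> l" by blast
    moreover from this have "x \<in> V" using UL DL by blast
    moreover have "x \<notin> m" if "m \<in> L - D" for m using away[of l m] l that DL by blast
    ultimately show "x \<in> V - \<Union>(L - D)" by blast
  qed
  have disD: "disjoint D" using dis DL by (auto simp: disjoint_def)
  show "planar V (L - D)"
    unfolding planar_def
  proof (intro conjI allI impI)
    show "even (card (V - \<Union> (L - D)))"
      unfolding T using disD c2 DL by (intro even_card_Union_pairs) auto
    fix c d x assume cd: "{c, d} \<in> L - D" and x: "x \<in> V" "between c d x"
    obtain l where "l \<in> L" "x \<in> l" using x UL by blast
    then obtain y where y: "{x, y} \<in> L" using line by metis
    have dc: "{d, c} \<in> L" using cd by (simp add: insert_commute)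
    have "between c d y \<and> {x, y} \<notin> D"
      using x(2) inside[of c d x y] inside[OF dc y] cd y unfolding between_def by blast
    with y show "\<exists>y. {x, y} \<in> L - D \<and> between c d y" by blast
  qed (use fin UL c2 dis in \<open>auto simp: disjoint_def\<close>)
  have gap: "\<Union>D \<inter> {x<..<y} = {}" if "{x, y} \<in> D" for x y
  proof (rule ccontr)
    assume "\<Union>D \<inter> {x<..<y} \<noteq> {}"
    then obtain z m where z: "x < z" "z < y" "m \<in> D" "z \<in> m" by auto
    then obtain w where "{z, w} = m" using line[of m z] DL by blast
    with z inside[of x y z w] that DL show False by blast
  qed
  have "consecutive_pairs (\<Union>D) = D"
  proof (rule consecutive_pairs_eqI)
    show "D \<subseteq> consecutive_pairs (\<Union>D)"
    proof
      fix l assume l: "l \<in> D"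
      then obtain u v where "l = {u, v}" "u \<noteq> v" using c2[of l] DL by (auto simp: card_2_iff)
      then obtain x y where xy: "l = {x, y}" "x < y"
        by (metis insert_commute linorder_neqE_nat)
      \<comment> \<open>No decorated line straddles \<open>x\<close>, because \<open>x\<close> is a
        decorated end itself. The decorated ends before \<open>x\<close> therefore come in whole
        lines, and their number is even.\<close>
      have "\<Union>D \<inter> {..<x} = \<Union>{m \<in> D. m \<subseteq> {..<x}}"
      proof (intro subset_antisym subsetI)
        fix z assume "z \<in> \<Union>D \<inter> {..<x}"
        then obtain m where m: "m \<in> D" "z \<in> m" "z < x" by auto
        then obtain w where w: "{z, w} = m" using line[of m z] DL by blast
        have "m \<noteq> l" using m(2,3) xy by auto
        then have "w \<noteq> x" using away[of m l] m(1) l DL w xy(1) by blast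
        moreover have "\<not> x < w"
        proof -
          have "x \<in> \<Union>D" using l xy(1) by blast
          then show ?thesis using gap[of z w] w m by (auto simp: disjoint_iff)
        qed
        ultimately have "m \<subseteq> {..<x}" using w m(3) by auto
        then show "z \<in> \<Union>{m \<in> D. m \<subseteq> {..<x}}" using m by blast
      qed blast
      moreover have "even (card (\<Union>{m \<in> D. m \<subseteq> {..<x}}))"
        using disD c2 DL by (intro even_card_Union_pairs) (auto simp: disjoint_def)
      ultimately have "even (card (\<Union>D \<inter> {..<x}))" by simp
      then show "l \<in> consecutive_pairs (\<Union>D)"
        unfolding xy(1) using xy l gap[of x y] by (intro consecutive_pairsI) auto
    qed
  qed blast
  then show "(L, D) = diagram V (L - D)"
    unfolding diagram_def T using DL by auto
qed

text \<open>Undecorated lines enclose only undecorated lines, and no defect lies between the ends of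
  a consecutive pair. So lines cannot cross, and no line encloses a defect, which makes the
  decorated lines exposed.\<close>

lemma planar_imp_ordered_blob_diagrams:
  assumes "planar V U"
  shows "diagram V U \<in> ordered_blob_diagrams V"
proof -
  note P = planarD[OF assms]
  let ?T = "V - \<Union>U"
  let ?D = "consecutive_pairs ?T"
  have part: "partition_on V (U \<union> ?D)" by (rule planar_diagram_partition_on[OF assms])
  then have dis: "disjoint (U \<union> ?D)" by (auto simp: partition_on_def)
  have UV: "\<Union>(U \<union> ?D) = V" using part by (auto simp: partition_on_def)
  have uniq: "y = z" if "{x, y} \<in> U \<union> ?D" "{x, z} \<in> U \<union> ?D" for x y z
    using disjoint_unique[OF dis that, of x] by (auto simp: doubleton_eq_iff)
  have "\<not> (a < b \<and> b < c \<and> c < d)" if L: "{a, c} \<in> U \<union> ?D" "{b, d} \<in> U \<union> ?D" for a b c d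
  proof
    assume less: "a < b \<and> b < c \<and> c < d"
    have V: "b \<in> V" "c \<in> V" using L UV by blast+
    show False
    proof (cases "{a, c} \<in> U")
      case True
      then obtain y where "{b, y} \<in> U" "between a c y"
        using P(6)[OF True V(1)] less by (auto simp: between_def)
      then show False using uniq[OF L(2), of y] less by (auto simp: between_def)
    next
      case False
      then have ac: "{a, c} \<in> ?D" using L by blast
      have "a < c" using less by simp
      note ac = pair_in_consecutive_pairs[OF ac this]
      show False
      proof (cases "{b, d} \<in> U")
        case True
        then have "c \<in> \<Union>U" using P(6)[OF True V(2)] less by (auto simp: between_def)
        with ac(2) show False by blast
      next
        case False
        then have "b \<in> ?T" using L(2) consecutive_pairs_Union_subset[of ?T] by blast
        with ac(3) less show False by (auto simp: disjoint_iff)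
      qed
    qed
  qed
  moreover have "\<not> (\<exists>a b. {a, b} \<in> U \<union> ?D \<and> (\<forall>v\<in>l. a < v \<and> v < b))" if l: "l \<in> ?D" for l
  proof (intro notI, elim exE conjE)
    fix a b assume ab: "{a, b} \<in> U \<union> ?D" "\<forall>v\<in>l. a < v \<and> v < b"
    obtain x where x: "x \<in> l" "x \<in> ?T" by (rule consecutive_pairsE[OF l]) blast
    then have lt: "a < x" "x < b" using ab(2) by auto
    then have "{a, b} \<notin> U" using P(6)[of a b x] x(2) by (auto simp: between_def)
    then have "?T \<inter> {a<..<b} = {}" using ab(1) lt pair_in_consecutive_pairs(3)[of a b ?T] by auto
    with x(2) lt show False by (auto simp: disjoint_iff)
  qed
  ultimately show ?thesis
    using part P(3) consecutive_pairs_card unfolding diagram_def ordered_blob_diagrams_def by blast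
qed

section \<open>Numberings of the vertices along the clockwise order\<close>

text \<open>Only the order matters, not the values: the two factors and their product get different
  numbers on one common line, and those of the product have a gap.\<close>

definition clockwise :: "nat \<Rightarrow> (vertex \<Rightarrow> nat) \<Rightarrow> bool" where
  "clockwise n g \<longleftrightarrow>
     (\<forall>u\<in>vertices n. \<forall>v\<in>vertices n. position n u < position n v \<longrightarrow> g u < g v)"

definition map_diagram :: "('a \<Rightarrow> 'b) \<Rightarrow> 'a set set \<times> 'a set set \<Rightarrow> 'b set set \<times> 'b set set" where
  "map_diagram g d = ((`) g ` fst d, (`) g ` snd d)"

text \<open>A numbering is injective on the vertices only, so \<open>map_diagram\<close> can be
  inverted only on diagrams confined to them.\<close>

definition on_vertices :: "nat \<Rightarrow> blob_diagram \<Rightarrow> bool" where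
  "on_vertices n d \<longleftrightarrow> fst d \<subseteq> Pow (vertices n) \<and> snd d \<subseteq> Pow (vertices n)"

lemma finite_vertices: "finite (vertices n)"
  by (simp add: vertices_def)

lemma inj_on_position: "inj_on (position n) (vertices n)"
  by (auto simp: inj_on_def vertices_def)

lemma position_bounds: "v \<in> vertices n \<Longrightarrow> 1 \<le> position n v \<and> position n v \<le> 2 * n"
  by (auto simp: vertices_def)

lemma clockwise_less_iff:
  assumes "clockwise n g" "u \<in> vertices n" "v \<in> vertices n"
  shows "g u < g v \<longleftrightarrow> position n u < position n v"
proof
  assume "g u < g v"
  then have "u \<noteq> v" by auto
  moreover have "\<not> position n v < position n u"
  proof
    assume "position n v < position n u"
    then have "g v < g u" using assms by (simp add: clockwise_def)
    with \<open>g u < g v\<close> show False by simp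
  qed
  moreover have "position n u \<noteq> position n v"
    using inj_on_position assms(2,3) \<open>u \<noteq> v\<close> by (auto dest: inj_onD)
  ultimately show "position n u < position n v" by simp
qed (use assms in \<open>simp add: clockwise_def\<close>)

lemma clockwise_inj_on:
  assumes "clockwise n g"
  shows "inj_on g (vertices n)"
proof (rule inj_onI)
  fix u v assume uv: "u \<in> vertices n" "v \<in> vertices n" "g u = g v"
  then have "position n u = position n v"
    using clockwise_less_iff[OF assms uv(1,2)] clockwise_less_iff[OF assms uv(2,1)] by simp
  with uv show "u = v" using inj_on_position by (auto dest: inj_onD)
qed

lemma map_diagram_inj:
  assumes "inj_on g (vertices n)" "on_vertices n d" "on_vertices n d'" "map_diagram g d = map_diagram g d'"
  shows "d = d'"
proof -
  have "inj_on ((`) g) (Pow (vertices n))" using assms(1) by (rule inj_on_image_Pow)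
  then have "inj_on ((`) ((`) g)) (Pow (Pow (vertices n)))" by (rule inj_on_image_Pow)
  with assms(2-4) show ?thesis
    unfolding map_diagram_def on_vertices_def by (auto intro!: prod_eqI dest: inj_onD)
qed

lemma pair_image_iff:
  assumes "inj_on g A" "L \<subseteq> Pow A"
  shows "{x, y} \<in> (`) g ` L \<longleftrightarrow> (\<exists>u v. x = g u \<and> y = g v \<and> {u, v} \<in> L)"
proof
  assume "{x, y} \<in> (`) g ` L"
  then obtain l where l: "l \<in> L" "{x, y} = g ` l" by blast
  then obtain u v where uv: "u \<in> l" "v \<in> l" "x = g u" "y = g v" by blast
  have "w = u \<or> w = v" if "w \<in> l" for w
  proof -
    have "g w = g u \<or> g w = g v" using l(2) that uv by blast
    then show ?thesis using assms l(1) that uv(1,2) by (metis PowD inj_onD subsetD)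
  qed
  then have "l = {u, v}" using uv by blast
  with l uv show "\<exists>u v. x = g u \<and> y = g v \<and> {u, v} \<in> L" by blast
next
  assume "\<exists>u v. x = g u \<and> y = g v \<and> {u, v} \<in> L"
  then obtain u v where uv: "x = g u" "y = g v" "{u, v} \<in> L" by blast
  then have "{x, y} = g ` {u, v}" by simp
  with uv(3) show "{x, y} \<in> (`) g ` L" by blast
qed

lemma partition_on_image_iff:
  assumes g: "inj_on g A" and L: "L \<subseteq> Pow A"
  shows "partition_on (g ` A) ((`) g ` L) \<longleftrightarrow> partition_on A L"
proof -
  have "\<Union>((`) g ` L) = g ` A \<longleftrightarrow> \<Union>L = A"
  proof -
    have "\<Union>((`) g ` L) = g ` \<Union>L" by blast
    moreover have "g ` \<Union>L = g ` A \<longleftrightarrow> \<Union>L = A"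
      using L by (intro inj_on_image_eq_iff[OF g]) auto
    ultimately show ?thesis by simp
  qed
  moreover have "disjoint ((`) g ` L) \<longleftrightarrow> disjoint L"
  proof -
    have "g ` l = g ` m \<longleftrightarrow> l = m" "g ` l \<inter> g ` m = {} \<longleftrightarrow> l \<inter> m = {}" if "l \<in> L" "m \<in> L" for l m
    proof -
      have "l \<subseteq> A" "m \<subseteq> A" using that L by auto
      then show "g ` l = g ` m \<longleftrightarrow> l = m" "g ` l \<inter> g ` m = {} \<longleftrightarrow> l \<inter> m = {}"
        using inj_on_image_eq_iff[OF g] inj_on_image_Int[OF g] by (simp, metis image_is_empty)
    qed
    then show ?thesis unfolding disjoint_def by simp
  qed
  ultimately show ?thesis unfolding partition_on_def by auto
qed

text \<open>Every condition compares positions, and a clockwise numbering preserves and reflects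
  their order.\<close>

lemma blob_diagrams_iff_ordered:
  assumes g: "clockwise n g"
  shows "d \<in> blob_diagrams n \<longleftrightarrow>
    on_vertices n d \<and> map_diagram g d \<in> ordered_blob_diagrams (g ` vertices n)"
proof -
  obtain L D where d: "d = (L, D)" by (cases d)
  have inj: "inj_on g (vertices n)" by (rule clockwise_inj_on[OF g])
  have "L \<subseteq> Pow (vertices n) \<and> D \<subseteq> Pow (vertices n)" if "d \<in> blob_diagrams n"
    using that unfolding d blob_diagrams_def TL_diagrams_def partition_on_def by blast
  moreover have "d \<in> blob_diagrams n \<longleftrightarrow> map_diagram g d \<in> ordered_blob_diagrams (g ` vertices n)"
    if sub: "L \<subseteq> Pow (vertices n)" "D \<subseteq> Pow (vertices n)"
  proof -
    note pair = pair_image_iff[OF inj sub(1)]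
    have in_V: "u \<in> vertices n" "v \<in> vertices n" if "{u, v} \<in> L" for u v using sub that by blast+
    note less = clockwise_less_iff[OF g]
    have 1: "(\<forall>l\<in>(`) g ` L. card l = 2) \<longleftrightarrow> (\<forall>l\<in>L. card l = 2)"
    proof -
      have "card (g ` l) = card l" if "l \<in> L" for l
        using sub that by (intro card_image inj_on_subset[OF inj]) auto
      then show ?thesis by auto
    qed
    have 2: "(\<forall>a b c d. {a, c} \<in> (`) g ` L \<and> {b, d} \<in> (`) g ` L \<longrightarrow> \<not> (a < b \<and> b < c \<and> c < d))
       \<longleftrightarrow> noncrossing n L" (is "?l \<longleftrightarrow> _")
    proof
      assume l: ?l
      show "noncrossing n L"
        unfolding noncrossing_def
      proof (intro allI impI, elim conjE)
        fix a b c d assume L: "{a, c} \<in> L" "{b, d} \<in> L"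
        then have "\<not> (g a < g b \<and> g b < g c \<and> g c < g d)"
          using l[rule_format, of "g a" "g c" "g b" "g d"] pair by metis
        then show "\<not> (position n a < position n b \<and> position n b < position n c \<and> position n c < position n d)"
          using less in_V L by metis
      qed
    next
      assume r: "noncrossing n L"
      show ?l
      proof (intro allI impI notI, elim conjE)
        fix a b c d assume L: "{a, c} \<in> (`) g ` L" "{b, d} \<in> (`) g ` L" and lt: "a < b" "b < c" "c < d"
        obtain a' c' where ac: "a = g a'" "c = g c'" "{a', c'} \<in> L" using L(1) pair by blast
        obtain b' d' where bd: "b = g b'" "d = g d'" "{b', d'} \<in> L" using L(2) pair by blast
        have "position n a' < position n b' \<and> position n b' < position n c' \<and> position n c' < position n d'"
          using lt less in_V ac bd by metis
        with r ac(3) bd(3) show False unfolding noncrossing_def by blast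
      qed
    qed
    have 3: "(`) g ` D \<subseteq> (`) g ` L \<longleftrightarrow> D \<subseteq> L"
    proof -
      have "g ` l \<in> (`) g ` L \<longleftrightarrow> l \<in> L" if "l \<in> D" for l
        using sub that by (intro inj_on_image_mem_iff[OF inj_on_image_Pow[OF inj]]) auto
      then show ?thesis unfolding image_subset_iff unfolding subset_eq by (rule ball_cong[OF refl])
    qed
    have 4: "(\<forall>l\<in>(`) g ` D. \<not> (\<exists>a b. {a, b} \<in> (`) g ` L \<and> (\<forall>v\<in>l. a < v \<and> v < b))) \<longleftrightarrow>
       (\<forall>l\<in>D. western_exposed n L l)"
    proof -
      have "(\<exists>a b. {a, b} \<in> (`) g ` L \<and> (\<forall>v\<in>g ` l. a < v \<and> v < b)) \<longleftrightarrow> \<not> western_exposed n L l"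
        if l: "l \<in> D" for l
      proof -
        have eq: "(\<forall>v\<in>g ` l. g a < v \<and> v < g b) \<longleftrightarrow>
            (\<forall>v\<in>l. position n a < position n v \<and> position n v < position n b)" if "{a, b} \<in> L" for a b
        proof -
          have "g a < g v \<longleftrightarrow> position n a < position n v" "g v < g b \<longleftrightarrow> position n v < position n b"
            if "v \<in> l" for v
            using less in_V[OF \<open>{a, b} \<in> L\<close>] sub(2) l that by blast+
          then show ?thesis by simp
        qed
        have "(\<exists>a b. {a, b} \<in> (`) g ` L \<and> (\<forall>v\<in>g ` l. a < v \<and> v < b)) \<longleftrightarrow>
            (\<exists>a b. {a, b} \<in> L \<and> (\<forall>v\<in>g ` l. g a < v \<and> v < g b))"
          unfolding pair by blast
        also have "\<dots> \<longleftrightarrow>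
            (\<exists>a b. {a, b} \<in> L \<and> (\<forall>v\<in>l. position n a < position n v \<and> position n v < position n b))"
          by (intro ex_cong1 conj_cong refl eq)
        finally show ?thesis unfolding western_exposed_def by blast
      qed
      then have "\<not> (\<exists>a b. {a, b} \<in> (`) g ` L \<and> (\<forall>v\<in>g ` l. a < v \<and> v < b)) \<longleftrightarrow>
          western_exposed n L l" if "l \<in> D" for l using that by blast
      then show ?thesis unfolding ball_simps(9) by (rule ball_cong[OF refl])
    qed
    show ?thesis
      unfolding d blob_diagrams_def ordered_blob_diagrams_def TL_diagrams_def map_diagram_def
      by (simp only: fst_conv snd_conv mem_Collect_eq prod.case 1 2 3 4 partition_on_image_iff[OF inj sub(1)]) blast
  qed
  ultimately show ?thesis unfolding on_vertices_def d by auto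
qed

lemma blob_diagrams_iff_planar:
  assumes g: "clockwise n g"
  shows "d \<in> blob_diagrams n \<longleftrightarrow>
    on_vertices n d \<and> (\<exists>U. planar (g ` vertices n) U \<and> map_diagram g d = diagram (g ` vertices n) U)"
proof -
  have "map_diagram g d \<in> ordered_blob_diagrams (g ` vertices n) \<longleftrightarrow>
      (\<exists>U. planar (g ` vertices n) U \<and> map_diagram g d = diagram (g ` vertices n) U)"
    using ordered_blob_diagrams_imp_planar[OF finite_imageI[OF finite_vertices]]
      planar_imp_ordered_blob_diagrams by (metis surj_pair)
  with blob_diagrams_iff_ordered[OF g] show ?thesis by blast
qed

text \<open>By \<open>Union_consecutive_pairs\<close> the defects are exactly the ends of decorated
  lines.\<close>

lemma corner_diagrams_iff_planar:
  assumes g: "clockwise n g" and n: "n \<ge> 1" and d: "d \<in> blob_diagrams n"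
    and U: "planar (g ` vertices n) U" "map_diagram g d = diagram (g ` vertices n) U"
  shows "d \<in> corner_diagrams n \<longleftrightarrow> g (North 1) \<notin> \<Union>U \<and> g (South 1) \<notin> \<Union>U"
proof -
  let ?V = "g ` vertices n"
  have D: "snd d \<subseteq> Pow (vertices n)" using d blob_diagrams_iff_planar[OF g] by (auto simp: on_vertices_def)
  have ends: "North 1 \<in> vertices n" "South 1 \<in> vertices n" using n by (auto simp: vertices_def)
  have "(\<exists>l\<in>snd d. v \<in> l) \<longleftrightarrow> g v \<notin> \<Union>U" if "v \<in> vertices n" for v
  proof -
    have "(\<exists>l\<in>snd d. v \<in> l) \<longleftrightarrow> g v \<in> g ` \<Union>(snd d)"
      using D that inj_on_image_mem_iff[OF clockwise_inj_on[OF g] that, of "\<Union>(snd d)"] by blast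
    also have "g ` \<Union>(snd d) = \<Union>(snd (map_diagram g d))" by (auto simp: map_diagram_def)
    also have "\<dots> = ?V - \<Union>U"
      unfolding U(2) diagram_def snd_conv using planarD[OF U(1)] by (intro Union_consecutive_pairs) auto
    finally show ?thesis using that by blast
  qed
  then show ?thesis using ends d unfolding corner_diagrams_def by (auto simp: case_prod_beta)
qed

section \<open>The map \<open>rho1\<close> in terms of defects\<close>

fun raise :: "vertex \<Rightarrow> vertex" where
  "raise (North i) = North (Suc i)"
| "raise (South i) = South (Suc i)"

lemma drop_first_raise [simp]: "drop_first (raise v) = v"
  by (cases v) auto

lemma raise_vertices: "raise ` vertices n = vertices (Suc n) - {North 1, South 1}"
proof -
  have "Suc ` {1..n} = {1..Suc n} - {1}" by (auto simp: image_iff)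
  moreover have "raise ` vertices n = North ` Suc ` {1..n} \<union> South ` Suc ` {1..n}"
    unfolding vertices_def image_Un image_image by simp
  ultimately show ?thesis unfolding vertices_def by auto
qed

lemma raise_in_vertices: "v \<in> vertices n \<Longrightarrow> raise v \<in> vertices (Suc n)"
  using raise_vertices by blast

lemma raise_drop_first: "v \<in> vertices (Suc n) - {North 1, South 1} \<Longrightarrow> raise (drop_first v) = v"
  unfolding raise_vertices[symmetric] by auto

lemma position_raise: "v \<in> vertices n \<Longrightarrow> position (Suc n) (raise v) = Suc (position n v)"
  by (auto simp: vertices_def)

text \<open>All positions are shifted by one, which keeps their order. Under
  \<open>g \<circ> raise\<close> the smaller diagram inherits the numbers of the larger one, so the
  renumbering of vertices vanishes from the description of \<open>rho1\<close>.\<close>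

lemma clockwise_raise: "clockwise (Suc n) g \<Longrightarrow> clockwise n (g \<circ> raise)"
  unfolding clockwise_def by (simp add: raise_in_vertices position_raise)

lemma pair_up_map: "pair_up (map f xs) = (`) f ` pair_up xs"
  by (induction xs rule: pair_up.induct) auto

lemma Union_pair_up: "\<Union>(pair_up xs) \<subseteq> set xs"
  by (induction xs rule: pair_up.induct) auto

text \<open>The two smallest entries form a block of even size below all others, so the pairings of
  block and rest can be united.\<close>

lemma pair_up_sorted:
  "sorted_wrt (<) xs \<Longrightarrow> even (length xs) \<Longrightarrow> pair_up xs = consecutive_pairs (set xs)"
proof (induction xs rule: pair_up.induct)
  case (1 a b xs)
  have c: "card (set xs) = length xs"
    using 1 by (intro distinct_card) (simp add: strict_sorted_iff)
  have "consecutive_pairs {a, b} = {{a, b}}"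
    using 1 by (intro consecutive_pairs_eqI) (auto intro!: consecutive_pairsI)
  moreover have "consecutive_pairs ({a, b} \<union> set xs) = consecutive_pairs {a, b} \<union> consecutive_pairs (set xs)"
    using 1 c by (intro consecutive_pairs_Un) (auto simp: card_insert_if)
  ultimately show ?case using 1 by simp
qed (auto simp: consecutive_pairs_def)

text \<open>Ensures that \<open>tl\<close> and \<open>butlast\<close> in \<open>rho1\<close> discard
  precisely the vertices 1 and 1'.\<close>

lemma sorted_list_ends:
  assumes "sorted_wrt (<) (map f xs)" "v \<in> set xs" "w \<in> set xs" "f v < f w"
    and "\<And>x. x \<in> set xs \<Longrightarrow> f v \<le> f x \<and> f x \<le> (f w :: nat)"
  shows "\<exists>ys. xs = v # ys @ [w]"
proof -
  have inj: "x = y" if "x \<in> set xs" "y \<in> set xs" "f x = f y" for x y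
  proof -
    have "distinct (map f xs)" using assms(1) strict_sorted_iff by blast
    then show ?thesis using that by (auto simp: distinct_map dest: inj_onD)
  qed
  obtain a zs where a: "xs = a # zs" using assms(2) by (cases xs) auto
  have "a = v" using a assms(1,2) assms(5)[of a] inj[of a v] by auto
  have "zs \<noteq> []" using a \<open>a = v\<close> assms(3,4) by auto
  then obtain ys b where b: "zs = ys @ [b]" by (metis rev_exhaust)
  have "b = w"
  proof (rule ccontr)
    assume "b \<noteq> w"
    then have "w \<in> set ys" using a b \<open>a = v\<close> assms(3,4) by auto
    then have "f w < f b" using a b assms(1) by (auto simp: sorted_wrt_append)
    then show False using assms(5)[of b] a b by auto
  qed
  with a b \<open>a = v\<close> show ?thesis by blast
qed

lemma (in linorder) sorted_key_list_of_set_inj_on: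
  assumes "inj_on f A" "finite A"
  shows "set (sorted_key_list_of_set f A) = A" "sorted_wrt (<) (map f (sorted_key_list_of_set f A))"
proof -
  interpret folding_insort_key "(\<le>)" "(<)" A f by unfold_locales (rule assms(1))
  show "set (sorted_key_list_of_set f A) = A" "sorted_wrt (<) (map f (sorted_key_list_of_set f A))"
    using assms(2) by simp_all
qed

text \<open>The lines in \<open>L - D\<close> are kept, and they are \<open>U\<close>. The list that
  \<open>pair_up\<close> receives enumerates the remaining defects in increasing order, so it
  produces their consecutive pairs.\<close>

lemma rho1_planar:
  assumes g: "clockwise (Suc n) g" and d: "on_vertices (Suc n) d"
    and U: "planar (g ` vertices (Suc n)) U" "map_diagram g d = diagram (g ` vertices (Suc n)) U"
    and ends: "g (North 1) \<notin> \<Union>U" "g (South 1) \<notin> \<Union>U"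
  shows "on_vertices n (rho1 (Suc n) d)"
    "map_diagram (g \<circ> raise) (rho1 (Suc n) d) =
      diagram (g ` vertices (Suc n) - {g (North 1), g (South 1)}) U"
proof -
  let ?n = "Suc n"
  let ?V = "g ` vertices ?n" and ?v = "North 1" and ?w = "South 1"
  let ?T = "?V - \<Union>U"
  obtain L D where LD: "d = (L, D)" by (cases d)
  have sub: "L \<subseteq> Pow (vertices ?n)" "D \<subseteq> Pow (vertices ?n)" using d by (auto simp: LD on_vertices_def)
  have gL: "(`) g ` L = U \<union> consecutive_pairs ?T" and gD: "(`) g ` D = consecutive_pairs ?T"
    using U(2) by (auto simp: LD map_diagram_def diagram_def)
  have inj: "inj_on g (vertices ?n)" by (rule clockwise_inj_on[OF g])
  have vw: "?v \<in> vertices ?n" "?w \<in> vertices ?n" by (auto simp: vertices_def)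
  have UT: "\<Union>(consecutive_pairs ?T) = ?T"
    using planarD[OF U(1)] by (intro Union_consecutive_pairs) auto
  then have gUD: "g ` \<Union>D = ?T" using gD by (metis image_Union)
  have UDV: "\<Union>D \<subseteq> vertices ?n" using sub by blast
  have finD: "finite (\<Union>D)" using UDV finite_vertices finite_subset by blast
  have mem: "v \<in> \<Union>D \<longleftrightarrow> g v \<in> ?T" if "v \<in> vertices ?n" for v
    using inj_on_image_mem_iff[OF inj that UDV] gUD by simp
  define xs where "xs = sorted_key_list_of_set (position ?n) (\<Union>D)"
  have xs: "set xs = \<Union>D" "sorted_wrt (<) (map (position ?n) xs)"
    unfolding xs_def
    using sorted_key_list_of_set_inj_on[OF inj_on_subset[OF inj_on_position UDV] finD] by simp_all
  have "sorted_wrt (\<lambda>u v. g u < g v) xs"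
  proof (rule sorted_wrt_mono_rel)
    show "sorted_wrt (\<lambda>u v. position ?n u < position ?n v) xs" using xs(2) by (simp add: sorted_wrt_map)
    show "g u < g v" if "u \<in> set xs" "v \<in> set xs" "position ?n u < position ?n v" for u v
      using that clockwise_less_iff[OF g] xs(1) UDV by blast
  qed
  then have gxs: "sorted_wrt (<) (map g xs)" by (simp add: sorted_wrt_map)
  have "\<exists>ys. xs = ?v # ys @ [?w]"
  proof (rule sorted_list_ends[OF xs(2)])
    show "?v \<in> set xs" "?w \<in> set xs" unfolding xs(1) using mem vw ends by auto
    show "position ?n ?v \<le> position ?n x \<and> position ?n x \<le> position ?n ?w" if "x \<in> set xs" for x
      using that UDV position_bounds[of x ?n] unfolding xs(1) by auto
  qed simp
  then obtain ys where ys: "xs = ?v # ys @ [?w]" by blast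
  have dist: "distinct xs" using gxs by (metis distinct_map strict_sorted_iff)
  have set_ys: "set ys = \<Union>D - {?v, ?w}" using dist xs(1) ys by auto
  have g_ys: "g ` set ys = ?T - {g ?v, g ?w}"
  proof -
    have "g ` (\<Union>D - {?v, ?w}) = g ` \<Union>D - g ` {?v, ?w}"
      using UDV vw by (intro inj_on_image_set_diff[OF inj]) auto
    then show ?thesis unfolding set_ys gUD by simp
  qed
  have "length xs = card ?T"
    using distinct_card[OF dist] card_image[OF inj_on_subset[OF inj UDV]] xs(1) gUD by simp
  then have "even (length xs)" using planarD(5)[OF U(1)] by simp
  then have even_ys: "even (length ys)" unfolding ys by simp
  have "sorted_wrt (<) (map g ys)" using gxs ys by (simp add: sorted_wrt_append)
  then have "pair_up (map g ys) = consecutive_pairs (set (map g ys))"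
    using even_ys by (intro pair_up_sorted) auto
  then have new: "(`) g ` pair_up ys = consecutive_pairs (?T - {g ?v, g ?w})"
    unfolding pair_up_map using g_ys by simp
  have rho: "rho1 ?n d = ((`) drop_first ` ((L - D) \<union> pair_up ys), (`) drop_first ` pair_up ys)"
    unfolding rho1_def LD snd_conv fst_conv xs_def[symmetric] ys Let_def by simp
  have gLD: "(`) g ` (L - D) = U"
  proof -
    have "(`) g ` (L - D) = (`) g ` L - (`) g ` D"
      using sub by (intro inj_on_image_set_diff[OF inj_on_image_Pow[OF inj]]) auto
    moreover have "U \<inter> consecutive_pairs ?T = {}"
    proof -
      have "l \<noteq> {} \<and> l \<subseteq> \<Union>U" if "l \<in> U" for l using planarD(3)[OF U(1) that] that by auto
      then show ?thesis using UT by blast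
    qed
    ultimately show ?thesis unfolding gL gD by blast
  qed
  have lines: "l \<subseteq> vertices ?n - {?v, ?w}" if "l \<in> (L - D) \<union> pair_up ys" for l
  proof (cases "l \<in> pair_up ys")
    case True
    then have "l \<subseteq> set ys" using Union_pair_up[of ys] by (meson Union_upper subset_trans)
    then show ?thesis using set_ys UDV by blast
  next
    case False
    then have l: "l \<in> L - D" using that by blast
    then have "g ` l \<in> U" using gLD by blast
    then have "g ?v \<notin> g ` l" "g ?w \<notin> g ` l" using ends by blast+
    with l sub show ?thesis by auto
  qed
  have drop: "drop_first ` l \<subseteq> vertices n \<and> (g \<circ> raise) ` drop_first ` l = g ` l"
    if "l \<in> (L - D) \<union> pair_up ys" for l
  proof
    have l: "l \<subseteq> raise ` vertices n" using lines[OF that] raise_vertices by blast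
    then show "drop_first ` l \<subseteq> vertices n" by auto
    have "g (raise (drop_first x)) = g x" if "x \<in> l" for x
    proof -
      have "x \<in> vertices ?n - {?v, ?w}" using that lines[OF \<open>l \<in> (L - D) \<union> pair_up ys\<close>] by blast
      then show ?thesis by (simp only: raise_drop_first)
    qed
    then show "(g \<circ> raise) ` drop_first ` l = g ` l" unfolding image_image by simp
  qed
  show "on_vertices n (rho1 ?n d)" unfolding rho on_vertices_def using drop by auto
  have "(`) (g \<circ> raise) ` (`) drop_first ` Q = (`) g ` Q" if "Q \<subseteq> (L - D) \<union> pair_up ys" for Q
  proof -
    have "(`) (g \<circ> raise) ` (`) drop_first ` Q = (\<lambda>l. (g \<circ> raise) ` drop_first ` l) ` Q"
      by (rule image_image)
    also have "\<dots> = (`) g ` Q" using drop that by (intro image_cong[OF refl]) blast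
    finally show ?thesis .
  qed
  then have "map_diagram (g \<circ> raise) (rho1 ?n d) = ((`) g ` ((L - D) \<union> pair_up ys), (`) g ` pair_up ys)"
    unfolding map_diagram_def rho by simp
  also have "\<dots> = diagram (?V - {g ?v, g ?w}) U"
  proof -
    have "?V - {g ?v, g ?w} - \<Union>U = ?T - {g ?v, g ?w}" by blast
    then show ?thesis unfolding diagram_def image_Un gLD new by simp
  qed
  finally show "map_diagram (g \<circ> raise) (rho1 ?n d) = diagram (?V - {g ?v, g ?w}) U" .
qed

section \<open>Concatenation by successive contractions\<close>

lemma corner_diagram_planar:
  assumes g: "clockwise (Suc n) g" and d: "d \<in> corner_diagrams (Suc n)"
  shows "\<exists>U. planar (g ` vertices (Suc n)) U \<and> g (North 1) \<notin> \<Union>U \<and> g (South 1) \<notin> \<Union>U \<and>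
    map_diagram g d = diagram (g ` vertices (Suc n)) U \<and>
    map_diagram (g \<circ> raise) (rho1 (Suc n) d) = diagram (g ` vertices (Suc n) - {g (North 1), g (South 1)}) U \<and>
    on_vertices (Suc n) d \<and> on_vertices n (rho1 (Suc n) d)"
proof -
  let ?V = "g ` vertices (Suc n)"
  have d': "d \<in> blob_diagrams (Suc n)" using d by (auto simp: corner_diagrams_def)
  then obtain U where U: "planar ?V U" "map_diagram g d = diagram ?V U" "on_vertices (Suc n) d"
    using blob_diagrams_iff_planar[OF g] by blast
  have out: "g (North 1) \<notin> \<Union>U" "g (South 1) \<notin> \<Union>U"
    using corner_diagrams_iff_planar[OF g _ d' U(1,2)] d by auto
  from rho1_planar[OF g U(3,1,2) out] U out show ?thesis by blast
qed

lemma clockwise_raise_image: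
  assumes "clockwise (Suc n) g"
  shows "(g \<circ> raise) ` vertices n = g ` vertices (Suc n) - {g (North 1), g (South 1)}"
proof -
  have "(g \<circ> raise) ` vertices n = g ` (vertices (Suc n) - {North 1, South 1})"
    unfolding image_comp[symmetric] raise_vertices ..
  also have "\<dots> = g ` vertices (Suc n) - g ` {North 1, South 1}"
    by (rule inj_on_image_set_diff[OF clockwise_inj_on[OF assms]]) (auto simp: vertices_def)
  finally show ?thesis by simp
qed

text \<open>Both sides are parametrised by the same sets \<open>U\<close>: the planar ones on the
  larger point set that avoid its first and last point are the planar ones on the smaller point
  set.\<close>

lemma rho1_bij_betw:
  "bij_betw (rho1 (Suc n)) (corner_diagrams (Suc n)) (blob_diagrams n)"
proof -
  let ?n = "Suc n"
  let ?g = "position ?n"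
  let ?V = "?g ` vertices ?n" and ?v = "?g (North 1)" and ?w = "?g (South 1)"
  let ?W = "?V - {?v, ?w}" and ?h = "?g \<circ> raise"
  have g: "clockwise ?n ?g" by (simp add: clockwise_def)
  have h: "clockwise n ?h" by (rule clockwise_raise[OF g])
  note hW = clockwise_raise_image[OF g]
  have "North 1 \<in> vertices ?n" "South 1 \<in> vertices ?n" by (auto simp: vertices_def)
  then have vw: "?v \<in> ?V" "?w \<in> ?V" "?v \<noteq> ?w" by (auto simp del: position.simps) simp
  have ends: "?v \<le> x \<and> x \<le> ?w" if "x \<in> ?V" for x using position_bounds[of _ ?n] that by auto
  note * = corner_diagram_planar[OF g]
  show ?thesis
    unfolding bij_betw_def
  proof (intro conjI inj_onI subset_antisym subsetI)
    fix d d' assume d: "d \<in> corner_diagrams ?n" and d': "d' \<in> corner_diagrams ?n"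
      and eq: "rho1 ?n d = rho1 ?n d'"
    obtain U where U: "planar ?V U" "map_diagram ?g d = diagram ?V U" "map_diagram ?h (rho1 ?n d) = diagram ?W U"
        "on_vertices ?n d" "?v \<notin> \<Union>U" "?w \<notin> \<Union>U"
      using *[OF d] by blast
    obtain U' where U': "planar ?V U'" "map_diagram ?g d' = diagram ?V U'" "map_diagram ?h (rho1 ?n d') = diagram ?W U'"
        "on_vertices ?n d'" "?v \<notin> \<Union>U'" "?w \<notin> \<Union>U'"
      using *[OF d'] by blast
    \<comment> \<open>\<open>U\<close> can be read off from a diagram as its set of undecorated
      lines. Equal images thus have the same \<open>U\<close>, and \<open>U\<close> determines the
      original diagram.\<close>
    have undec: "fst (diagram A S) - snd (diagram A S) = S" if "planar A S" for A S
    proof -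
      have "l \<noteq> {} \<and> l \<subseteq> \<Union>S" if "l \<in> S" for l using planarD(3)[OF \<open>planar A S\<close> that] that by auto
      then have "S \<inter> consecutive_pairs (A - \<Union>S) = {}" using consecutive_pairs_Union_subset[of "A - \<Union>S"] by blast
      then show ?thesis unfolding diagram_def fst_conv snd_conv by blast
    qed
    have "planar ?W U" "planar ?W U'" using U U' vw by (auto intro!: planar_remove_ends)
    then have "U = U'" using U(3) U'(3) eq undec by metis
    then show "d = d'" using map_diagram_inj[OF inj_on_position U(4) U'(4)] U(2) U'(2) by simp
  next
    fix d' assume "d' \<in> rho1 ?n ` corner_diagrams ?n"
    then obtain d where d: "d \<in> corner_diagrams ?n" "d' = rho1 ?n d" by blast
    obtain U where U: "planar ?V U" "?v \<notin> \<Union>U" "?w \<notin> \<Union>U"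
      "map_diagram ?h (rho1 ?n d) = diagram ?W U" "on_vertices n (rho1 ?n d)" using *[OF d(1)] by blast
    have "planar ?W U" using U vw by (auto intro!: planar_remove_ends)
    with U show "d' \<in> blob_diagrams n" unfolding blob_diagrams_iff_planar[OF h] d(2) hW by blast
  next
    fix d' assume d': "d' \<in> blob_diagrams n"
    then obtain U where U: "planar ?W U" "map_diagram ?h d' = diagram ?W U" "on_vertices n d'"
      using blob_diagrams_iff_planar[OF h] unfolding hW by blast
    have out: "?v \<notin> \<Union>U" "?w \<notin> \<Union>U" using planarD(2)[OF U(1)] by auto
    note P = planarD[OF U(1)]
    \<comment> \<open>The two outermost points can be added as defects: no line encloses them, and
      two more defects keep the parity.\<close>
    have V: "?V - \<Union>U = insert ?v (insert ?w (?W - \<Union>U))" using vw out by auto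
    have "card (?V - \<Union>U) = Suc (Suc (card (?W - \<Union>U)))"
      unfolding V using P(1) vw(3) by (simp del: position.simps)
    moreover have "\<exists>y. {x, y} \<in> U \<and> between c d y" if "{c, d} \<in> U" "x \<in> ?V" "between c d x" for c d x
    proof -
      have "c \<in> ?V" "d \<in> ?V" using that(1) P(2) by blast+
      then have "x \<noteq> ?v" "x \<noteq> ?w" using ends[of c] ends[of d] that(3) unfolding between_def by linarith+
      then show ?thesis using P(6)[OF that(1) _ that(3)] that(2) by blast
    qed
    ultimately have pV: "planar ?V U"
      using P(1-5) unfolding planar_def by auto
    define d where "d = map_diagram (inv_into (vertices ?n) ?g) (diagram ?V U)"
    have sub: "l \<subseteq> ?V" if "l \<in> U \<union> consecutive_pairs (?V - \<Union>U)" for l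
      using that P(2) consecutive_pairs_Union_subset by blast
    have inv: "?g ` inv_into (vertices ?n) ?g ` l = l" if "l \<subseteq> ?V" for l
      using that by (rule image_inv_into_cancel[OF refl])
    have "(`) ?g ` (`) (inv_into (vertices ?n) ?g) ` Q = Q" if "Q \<subseteq> U \<union> consecutive_pairs (?V - \<Union>U)" for Q
    proof -
      have "(`) ?g ` (`) (inv_into (vertices ?n) ?g) ` Q = (\<lambda>l. ?g ` inv_into (vertices ?n) ?g ` l) ` Q"
        by (rule image_image)
      also have "\<dots> = (\<lambda>l. l) ` Q"
      proof (rule image_cong[OF refl])
        fix l assume "l \<in> Q"
        then have "l \<subseteq> ?V" using sub that by blast
        then show "?g ` inv_into (vertices ?n) ?g ` l = l" by (rule inv)
      qed
      finally show ?thesis by simp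
    qed
    then have gd: "map_diagram ?g d = diagram ?V U"
      unfolding d_def map_diagram_def diagram_def fst_conv snd_conv by (metis Un_upper2 order_refl)
    have "inv_into (vertices ?n) ?g ` l \<subseteq> vertices ?n" if "l \<subseteq> ?V" for l
      using that inv_into_into[of _ ?g "vertices ?n"] by blast
    then have on: "on_vertices ?n d" unfolding d_def map_diagram_def diagram_def on_vertices_def using sub by auto
    have db: "d \<in> blob_diagrams ?n" using blob_diagrams_iff_planar[OF g] on pV gd by blast
    then have "d \<in> corner_diagrams ?n" using corner_diagrams_iff_planar[OF g _ db pV gd] out by simp
    moreover have "rho1 ?n d = d'"
      using rho1_planar[OF g on pV gd out] U(2,3) map_diagram_inj[OF clockwise_inj_on[OF h]] by metis
    ultimately show "d' \<in> rho1 ?n ` corner_diagrams ?n" by blast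
  qed
qed

section \<open>The stack of two diagrams and its exponents\<close>

definition stack_outcome ::
    "nat \<Rightarrow> blob_diagram \<Rightarrow> blob_diagram \<Rightarrow> blob_diagram \<times> nat \<times> nat \<times> nat" where
  "stack_outcome n d1 d2 = outcome (stack_components n d1 d2) outer_ends (blobs_on d1 d2)"

lemma concat_diagram_stack_outcome: "concat_diagram n d1 d2 = fst (stack_outcome n d1 d2)"
  by (simp add: concat_diagram_def stack_outcome_def outcome_def)

lemma outcome_image:
  "outcome Cs (\<lambda>C. g ` ends C) k = apfst (map_diagram g) (outcome Cs ends k)"
proof -
  have *: "{g ` ends C |C. P C} = (`) g ` {ends C |C. P C}" for P by blast
  show ?thesis unfolding outcome_def map_diagram_def by (simp add: *)
qed

definition stack_edges :: "blob_diagram \<Rightarrow> blob_diagram \<Rightarrow> (nat \<times> nat) set set" where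
  "stack_edges d1 d2 = (`) (place 0) ` fst d1 \<union> (`) (place 1) ` fst d2"

lemma stack_components_alt:
  "stack_components n d1 d2 = components ({0, 1, 2} \<times> {1..n}) (stack_edges d1 d2)"
proof -
  have "stack_joined d1 d2 = joined (stack_edges d1 d2)"
  proof (intro subset_antisym subrelI)
    have "(x, y) \<in> stack_joined d1 d2 \<longleftrightarrow> (x, y) \<in> joined (stack_edges d1 d2)" for x y
      unfolding stack_joined_def joined_def stack_edges_def mem_Collect_eq prod.case bex_Un
      by (simp only: bex_simps(7))
    note iff = this
    show "(x, y) \<in> joined (stack_edges d1 d2)" if "(x, y) \<in> stack_joined d1 d2" for x y
      using that iff by (rule iffD1[rotated])
    show "(x, y) \<in> stack_joined d1 d2" if "(x, y) \<in> joined (stack_edges d1 d2)" for x y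
      using that iff by (rule iffD2[rotated])
  qed
  then show ?thesis by (simp add: stack_components_def components_def)
qed

lemma place_in_stack: "v \<in> vertices n \<Longrightarrow> k \<in> {0, 1} \<Longrightarrow> place k v \<in> {0, 1, 2} \<times> {1..n}"
  by (auto simp: vertices_def)

lemma stack_edges_subset:
  assumes "on_vertices n d1" "on_vertices n d2"
  shows "\<Union>(stack_edges d1 d2) \<subseteq> {0, 1, 2} \<times> {1..n}"
proof
  fix x assume "x \<in> \<Union>(stack_edges d1 d2)"
  then consider l v where "l \<in> fst d1" "v \<in> l" "x = place 0 v" | l v where "l \<in> fst d2" "v \<in> l" "x = place 1 v"
    by (auto simp: stack_edges_def)
  then show "x \<in> {0, 1, 2} \<times> {1..n}"
  proof cases
    case (1 l v)
    then have "v \<in> vertices n" using assms(1) unfolding on_vertices_def by blast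
    then show ?thesis unfolding 1(3) by (rule place_in_stack) simp
  next
    case (2 l v)
    then have "v \<in> vertices n" using assms(2) unfolding on_vertices_def by blast
    then show ?thesis unfolding 2(3) by (rule place_in_stack) simp
  qed
qed

lemma finite_stack_components:
  assumes "on_vertices n d1" "on_vertices n d2"
  shows "finite (stack_components n d1 d2)"
  unfolding stack_components_alt
  using components_partition_on[OF stack_edges_subset[OF assms]] by (rule finite_elements[rotated]) simp

text \<open>Closed or not, a component with \<open>k\<close> blobs contributes \<beta> to the
  truncated power \<open>k - 1\<close>, so one sum over all components gives the exponent of
  \<beta>. The closed components without and with blobs give those of \<alpha> and \<gamma>.\<close>

lemma (in cring) concat_factor_stack_outcome:
  assumes "on_vertices n d1" "on_vertices n d2" "stack_outcome n d1 d2 = (d, i, j, k)"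
    and "\<alpha> \<in> carrier R" "\<beta> \<in> carrier R" "\<gamma> \<in> carrier R"
  shows "concat_factor R n \<alpha> \<beta> \<gamma> d1 d2 = \<alpha> [^] i \<otimes> \<beta> [^] j \<otimes> \<gamma> [^] k"
proof -
  let ?b = "blobs_on d1 d2"
  have *: "finprod R (component_factor R \<alpha> \<beta> \<gamma> d1 d2) Cs =
      \<alpha> [^] card {C \<in> Cs. outer_ends C = {} \<and> ?b C = 0} \<otimes> \<beta> [^] (\<Sum>C\<in>Cs. ?b C - 1)
      \<otimes> \<gamma> [^] card {C \<in> Cs. outer_ends C = {} \<and> ?b C > 0}"
    if "finite Cs" for Cs
    using that
  proof (induction Cs rule: finite_induct)
    case (insert C Cs)
    let ?x = "{C \<in> Cs. outer_ends C = {} \<and> ?b C = 0}" and ?z = "{C \<in> Cs. outer_ends C = {} \<and> ?b C > 0}"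
      and ?y = "\<Sum>C\<in>Cs. ?b C - 1"
    have fin: "finite ?x" "finite ?z" "C \<notin> ?x" "C \<notin> ?z" using insert by auto
    have x: "{C' \<in> insert C Cs. outer_ends C' = {} \<and> ?b C' = 0} =
        (if outer_ends C = {} \<and> ?b C = 0 then insert C ?x else ?x)"
      and z: "{C' \<in> insert C Cs. outer_ends C' = {} \<and> ?b C' > 0} =
        (if outer_ends C = {} \<and> ?b C > 0 then insert C ?z else ?z)" by auto
    have y: "(\<Sum>C\<in>insert C Cs. ?b C - 1) = (?b C - 1) + ?y" using insert by simp
    have closed: "component_factor R \<alpha> \<beta> \<gamma> d1 d2 \<in> A \<rightarrow> carrier R" for A
      using assms(4-6) by (auto simp: component_factor_def Let_def)
    then have "finprod R (component_factor R \<alpha> \<beta> \<gamma> d1 d2) (insert C Cs) =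
        component_factor R \<alpha> \<beta> \<gamma> d1 d2 C \<otimes> (\<alpha> [^] card ?x \<otimes> \<beta> [^] ?y \<otimes> \<gamma> [^] card ?z)"
      using insert by (subst finprod_insert) (auto simp: insert.IH)
    moreover have c: "\<alpha> [^] card ?x \<in> carrier R" "\<beta> [^] ?y \<in> carrier R" "\<gamma> [^] card ?z \<in> carrier R"
      "\<beta> [^] (?b C - 1) \<in> carrier R" using assms(4-6) by auto
    moreover have "\<beta> [^] (?b C - 1 + ?y) = \<beta> [^] (?b C - 1) \<otimes> \<beta> [^] ?y"
      using assms(5) by (simp add: nat_pow_mult)
    ultimately show ?case
      unfolding x y z component_factor_def Let_def
      using fin assms(4-6) by (auto simp: m_ac)
  qed (use assms(4-6) in simp)
  have "i = card {C \<in> stack_components n d1 d2. outer_ends C = {} \<and> ?b C = 0}"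
    "j = (\<Sum>C\<in>stack_components n d1 d2. ?b C - 1)"
    "k = card {C \<in> stack_components n d1 d2. outer_ends C = {} \<and> ?b C > 0}"
    using assms(3) by (auto simp: stack_outcome_def outcome_def)
  then show ?thesis
    unfolding concat_factor_def using *[OF finite_stack_components[OF assms(1,2)]] by simp
qed

lemma on_vertices_concat_diagram:
  assumes "on_vertices n d1" "on_vertices n d2"
  shows "on_vertices n (concat_diagram n d1 d2)"
proof -
  have "outer_ends C \<subseteq> vertices n" if "C \<in> stack_components n d1 d2" for C
  proof -
    have "C \<subseteq> {0, 1, 2} \<times> {1..n}"
      using components_partition_on[OF stack_edges_subset[OF assms]] that
      unfolding stack_components_alt partition_on_def by blast
    then show ?thesis unfolding outer_ends_def vertices_def by auto
  qed
  then show ?thesis unfolding concat_diagram_def on_vertices_def by auto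
qed

text \<open>
  The two factors are drawn next to each other along a line, the southern edge of the first one
  being glued to the northern edge of the second one.
\<close>

definition gluing :: "nat \<Rightarrow> (vertex \<Rightarrow> nat) \<Rightarrow> (vertex \<Rightarrow> nat) \<Rightarrow> nat set set" where
  "gluing n a b = {{a (South i), b (North i)} | i. i \<in> {1..n}}"

text \<open>Collapsing each glued pair to a point of level 1 turns the juxtaposed diagrams into the
  stack. The free ends are northern vertices of the first factor and southern vertices of the second
  one, whence the mixed numbering of the result.\<close>

lemma glue_juxtaposition:
  fixes a b :: "vertex \<Rightarrow> nat"
  assumes a: "inj_on a (vertices n)" and b: "inj_on b (vertices n)"
    and ab: "a ` vertices n \<inter> b ` vertices n = {}"
    and d: "on_vertices n d1" "on_vertices n d2" and ne: "{} \<notin> snd d1" "{} \<notin> snd d2"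
  shows "glue (a ` vertices n \<union> b ` vertices n)
      (fst (map_diagram a d1) \<union> fst (map_diagram b d2), snd (map_diagram a d1) \<union> snd (map_diagram b d2))
      (gluing n a b) =
    apfst (map_diagram (\<lambda>v. case v of North i \<Rightarrow> a v | South i \<Rightarrow> b v)) (stack_outcome n d1 d2)"
proof -
  let ?N = "vertices n" and ?S = "{0, 1, 2} \<times> {1..n} :: (nat \<times> nat) set"
  let ?V = "a ` ?N \<union> b ` ?N" and ?M = "gluing n a b"
  let ?L = "fst (map_diagram a d1) \<union> fst (map_diagram b d2)"
    and ?D = "snd (map_diagram a d1) \<union> snd (map_diagram b d2)"
  let ?g = "\<lambda>v. case v of North i \<Rightarrow> a v | South i \<Rightarrow> b v"
  define f where "f x = (if x \<in> a ` ?N then place 0 (inv_into ?N a x) else place 1 (inv_into ?N b x))" for x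
  have fa: "f (a v) = place 0 v" if "v \<in> ?N" for v using that a by (simp add: f_def)
  have fb: "f (b v) = place 1 v" if "v \<in> ?N" for v
  proof -
    have "b v \<notin> a ` ?N" using that ab by blast
    then show ?thesis using that b by (simp add: f_def)
  qed
  have sub: "fst d1 \<subseteq> Pow ?N" "fst d2 \<subseteq> Pow ?N" "snd d1 \<subseteq> Pow ?N" "snd d2 \<subseteq> Pow ?N"
    using d by (auto simp: on_vertices_def)
  have iN: "North i \<in> ?N" "South i \<in> ?N" if "i \<in> {1..n}" for i using that by (auto simp: vertices_def)
  have edge_cases: "(\<exists>l\<in>fst d1. e = a ` l) \<or> (\<exists>l\<in>fst d2. e = b ` l) \<or>
      (\<exists>i\<in>{1..n}. e = {a (South i), b (North i)})" if "e \<in> ?L \<union> ?M" for e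
    using that by (auto simp: map_diagram_def gluing_def)
  have inE: "a ` l \<in> ?L \<union> ?M" if "l \<in> fst d1" for l using that by (auto simp: map_diagram_def)
  have inE2: "b ` l \<in> ?L \<union> ?M" if "l \<in> fst d2" for l using that by (auto simp: map_diagram_def)
  have inM: "{a (South i), b (North i)} \<in> ?L \<union> ?M" if "i \<in> {1..n}" for i using that by (auto simp: gluing_def)
  let ?E' = "stack_edges d1 d2"
  have E': "\<Union>?E' \<subseteq> ?S" by (rule stack_edges_subset[OF d])
  have bij: "bij_betw (\<lambda>C. ?V \<inter> f -` C) (components ?S ?E') (components ?V (?L \<union> ?M))"
  proof (rule components_pullback)
    have "f ` ?V = place 0 ` ?N \<union> place 1 ` ?N"
      unfolding image_Un image_image using fa fb by (intro arg_cong2[where f = "(\<union>)"] image_cong) auto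
    also have "\<dots> = ?S"
    proof (intro subset_antisym subsetI)
      fix x assume "x \<in> ?S"
      then obtain i where i: "i \<in> {1..n}" "x = (0, i) \<or> x = (1, i) \<or> x = (2, i)" by auto
      then have "x = place 0 (North i) \<or> x = place 1 (North i) \<or> x = place 1 (South i)" by auto
      then show "x \<in> place 0 ` ?N \<union> place 1 ` ?N" using iN[OF i(1)] by blast
    qed (auto simp: vertices_def)
    finally show "f ` ?V = ?S" .
    show "\<Union>?E' \<subseteq> ?S" by (rule E')
    show "\<Union>(?L \<union> ?M) \<subseteq> ?V"
    proof
      fix x assume "x \<in> \<Union>(?L \<union> ?M)"
      then obtain e where "e \<in> ?L \<union> ?M" "x \<in> e" by blast
      with edge_cases[of e] sub iN show "x \<in> ?V" by blast
    qed
  next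
    fix e x y assume e: "e \<in> ?L \<union> ?M" "x \<in> e" "y \<in> e"
    from edge_cases[OF e(1)] show "(f x, f y) \<in> (joined ?E')\<^sup>*"
    proof (elim disjE bexE)
      fix l assume l: "l \<in> fst d1" "e = a ` l"
      then have "f x \<in> place 0 ` l" "f y \<in> place 0 ` l" using e(2,3) fa sub(1) by force+
      moreover have "place 0 ` l \<in> ?E'" using l(1) by (auto simp: stack_edges_def)
      ultimately show ?thesis by (intro joined_edge)
    next
      fix l assume l: "l \<in> fst d2" "e = b ` l"
      then have "f x \<in> place 1 ` l" "f y \<in> place 1 ` l" using e(2,3) fb sub(2) by force+
      moreover have "place 1 ` l \<in> ?E'" using l(1) by (auto simp: stack_edges_def)
      ultimately show ?thesis by (intro joined_edge)
    next
      fix i assume i: "i \<in> {1..n}" "e = {a (South i), b (North i)}"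
      then have "f x = (1, i)" "f y = (1, i)" using e(2,3) fa[of "South i"] fb[of "North i"] iN[OF i(1)] by auto
      then show ?thesis by simp
    qed
  next
    fix e x' y' assume e: "e \<in> ?E'" "x' \<in> e" "y' \<in> e"
    then consider l where "l \<in> fst d1" "e = place 0 ` l" | l where "l \<in> fst d2" "e = place 1 ` l"
      by (auto simp: stack_edges_def)
    then show "\<exists>x\<in>?V. \<exists>y\<in>?V. f x = x' \<and> f y = y' \<and> (x, y) \<in> (joined (?L \<union> ?M))\<^sup>*"
    proof cases
      case (1 l)
      then obtain u v where uv: "u \<in> l" "v \<in> l" "x' = place 0 u" "y' = place 0 v" using e by blast
      then have "u \<in> ?N" "v \<in> ?N" using sub 1 by auto
      moreover have "(a u, a v) \<in> (joined (?L \<union> ?M))\<^sup>*"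
        using joined_edge[OF inE[OF 1(1)]] uv by blast
      ultimately show ?thesis using fa uv by (intro bexI[of _ "a u"] bexI[of _ "a v"]) auto
    next
      case (2 l)
      then obtain u v where uv: "u \<in> l" "v \<in> l" "x' = place 1 u" "y' = place 1 v" using e by blast
      then have "u \<in> ?N" "v \<in> ?N" using sub 2 by auto
      moreover have "(b u, b v) \<in> (joined (?L \<union> ?M))\<^sup>*"
        using joined_edge[OF inE2[OF 2(1)]] uv by blast
      ultimately show ?thesis using fb uv by (intro bexI[of _ "b u"] bexI[of _ "b v"]) auto
    qed
  next
    have inj_place: "u = v" if "place k u = place k v" for k u v using that by (cases u; cases v) auto
    have cross: "(a u, b v) \<in> (joined (?L \<union> ?M))\<^sup>*" if uv: "u \<in> ?N" "v \<in> ?N" "place 0 u = place 1 v" for u v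
    proof -
      obtain i where i: "u = South i" "v = North i" using uv(3) by (cases u; cases v) auto
      then have "i \<in> {1..n}" using uv(1) by (auto simp: vertices_def)
      then show ?thesis using joined_edge[OF inM] i by blast
    qed
    fix x y assume "x \<in> ?V" "y \<in> ?V" and eq: "f x = f y"
    then consider u v where "u \<in> ?N" "v \<in> ?N" "x = a u" "y = a v"
      | u v where "u \<in> ?N" "v \<in> ?N" "x = b u" "y = b v"
      | u v where "u \<in> ?N" "v \<in> ?N" "x = a u" "y = b v"
      | u v where "u \<in> ?N" "v \<in> ?N" "x = b u" "y = a v" by blast
    then show "(x, y) \<in> (joined (?L \<union> ?M))\<^sup>*"
    proof cases
      case (1 u v)
      then show ?thesis using eq fa inj_place by force
    next
      case (2 u v)
      then show ?thesis using eq fb inj_place by force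
    next
      case (3 u v)
      then show ?thesis using eq fa fb cross by metis
    next
      case (4 u v)
      then show ?thesis using eq fa fb cross joined_rtrancl_sym by metis
    qed
  qed
  have "glue ?V (?L, ?D) ?M = outcome (components ?S ?E') (\<lambda>C. ?g ` outer_ends C) (blobs_on d1 d2)"
    unfolding glue_def fst_conv snd_conv
  proof (rule outcome_reindex[OF bij])
    fix C assume "C \<in> components ?S ?E'"
    then have C: "C \<subseteq> ?S" using components_partition_on[OF E'] unfolding partition_on_def by blast
    have UM: "\<Union>?M = (a \<circ> South) ` {1..n} \<union> (b \<circ> North) ` {1..n}"
      unfolding gluing_def Collect_image_eq by force
    show "?V \<inter> f -` C - \<Union>?M = ?g ` outer_ends C"
    proof (intro subset_antisym subsetI)
      fix x assume x: "x \<in> ?V \<inter> f -` C - \<Union>?M"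
      then consider v where "v \<in> ?N" "x = a v" | v where "v \<in> ?N" "x = b v" by blast
      then show "x \<in> ?g ` outer_ends C"
      proof cases
        case (1 v)
        then obtain i where i: "v = North i" using x unfolding UM by (auto simp: vertices_def)
        then have "(0, i) \<in> C" using x fa 1 by auto
        then have "North i \<in> outer_ends C" by (auto simp: outer_ends_def)
        then have "?g (North i) \<in> ?g ` outer_ends C" by (rule imageI)
        then show ?thesis using i 1 by simp
      next
        case (2 v)
        then obtain i where i: "v = South i" using x unfolding UM by (auto simp: vertices_def)
        then have "(2, i) \<in> C" using x fb 2 by (auto simp: numeral_2_eq_2)
        then have "South i \<in> outer_ends C" by (auto simp: outer_ends_def)
        then have "?g (South i) \<in> ?g ` outer_ends C" by (rule imageI)
        then show ?thesis using i 2 by simp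
      qed
    next
      fix x assume "x \<in> ?g ` outer_ends C"
      then consider i where "x = a (North i)" "(0, i) \<in> C" | i where "x = b (South i)" "(2, i) \<in> C"
        by (auto simp: outer_ends_def)
      then show "x \<in> ?V \<inter> f -` C - \<Union>?M"
      proof cases
        case (1 i)
        then have i: "North i \<in> ?N" using C iN by auto
        have "x \<notin> \<Union>?M"
        proof
          assume "x \<in> \<Union>?M"
          then obtain j where "j \<in> {1..n}" "x = a (South j) \<or> x = b (North j)" unfolding UM by auto
          then show False using 1(1) i iN[of j] ab a by (auto dest: inj_onD)
        qed
        then show ?thesis using 1 i fa[OF i] by auto
      next
        case (2 i)
        then have i: "South i \<in> ?N" using C iN by auto
        have "x \<notin> \<Union>?M"
        proof
          assume "x \<in> \<Union>?M"
          then obtain j where "j \<in> {1..n}" "x = a (South j) \<or> x = b (North j)" unfolding UM by auto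
          then show False using 2(1) i iN[of j] ab b by (auto dest: inj_onD)
        qed
        then show ?thesis using 2 i fb[OF i] by (auto simp: numeral_2_eq_2)
      qed
    qed
    have la: "a ` l \<subseteq> ?V \<inter> f -` C \<longleftrightarrow> place 0 ` l \<subseteq> C" if "l \<in> snd d1" for l
    proof -
      have "l \<subseteq> ?N" using sub(3) that by auto
      then have "\<forall>v\<in>l. f (a v) = place 0 v \<and> a v \<in> ?V" using fa by blast
      then show ?thesis unfolding image_subset_iff by simp
    qed
    have lb: "b ` l \<subseteq> ?V \<inter> f -` C \<longleftrightarrow> place 1 ` l \<subseteq> C" if "l \<in> snd d2" for l
    proof -
      have "l \<subseteq> ?N" using sub(4) that by auto
      then have "\<forall>v\<in>l. f (b v) = place 1 v \<and> b v \<in> ?V" using fb by blast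
      then show ?thesis unfolding image_subset_iff by simp
    qed
    let ?A = "{l \<in> snd d1. place 0 ` l \<subseteq> C}" and ?B = "{l \<in> snd d2. place 1 ` l \<subseteq> C}"
    have eq: "{l \<in> ?D. l \<subseteq> ?V \<inter> f -` C} = (`) a ` ?A \<union> (`) b ` ?B"
    proof -
      have "{l \<in> ?D. l \<subseteq> S} = (`) a ` {l \<in> snd d1. a ` l \<subseteq> S} \<union> (`) b ` {l \<in> snd d2. b ` l \<subseteq> S}" for S
        unfolding map_diagram_def snd_conv by blast
      moreover have "{l \<in> snd d1. a ` l \<subseteq> ?V \<inter> f -` C} = ?A" "{l \<in> snd d2. b ` l \<subseteq> ?V \<inter> f -` C} = ?B"
        using la lb by (intro Collect_cong conj_cong refl; simp)+
      ultimately show ?thesis by (simp only:)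
    qed
    have "finite (Pow ?N)" using finite_vertices by simp
    then have fin: "finite ?A" "finite ?B" using sub(3,4) by (auto intro: finite_subset)
    \<comment> \<open>The factors occupy disjoint sets of numbers, so a common line could only be
      empty. Hence the two separate counts in \<open>blobs_on\<close> add up to the count in the
      juxtaposition.\<close>
    have disj: "(`) a ` ?A \<inter> (`) b ` ?B = {}"
    proof (rule ccontr)
      assume "(`) a ` ?A \<inter> (`) b ` ?B \<noteq> {}"
      then obtain l m where lm: "l \<in> ?A" "m \<in> ?B" "a ` l = b ` m" by blast
      have "l \<noteq> {}" "l \<subseteq> ?N" "m \<subseteq> ?N" using lm ne sub by auto
      then show False using lm(3) ab by blast
    qed
    have cards: "card ((`) a ` ?A) = card ?A" "card ((`) b ` ?B) = card ?B"
      using sub(3,4) by (auto intro!: card_image inj_on_subset[OF inj_on_image_Pow[OF a]] inj_on_subset[OF inj_on_image_Pow[OF b]])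
    show "blobs ?D (?V \<inter> f -` C) = blobs_on d1 d2 C"
      unfolding blobs_def blobs_on_def eq using fin disj cards by (simp add: card_Un_disjoint)
  qed
  also have "\<dots> = apfst (map_diagram ?g) (stack_outcome n d1 d2)"
    unfolding stack_outcome_def stack_components_alt by (rule outcome_image)
  finally show ?thesis .
qed

lemma blob_diagrams_nonempty_lines: "d \<in> blob_diagrams n \<Longrightarrow> {} \<notin> snd d"
  unfolding blob_diagrams_def TL_diagrams_def partition_on_def by auto

lemma corner_diagrams_subset: "corner_diagrams n \<subseteq> blob_diagrams n"
  by (auto simp: corner_diagrams_def)

section \<open>Two diagrams side by side on a line\<close>

text \<open>No line of one diagram encloses a point of the other, and the even number of defects on
  the left leaves the pairing on the right unaffected.\<close>

lemma planar_Un: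
  assumes 1: "planar V U" and 2: "planar W S" and less: "\<And>x y. x \<in> V \<Longrightarrow> y \<in> W \<Longrightarrow> x < y"
  shows "planar (V \<union> W) (U \<union> S)"
    "diagram (V \<union> W) (U \<union> S) =
      (fst (diagram V U) \<union> fst (diagram W S), snd (diagram V U) \<union> snd (diagram W S))"
proof -
  note P = planarD[OF 1] and Q = planarD[OF 2]
  have VW: "V \<inter> W = {}" using less by blast
  have T: "V \<union> W - \<Union>(U \<union> S) = (V - \<Union>U) \<union> (W - \<Union>S)" using VW P(2) Q(2) by blast
  have "card ((V - \<Union>U) \<union> (W - \<Union>S)) = card (V - \<Union>U) + card (W - \<Union>S)"
    using P(1) Q(1) VW by (intro card_Un_disjoint) auto
  then have ev: "even (card (V \<union> W - \<Union>(U \<union> S)))" unfolding T using P(5) Q(5) by simp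
  have dis: "disjoint (U \<union> S)"
    using P(2,4) Q(2,4) VW by (intro disjoint_union) auto
  have nest: "\<exists>y. {x, y} \<in> U \<union> S \<and> between c d y"
    if "{c, d} \<in> U \<union> S" "x \<in> V \<union> W" "between c d x" for c d x
  proof (cases "{c, d} \<in> U")
    case True
    then have "c \<in> V" "d \<in> V" using P(2) by blast+
    then have "x \<notin> W" using less[of c x] less[of d x] that(3) unfolding between_def by auto
    then show ?thesis using P(6)[OF True _ that(3)] that(2) by blast
  next
    case False
    then have cd: "{c, d} \<in> S" using that(1) by blast
    then have "c \<in> W" "d \<in> W" using Q(2) by blast+
    then have "x \<notin> V" using less[of x c] less[of x d] that(3) unfolding between_def by auto
    then show ?thesis using Q(6)[OF cd _ that(3)] that(2) by blast
  qed
  show "planar (V \<union> W) (U \<union> S)"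
    unfolding planar_def using P(1-3) Q(1-3) ev dis nest by blast
  have "consecutive_pairs ((V - \<Union>U) \<union> (W - \<Union>S)) =
      consecutive_pairs (V - \<Union>U) \<union> consecutive_pairs (W - \<Union>S)"
    using P Q less by (intro consecutive_pairs_Un) auto
  then show "diagram (V \<union> W) (U \<union> S) =
      (fst (diagram V U) \<union> fst (diagram W S), snd (diagram V U) \<union> snd (diagram W S))"
    unfolding diagram_def T by auto
qed

text \<open>The upper factor occupies 1 to \<open>2 * n\<close>, the lower one
  \<open>2 * n + 1\<close> to \<open>4 * n\<close>. The vertex \<open>South (k + 1)\<close> of the
  former has number \<open>2 * n - k\<close>, the vertex \<open>North (k + 1)\<close> of the latter
  \<open>2 * n + 1 + k\<close>. These are the points left after the first \<open>k\<close> pairs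
  have been contracted.\<close>

definition stack_points :: "nat \<Rightarrow> nat \<Rightarrow> nat set" where
  "stack_points n k = {1..2 * n - k} \<union> {2 * n + 1 + k..4 * n}"

definition stack_gluing :: "nat \<Rightarrow> nat \<Rightarrow> nat set set" where
  "stack_gluing n k = {{2 * n - i, 2 * n + 1 + i} | i. i \<in> {k..<n}}"

lemma stack_points_Suc:
  "k < n \<Longrightarrow> stack_points n k - {2 * n - k, 2 * n + 1 + k} = stack_points n (Suc k)"
  by (auto simp: stack_points_def)

lemma stack_gluing_Suc:
  assumes "k < n"
  shows "stack_gluing n k - {{2 * n - k, 2 * n + 1 + k}} = stack_gluing n (Suc k)"
proof -
  have inj: "{2 * n - i, 2 * n + 1 + i} = {2 * n - k, 2 * n + 1 + k} \<longleftrightarrow> i = k" for i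
    by (auto simp: doubleton_eq_iff)
  have "i \<in> {k..<n} \<and> i \<noteq> k \<longleftrightarrow> i \<in> {Suc k..<n}" for i by auto
  then show ?thesis unfolding stack_gluing_def using inj by blast
qed

text \<open>After \<open>k\<close> contractions \<open>2 * n - k\<close> and
  \<open>2 * n + 1 + k\<close> face each other across the gap. The induction descends from
  \<open>k = n\<close>, where no pair is left.\<close>

lemma nested_stack: "k \<le> n \<Longrightarrow> nested (stack_points n k) (stack_gluing n k)"
proof (induction k rule: inc_induct)
  case base
  then show ?case by (simp add: stack_gluing_def nested_empty)
next
  case (step k)
  show ?case
  proof (rule nested_step)
    show "nested (stack_points n k - {2 * n - k, 2 * n + 1 + k}) (stack_gluing n k - {{2 * n - k, 2 * n + 1 + k}})"
      using step by (simp only: stack_points_Suc stack_gluing_Suc)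
    show "{2 * n - k, 2 * n + 1 + k} \<in> stack_gluing n k" using step unfolding stack_gluing_def by auto
  qed (use step in \<open>auto simp: stack_points_def\<close>)
qed

lemma Union_stack_gluing: "\<Union>(stack_gluing n k) = {n + 1..2 * n - k} \<union> {2 * n + 1 + k..3 * n}"
proof -
  have "x \<in> \<Union>(stack_gluing n k)" if "x \<in> {n + 1..2 * n - k}" for x
  proof -
    have "2 * n - x \<in> {k..<n}" "x = 2 * n - (2 * n - x)" using that by auto
    then show ?thesis unfolding stack_gluing_def by blast
  qed
  moreover have "x \<in> \<Union>(stack_gluing n k)" if "x \<in> {2 * n + 1 + k..3 * n}" for x
  proof -
    have "x - (2 * n + 1) \<in> {k..<n}" "x = 2 * n + 1 + (x - (2 * n + 1))" using that by auto
    then show ?thesis unfolding stack_gluing_def by blast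
  qed
  moreover have "x \<in> {n + 1..2 * n - k} \<union> {2 * n + 1 + k..3 * n}" if "x \<in> \<Union>(stack_gluing n k)" for x
    using that by (auto simp: stack_gluing_def)
  ultimately show ?thesis by blast
qed

lemma South_in_vertices: "South i \<in> vertices n \<longleftrightarrow> i \<in> {1..n}"
  by (auto simp: vertices_def)

lemma position_image: "position n ` vertices n = {1..2 * n}"
proof (intro subset_antisym subsetI)
  fix x assume x: "x \<in> {1..2 * n}"
  show "x \<in> position n ` vertices n"
  proof (cases "x \<le> n")
    case True
    then have "North x \<in> vertices n" "position n (North x) = x" using x by (auto simp: vertices_def)
    then show ?thesis by (metis imageI)
  next
    case False
    then have "South (2 * n + 1 - x) \<in> vertices n" "position n (South (2 * n + 1 - x)) = x"
      using x by (auto simp: South_in_vertices)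
    then show ?thesis by (metis imageI)
  qed
qed (use position_bounds in fastforce)

lemma shifted_position_image: "(\<lambda>v. 2 * n + position n v) ` vertices n = {2 * n + 1..4 * n}"
proof -
  have "(\<lambda>v. 2 * n + position n v) ` vertices n = (+) (2 * n) ` {1..2 * n}"
    unfolding position_image[symmetric] image_image ..
  also have "\<dots> = {2 * n + 1..4 * n}" by (subst image_add_atLeastAtMost) simp
  finally show ?thesis .
qed

lemma contract_defects: "p \<notin> \<Union>U \<Longrightarrow> q \<notin> \<Union>U \<Longrightarrow> contract p q U = U"
  unfolding contract_def by blast

text \<open>After the contraction of \<open>2 * ?n\<close> and \<open>2 * ?n + 1\<close>, the
  remaining points are those of the stack of the two images together with the outer ends 1 and
  \<open>4 * ?n\<close>. From here \<open>planar_glue_nested\<close> treats both stacks at once, and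
  the set \<open>U'\<close> that it returns consists of the undecorated lines of both products. This
  makes one product the image of the other under \<open>rho1\<close>.\<close>

lemma stack_outcome_rho1:
  assumes d1: "d1 \<in> corner_diagrams (Suc m)" and d2: "d2 \<in> corner_diagrams (Suc m)"
  shows "\<exists>d i j k. d \<in> corner_diagrams (Suc m) \<and> stack_outcome (Suc m) d1 d2 = (d, i, Suc j, k) \<and>
    stack_outcome m (rho1 (Suc m) d1) (rho1 (Suc m) d2) = (rho1 (Suc m) d, i, k, j)"
proof -
  let ?n = "Suc m"
  let ?N = "vertices ?n"
  define a where "a = position ?n"
  define b where "b v = 2 * ?n + position ?n v" for v
  define g where "g v = (case v of North i \<Rightarrow> a v | South i \<Rightarrow> b v)" for v
  let ?A = "a ` ?N" and ?B = "b ` ?N"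
  have ca: "clockwise ?n a" and cb: "clockwise ?n b" by (auto simp: clockwise_def a_def b_def)
  have cg: "clockwise ?n g"
    unfolding clockwise_def vertices_def g_def a_def b_def by auto
  have A: "?A = {1..2 * ?n}" by (simp only: a_def position_image)
  have B: "?B = {2 * ?n + 1..4 * ?n}"
    unfolding b_def by (rule shifted_position_image)
  have ends: "a (North 1) = 1" "a (South 1) = 2 * ?n" "b (North 1) = 2 * ?n + 1" "b (South 1) = 4 * ?n"
    "g (North 1) = 1" "g (South 1) = 4 * ?n" by (simp_all add: a_def b_def g_def)
  have gN: "g ` ?N = {1..?n} \<union> {3 * ?n + 1..4 * ?n}"
  proof (intro subset_antisym subsetI)
    fix x assume x: "x \<in> {1..?n} \<union> {3 * ?n + 1..4 * ?n}"
    show "x \<in> g ` ?N"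
    proof (cases "x \<le> ?n")
      case True
      then have "North x \<in> ?N" "g (North x) = x" using x by (auto simp: vertices_def g_def a_def)
      then show ?thesis by (metis imageI)
    next
      case False
      then have "South (4 * ?n + 1 - x) \<in> ?N" "g (South (4 * ?n + 1 - x)) = x"
        using x by (auto simp: South_in_vertices g_def b_def)
      then show ?thesis by (metis imageI)
    qed
  qed (auto simp: vertices_def g_def a_def b_def)
  have glu: "gluing ?n a b = stack_gluing ?n 0"
  proof -
    have "{a (South (Suc i)), b (North (Suc i))} = {2 * ?n - i, 2 * ?n + 1 + i}" for i
      by (simp add: a_def b_def)
    moreover have "gluing ?n a b = (\<lambda>i. {a (South (Suc i)), b (North (Suc i))}) ` {0..<?n}"
      unfolding gluing_def Collect_image_eq by (simp add: image_Suc_atLeastLessThan[symmetric] image_image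
          atLeastLessThanSuc_atLeastAtMost[symmetric] del: image_Suc_atLeastLessThan)
    ultimately show ?thesis unfolding stack_gluing_def Collect_image_eq by (simp add: atLeast0LessThan lessThan_def)
  qed
  \<comment> \<open>\<open>raise\<close> shifts the index by one, so the gluing of the images starts
    just after the first pair of the larger stack.\<close>
  have glu': "gluing m (a \<circ> raise) (b \<circ> raise) = stack_gluing ?n 1"
  proof -
    have "{(a \<circ> raise) (South i), (b \<circ> raise) (North i)} = {2 * ?n - i, 2 * ?n + 1 + i}" for i
      by (simp add: a_def b_def)
    moreover have "{1..m} = {1..<?n}" by auto
    ultimately show ?thesis unfolding stack_gluing_def gluing_def by simp
  qed
  obtain U1 where U1: "planar ?A U1" "a (North 1) \<notin> \<Union>U1" "a (South 1) \<notin> \<Union>U1"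
    "map_diagram a d1 = diagram ?A U1"
    "map_diagram (a \<circ> raise) (rho1 ?n d1) = diagram (?A - {a (North 1), a (South 1)}) U1"
    "on_vertices ?n d1" "on_vertices m (rho1 ?n d1)" using corner_diagram_planar[OF ca d1] by blast
  obtain U2 where U2: "planar ?B U2" "b (North 1) \<notin> \<Union>U2" "b (South 1) \<notin> \<Union>U2"
    "map_diagram b d2 = diagram ?B U2"
    "map_diagram (b \<circ> raise) (rho1 ?n d2) = diagram (?B - {b (North 1), b (South 1)}) U2"
    "on_vertices ?n d2" "on_vertices m (rho1 ?n d2)" using corner_diagram_planar[OF cb d2] by blast
  let ?p = "2 * ?n" and ?q = "2 * ?n + 1" and ?w = "4 * ?n"
  let ?V = "stack_points ?n 0" and ?V1 = "stack_points ?n 1" and ?M = "stack_gluing ?n 0" and ?M1 = "stack_gluing ?n 1"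
  let ?U = "U1 \<union> U2"
  have V: "?A \<union> ?B = ?V" unfolding A B stack_points_def by simp
  have less: "x < y" if "x \<in> ?A" "y \<in> ?B" for x y using that unfolding A B by simp
  have pU: "planar ?V ?U" using planar_Un(1)[OF U1(1) U2(1) less] unfolding V .
  have dU: "diagram ?V ?U = (fst (map_diagram a d1) \<union> fst (map_diagram b d2), snd (map_diagram a d1) \<union> snd (map_diagram b d2))"
    unfolding U1(4) U2(4) V[symmetric] by (rule planar_Un(2)[OF U1(1) U2(1) less])
  note P1 = planarD[OF U1(1)] and P2 = planarD[OF U2(1)]
  have pq: "?p \<in> ?V" "?q \<in> ?V" "?p < ?q" "?V \<inter> {?p<..<?q} = {}" by (auto simp: stack_points_def)
  have out: "?p \<notin> \<Union>?U" "?q \<notin> \<Union>?U" "1 \<notin> \<Union>?U" "?w \<notin> \<Union>?U"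
  proof -
    have "x \<notin> \<Union>U1" if "?p < x" for x
    proof
      assume "x \<in> \<Union>U1"
      then have "x \<in> {1..?p}" using P1(2) unfolding A by blast
      with that show False by simp
    qed
    then have 1: "?q \<notin> \<Union>U1" "?w \<notin> \<Union>U1" by simp_all
    have "x \<notin> \<Union>U2" if "x \<le> ?p" for x
    proof
      assume "x \<in> \<Union>U2"
      then have "x \<in> {?q..?w}" using P2(2) unfolding B by blast
      with that show False by simp
    qed
    then have 2: "1 \<notin> \<Union>U2" "?p \<notin> \<Union>U2" by simp_all
    from 1 2 show "?p \<notin> \<Union>?U" "?q \<notin> \<Union>?U" "1 \<notin> \<Union>?U" "?w \<notin> \<Union>?U"
      using U1(2,3) U2(2,3) unfolding ends by blast+
  qed
  have Mpq: "{?p, ?q} \<in> ?M" "?M - {{?p, ?q}} = ?M1" "?V - {?p, ?q} = ?V1"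
  proof -
    have "{?p - 0, ?q + 0} \<in> ?M" unfolding stack_gluing_def
      by (rule CollectI, rule exI[of _ 0]) simp
    then show "{?p, ?q} \<in> ?M" by simp
  qed (use stack_gluing_Suc[of 0 ?n] stack_points_Suc[of 0 ?n] in simp_all)
  have M: "disjoint ?M" "\<Union>?M \<subseteq> ?V" using nested_disjoint[OF nested_stack[of 0 ?n]] by auto
  \<comment> \<open>Both points are decorated ends, 1' of the upper and 1 of the lower factor, so
    their contraction leaves the undecorated lines alone.\<close>
  have con: "contract ?p ?q ?U = ?U"
    by (rule contract_defects[OF out(1,2)])
  let ?T = "?V - \<Union>?U"
  \<comment> \<open>\<open>?p\<close> is the last of the evenly many defects of the upper factor, so
    an odd number of defects precedes it: two blobs merge here, which is the additional one in
    \<open>Suc j\<close>.\<close>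
  have odd: "odd (card (?T \<inter> {..<?p}))"
  proof -
    have "?A - \<Union>U1 = insert ?p (?T \<inter> {..<?p})"
    proof (intro subset_antisym subsetI)
      fix x assume x: "x \<in> ?A - \<Union>U1"
      then have "x \<notin> \<Union>U2" using P2(2) less by blast
      then show "x \<in> insert ?p (?T \<inter> {..<?p})" using x unfolding V[symmetric] A by auto
    next
      fix x assume "x \<in> insert ?p (?T \<inter> {..<?p})"
      then show "x \<in> ?A - \<Union>U1" using out(1) unfolding V[symmetric] A B by auto
    qed
    then have "card (?A - \<Union>U1) = card (insert ?p (?T \<inter> {..<?p}))" by simp
    also have "\<dots> = Suc (card (?T \<inter> {..<?p}))" using P1(1) V by simp
    finally show ?thesis using P1(5) by simp
  qed
  have g1: "glue ?V (diagram ?V ?U) ?M = scale 0 1 0 (glue ?V1 (diagram ?V1 ?U) ?M1)"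
  proof -
    have "{?p, ?q} \<notin> ?U" using out by blast
    moreover have "?p \<in> ?T" "?q \<in> ?T" using pq out by auto
    ultimately show ?thesis
      using planar_glue_contract[OF pU pq Mpq(1) M] odd unfolding con Mpq(2,3) by simp
  qed
  have pU1: "planar ?V1 ?U" using planar_contract[OF pU pq] unfolding con Mpq(3) .
  have VM: "?V1 - \<Union>?M1 = g ` ?N" unfolding Union_stack_gluing gN stack_points_def by auto
  have "1 \<in> ?V1 - \<Union>?U - \<Union>?M1" "?w \<in> ?V1 - \<Union>?U - \<Union>?M1"
    using out unfolding Union_stack_gluing by (auto simp: stack_points_def)
  then obtain U' i j k where U': "planar (g ` ?N) U'" "1 \<notin> \<Union>U'" "?w \<notin> \<Union>U'"
    "glue ?V1 (diagram ?V1 ?U) ?M1 = (diagram (g ` ?N) U', i, j, k)"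
    "glue (?V1 - {1, ?w}) (diagram (?V1 - {1, ?w}) ?U) ?M1 = (diagram (g ` ?N - {1, ?w}) U', i, k, j)"
  proof -
    assume vw: "1 \<in> ?V1 - \<Union>?U - \<Union>?M1" "?w \<in> ?V1 - \<Union>?U - \<Union>?M1"
    have nest: "nested ?V1 ?M1" by (rule nested_stack) simp
    have lt: "1 < ?w" by simp
    have bounds: "1 \<le> x \<and> x \<le> ?w" if "x \<in> ?V1" for x using that by (auto simp: stack_points_def)
    note ex = planar_glue_nested[OF nest pU1 vw lt bounds, unfolded VM]
    show thesis by (insert ex, drule meta_mp, assumption, elim exE conjE, rule that)
  qed
  have ne: "{} \<notin> snd d1" "{} \<notin> snd d2" using d1 d2 corner_diagrams_subset blob_diagrams_nonempty_lines by blast+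
  have "glue ?V (diagram ?V ?U) ?M = apfst (map_diagram g) (stack_outcome ?n d1 d2)"
    using glue_juxtaposition[OF clockwise_inj_on[OF ca] clockwise_inj_on[OF cb] _ U1(6) U2(6) ne] less
    unfolding V glu dU g_def by blast
  then have o1: "apfst (map_diagram g) (stack_outcome ?n d1 d2) = (diagram (g ` ?N) U', i, Suc j, k)"
    unfolding g1 U'(4) by simp
  define d where "d = concat_diagram ?n d1 d2"
  have d: "stack_outcome ?n d1 d2 = (d, i, Suc j, k)" "map_diagram g d = diagram (g ` ?N) U'"
    using o1 unfolding d_def concat_diagram_stack_outcome by (cases "stack_outcome ?n d1 d2"; simp)+
  have on: "on_vertices ?n d" unfolding d_def by (rule on_vertices_concat_diagram[OF U1(6) U2(6)])
  have db: "d \<in> blob_diagrams ?n" using blob_diagrams_iff_planar[OF cg] on d(2) U'(1) by blast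
  have out': "g (North 1) \<notin> \<Union>U'" "g (South 1) \<notin> \<Union>U'" using U'(2,3) unfolding ends .
  have dc: "d \<in> corner_diagrams ?n" using corner_diagrams_iff_planar[OF cg _ db U'(1) d(2)] out' by simp
  let ?r1 = "rho1 ?n d1" and ?r2 = "rho1 ?n d2"
  have r: "?r1 \<in> blob_diagrams m" "?r2 \<in> blob_diagrams m" using bij_betwE[OF rho1_bij_betw] d1 d2 by blast+
  let ?a = "a \<circ> raise" and ?b = "b \<circ> raise"
  note ca' = clockwise_raise[OF ca] and cb' = clockwise_raise[OF cb]
  have A': "?a ` vertices m = ?A - {1, ?p}" and B': "?b ` vertices m = ?B - {?q, ?w}"
    using clockwise_raise_image[OF ca] clockwise_raise_image[OF cb] unfolding ends by blast+
  have V': "(?A - {1, ?p}) \<union> (?B - {?q, ?w}) = ?V1 - {1, ?w}"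
    unfolding A B stack_points_def by auto
  have p1: "planar (?A - {1, ?p}) U1" using planar_remove_ends[OF U1(1), of 1 ?p] U1(2,3)
    unfolding ends unfolding A by simp
  have p2: "planar (?B - {?q, ?w}) U2" using planar_remove_ends[OF U2(1), of ?q ?w] U2(2,3)
    unfolding ends unfolding B by simp
  have less': "x < y" if "x \<in> ?A - {1, ?p}" "y \<in> ?B - {?q, ?w}" for x y using less that by blast
  have dU': "diagram (?V1 - {1, ?w}) ?U =
      (fst (map_diagram ?a ?r1) \<union> fst (map_diagram ?b ?r2), snd (map_diagram ?a ?r1) \<union> snd (map_diagram ?b ?r2))"
    using planar_Un(2)[OF p1 p2 less'] unfolding U1(5) U2(5) ends V' .
  have case_raise: "(\<lambda>v. case v of North i \<Rightarrow> ?a v | South i \<Rightarrow> ?b v) = g \<circ> raise"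
    by (auto simp: g_def fun_eq_iff split: vertex.split)
  have "glue (?V1 - {1, ?w}) (diagram (?V1 - {1, ?w}) ?U) ?M1 = apfst (map_diagram (g \<circ> raise)) (stack_outcome m ?r1 ?r2)"
  proof -
    have "?a ` vertices m \<inter> ?b ` vertices m = {}" using less' unfolding A' B' by blast
    from glue_juxtaposition[OF clockwise_inj_on[OF ca'] clockwise_inj_on[OF cb'] this U1(7) U2(7)
        blob_diagrams_nonempty_lines[OF r(1)] blob_diagrams_nonempty_lines[OF r(2)]]
    show ?thesis unfolding A' B' V' glu' dU' case_raise .
  qed
  then have o2: "apfst (map_diagram (g \<circ> raise)) (stack_outcome m ?r1 ?r2) = (diagram (g ` ?N - {1, ?w}) U', i, k, j)"
    unfolding U'(5) by simp
  define d' where "d' = concat_diagram m ?r1 ?r2"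
  have d': "stack_outcome m ?r1 ?r2 = (d', i, k, j)" "map_diagram (g \<circ> raise) d' = diagram (g ` ?N - {1, ?w}) U'"
    using o2 unfolding d'_def concat_diagram_stack_outcome by (cases "stack_outcome m ?r1 ?r2"; simp)+
  have "on_vertices m d'" unfolding d'_def by (rule on_vertices_concat_diagram[OF U1(7) U2(7)])
  moreover note rho = rho1_planar[OF cg on U'(1) d(2) out']
  moreover have "map_diagram (g \<circ> raise) d' = map_diagram (g \<circ> raise) (rho1 ?n d)"
    using rho(2) d'(2) unfolding ends by simp
  ultimately have "d' = rho1 ?n d"
    using map_diagram_inj[OF clockwise_inj_on[OF clockwise_raise[OF cg]]] by blast
  with d(1) d'(1) dc show ?thesis by blast
qed

section \<open>Concatenation with identity diagrams, and the diagram \<open>e\<close>\<close>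

text \<open>When the stack collapses onto \<open>d\<close> along connected fibres, its components
  correspond to the lines of \<open>d\<close>: none is closed, and the blob counts agree. The
  outcome is then that of gluing \<open>d\<close> along no pairs.\<close>

lemma stack_outcome_retract:
  fixes f :: "nat \<times> nat \<Rightarrow> vertex" and n :: nat
  defines "S \<equiv> {0, 1, 2} \<times> {1..n} :: (nat \<times> nat) set"
  assumes d: "d \<in> blob_diagrams n" and on: "on_vertices n d1" "on_vertices n d2"
    and f: "f ` S = vertices n"
    and edge: "\<And>e x y. e \<in> stack_edges d1 d2 \<Longrightarrow> x \<in> e \<Longrightarrow> y \<in> e \<Longrightarrow> (f x, f y) \<in> (joined (fst d))\<^sup>*"
    and lift: "\<And>l x y. l \<in> fst d \<Longrightarrow> x \<in> l \<Longrightarrow> y \<in> l \<Longrightarrow>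
      \<exists>u\<in>S. \<exists>v\<in>S. f u = x \<and> f v = y \<and> (u, v) \<in> (joined (stack_edges d1 d2))\<^sup>*"
    and fibre: "\<And>x y. x \<in> S \<Longrightarrow> y \<in> S \<Longrightarrow> f x = f y \<Longrightarrow> (x, y) \<in> (joined (stack_edges d1 d2))\<^sup>*"
    and ends: "\<And>l. l \<subseteq> vertices n \<Longrightarrow> outer_ends (S \<inter> f -` l) = l"
    and bl: "\<And>l. l \<in> fst d \<Longrightarrow> blobs_on d1 d2 (S \<inter> f -` l) = blobs (snd d) l"
  shows "stack_outcome n d1 d2 = (d, 0, 0, 0)"
proof -
  have part: "partition_on (vertices n) (fst d)" and D: "snd d \<subseteq> fst d"
    using d by (auto simp: blob_diagrams_def TL_diagrams_def)
  have U: "\<Union>(fst d) = vertices n" using part by (simp add: partition_on_def)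
  note comp = components_partition_lines[OF part]
  have bij: "bij_betw (\<lambda>l. S \<inter> f -` l) (components (vertices n) (fst d)) (stack_components n d1 d2)"
    unfolding stack_components_alt S_def[symmetric]
    by (rule components_pullback[OF f _ _ edge lift fibre])
       (use U stack_edges_subset[OF on] in \<open>auto simp: S_def\<close>)
  have "stack_outcome n d1 d2 = outcome (components (vertices n) (fst d \<union> {})) (\<lambda>C. C - \<Union>{}) (blobs (snd d))"
    unfolding stack_outcome_def Un_empty_right
  proof (rule outcome_reindex[OF bij])
    fix C assume "C \<in> components (vertices n) (fst d)"
    then have C: "C \<in> fst d" unfolding comp .
    then have "C \<subseteq> vertices n" using U by blast
    then show "outer_ends (S \<inter> f -` C) = C - \<Union>{}" by (simp only: ends Union_empty Diff_empty)
    show "blobs_on d1 d2 (S \<inter> f -` C) = blobs (snd d) C" by (rule bl[OF C])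
  qed
  also have "\<dots> = glue (vertices n) (fst d, snd d) {}" by (simp add: glue_def)
  also have "\<dots> = (d, 0, 0, 0)" using glue_empty[OF part D] by simp
  finally show ?thesis .
qed

lemma on_vertices_id: "on_vertices n (id_diagram n)"
  by (auto simp: on_vertices_def id_diagram_def id_lines_def vertices_def)

lemma blob_diagrams_on_vertices: "d \<in> blob_diagrams n \<Longrightarrow> on_vertices n d"
proof -
  assume "d \<in> blob_diagrams n"
  then have "\<Union>(fst d) = vertices n" "snd d \<subseteq> fst d"
    by (auto simp: blob_diagrams_def TL_diagrams_def partition_on_def)
  then show ?thesis unfolding on_vertices_def by blast
qed

lemma id_lines_image: "id_lines n = (\<lambda>i. {North i, South i}) ` {1..n}"
  by (auto simp: id_lines_def)

text \<open>\<open>k\<close> is the level at which \<open>d\<close> is placed and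
  \<open>1 - k\<close> that of the identity, so one argument covers both orders of the
  factors.\<close>

lemma stack_outcome_id:
  assumes d: "d \<in> blob_diagrams n" and on: "on_vertices n d1" "on_vertices n d2" and k: "k \<in> {0, 1}"
    and edges: "stack_edges d1 d2 = (`) (place k) ` fst d \<union> (`) (place (1 - k)) ` id_lines n"
    and bl: "\<And>C. blobs_on d1 d2 C = card {l \<in> snd d. place k ` l \<subseteq> C}"
  shows "stack_outcome n d1 d2 = (d, 0, 0, 0)"
proof -
  let ?S = "{0, 1, 2} \<times> {1..n} :: (nat \<times> nat) set" and ?R = "(joined (stack_edges d1 d2))\<^sup>*"
  \<comment> \<open>Each strand of the identity, running between levels \<open>1 - k\<close> and
    \<open>2 - k\<close>, shrinks to a single vertex of \<open>d\<close>.\<close>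
  define f where "f x = (if fst x \<le> k then North (snd x) else South (snd x))" for x :: "nat \<times> nat"
  have fk: "f (place k v) = v" for v by (cases v) (auto simp: f_def)
  have in_S: "place k v \<in> ?S" if "v \<in> vertices n" for v by (rule place_in_stack[OF that k])
  have fS: "f ` ?S = vertices n"
  proof (intro subset_antisym subsetI)
    fix v assume "v \<in> vertices n"
    then show "v \<in> f ` ?S" using fk in_S by (metis imageI)
  qed (auto simp: f_def vertices_def)
  have lines: "l \<subseteq> vertices n" if "l \<in> fst d \<or> l \<in> snd d" for l
    using blob_diagrams_on_vertices[OF d] that by (auto simp: on_vertices_def)
  have id_edge: "{(1 - k, i), (2 - k, i)} = place (1 - k) ` {North i, South i}" for i
    using k by (auto simp: numeral_2_eq_2)
  have j: "((1 - k, i), (2 - k, i)) \<in> ?R" if "i \<in> {1..n}" for i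
  proof (rule joined_edge)
    show "{(1 - k, i), (2 - k, i)} \<in> stack_edges d1 d2"
      unfolding edges id_edge id_lines_image using that by blast
  qed auto
  have j2: "(place k x, place k y) \<in> ?R" if "l \<in> fst d" "x \<in> l" "y \<in> l" for l x y
    by (rule joined_edge[of "place k ` l"]) (use that in \<open>auto simp: edges\<close>)
  show ?thesis
  proof (rule stack_outcome_retract[OF d on fS])
    fix e x y assume e: "e \<in> stack_edges d1 d2" "x \<in> e" "y \<in> e"
    then consider i where "e = {(1 - k, i), (2 - k, i)}" | l where "l \<in> fst d" "e = place k ` l"
      unfolding edges id_lines_image id_edge by blast
    then show "(f x, f y) \<in> (joined (fst d))\<^sup>*"
    proof cases
      case (1 i)
      then have "f x = f y" using e k by (auto simp: f_def)
      then show ?thesis by simp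
    next
      case (2 l)
      then have "f x \<in> l" "f y \<in> l" using e fk by auto
      then show ?thesis using joined_edge[OF 2(1)] by blast
    qed
  next
    fix l x y assume l: "l \<in> fst d" "x \<in> l" "y \<in> l"
    then have "place k x \<in> ?S" "place k y \<in> ?S" using lines in_S by blast+
    then show "\<exists>u\<in>?S. \<exists>v\<in>?S. f u = x \<and> f v = y \<and> (u, v) \<in> ?R"
      using fk j2[OF l] by (intro bexI[of _ "place k x"] bexI[of _ "place k y"] conjI)
  next
    fix x y assume "x \<in> ?S" "y \<in> ?S" "f x = f y"
    then obtain l m i where "x = (l, i)" "y = (m, i)"
        "l = m \<or> l = 1 - k \<and> m = 2 - k \<or> l = 2 - k \<and> m = 1 - k" "i \<in> {1..n}"
      using k by (auto simp: f_def split: if_splits)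
    then show "(x, y) \<in> ?R"
      using j[of i] joined_rtrancl_sym[OF j[of i]] by auto
  next
    fix l assume "l \<subseteq> vertices n"
    then show "outer_ends (?S \<inter> f -` l) = l"
      using k by (auto simp: outer_ends_def f_def vertices_def)
  next
    fix l assume "l \<in> fst d"
    have "place k ` m \<subseteq> ?S \<inter> f -` l \<longleftrightarrow> m \<subseteq> l" if "m \<in> snd d" for m
    proof -
      have "\<forall>v\<in>m. place k v \<in> ?S" using lines that in_S by blast
      then show ?thesis unfolding image_subset_iff subset_eq using fk by simp
    qed
    then have "{m \<in> snd d. place k ` m \<subseteq> ?S \<inter> f -` l} = {m \<in> snd d. m \<subseteq> l}"
      by (intro Collect_cong conj_cong refl)
    then show "blobs_on d1 d2 (?S \<inter> f -` l) = blobs (snd d) l"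
      unfolding bl blobs_def by simp
  qed
qed

lemma stack_outcome_id_left:
  assumes "d \<in> blob_diagrams n"
  shows "stack_outcome n (id_diagram n) d = (d, 0, 0, 0)"
  by (rule stack_outcome_id[OF assms on_vertices_id blob_diagrams_on_vertices[OF assms], of 1])
     (auto simp: stack_edges_def blobs_on_def id_diagram_def)

lemma stack_outcome_id_right:
  assumes "d \<in> blob_diagrams n"
  shows "stack_outcome n d (id_diagram n) = (d, 0, 0, 0)"
  by (rule stack_outcome_id[OF assms blob_diagrams_on_vertices[OF assms] on_vertices_id, of 0])
     (auto simp: stack_edges_def blobs_on_def id_diagram_def)

lemma e_diagram_corner: "e_diagram (Suc n) \<in> corner_diagrams (Suc n)"
proof -
  let ?n = "Suc n"
  have "partition_on (vertices ?n) (id_lines ?n)"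
    unfolding partition_on_def
  proof (intro conjI)
    show "\<Union>(id_lines ?n) = vertices ?n" unfolding id_lines_image vertices_def by blast
  qed (auto simp: id_lines_def disjoint_def)
  moreover have "\<forall>l\<in>id_lines ?n. card l = 2" by (auto simp: id_lines_def)
  moreover have "noncrossing ?n (id_lines ?n)"
    unfolding noncrossing_def
  proof (intro allI impI notI, elim conjE)
    fix a b c d assume "{a, c} \<in> id_lines ?n" "{b, d} \<in> id_lines ?n"
      and less: "position ?n a < position ?n b" "position ?n b < position ?n c" "position ?n c < position ?n d"
    then obtain i j where "{a, c} = {North i, South i}" "{b, d} = {North j, South j}" "i \<in> {1..?n}" "j \<in> {1..?n}"
      by (auto simp: id_lines_def)
    then have "a = North i \<and> c = South i" "b = North j \<and> d = South j"
      using less by (auto simp: doubleton_eq_iff)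
    then show False using less by simp
  qed
  moreover have "western_exposed ?n (id_lines ?n) {North 1, South 1}"
    unfolding western_exposed_def
  proof (intro notI, elim exE conjE)
    fix a b assume "{a, b} \<in> id_lines ?n"
      "\<forall>v\<in>{North 1, South 1}. position ?n a < position ?n v \<and> position ?n v < position ?n b"
    then have "a \<in> vertices ?n" "position ?n a < 1"
      by (auto simp: id_lines_def vertices_def doubleton_eq_iff)
    then show False using position_bounds[of a ?n] by simp
  qed
  moreover have "{North 1, South 1} \<in> id_lines ?n" by (auto simp: id_lines_def)
  ultimately show ?thesis
    unfolding corner_diagrams_def blob_diagrams_def TL_diagrams_def e_diagram_def by auto
qed

lemma rho1_e_diagram: "rho1 (Suc n) (e_diagram (Suc n)) = id_diagram n"
proof -
  let ?n = "Suc n"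
  define xs where "xs = sorted_key_list_of_set (position ?n) {North 1, South 1}"
  have "inj_on (position ?n) {North 1, South 1}"
    by (rule inj_on_subset[OF inj_on_position]) (auto simp: vertices_def)
  from sorted_key_list_of_set_inj_on[OF this] have xs: "set xs = {North 1, South 1}"
    "sorted_wrt (<) (map (position ?n) xs)" unfolding xs_def by blast+
  then have "distinct xs" by (metis distinct_map strict_sorted_iff)
  then have "length xs = 2" using distinct_card[of xs] xs(1) by simp
  then have xs_tl: "butlast (tl xs) = []" by (auto simp: length_Suc_conv numeral_2_eq_2)
  have "\<Union>{{North 1, South 1}} = {North 1, South 1}" by simp
  then have "rho1 ?n (e_diagram ?n) = ((`) drop_first ` (id_lines ?n - {{North 1, South 1}}), {})"
    unfolding rho1_def e_diagram_def fst_conv snd_conv Let_def using xs_tl unfolding xs_def by simp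
  also have "(`) drop_first ` (id_lines ?n - {{North 1, South 1}}) = id_lines n"
  proof -
    have "inj_on (\<lambda>i. {North i, South i}) {1..?n}" by (auto simp: inj_on_def doubleton_eq_iff)
    then have "id_lines ?n - {{North 1, South 1}} = (\<lambda>i. {North i, South i}) ` ({1..?n} - {1})"
      unfolding id_lines_image by (subst inj_on_image_set_diff) auto
    also have "{1..?n} - {1} = Suc ` {1..n}" by (auto simp: image_iff)
    finally show ?thesis unfolding id_lines_image by (simp only: image_image) simp
  qed
  finally show ?thesis by (simp add: id_diagram_def)
qed

section \<open>The algebra isomorphism\<close>

lemma finite_blob_diagrams: "finite (blob_diagrams n)"
proof -
  have "blob_diagrams n \<subseteq> Pow (Pow (vertices n)) \<times> Pow (Pow (vertices n))"
  proof
    fix d assume "d \<in> blob_diagrams n"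
    from blob_diagrams_on_vertices[OF this] show "d \<in> Pow (Pow (vertices n)) \<times> Pow (Pow (vertices n))"
      unfolding on_vertices_def by (simp add: mem_Times_iff)
  qed
  then show ?thesis by (rule finite_subset) (simp add: finite_vertices)
qed

section \<open>The span of the corner diagrams\<close>

text \<open>Explicit form of the carrier of the corner algebra, which is given as an intersection of
  submodules; the two agree by \<open>carrier_corner_algebra\<close>.\<close>

definition corner_functions :: "('k, 'm) ring_scheme \<Rightarrow> nat \<Rightarrow> (blob_diagram \<Rightarrow> 'k) set" where
  "corner_functions K n = {x \<in> blob_diagrams n \<rightarrow>\<^sub>E carrier K.
     \<forall>d\<in>blob_diagrams n - corner_diagrams n. x d = \<zero>\<^bsub>K\<^esub>}"

context cring
begin

lemma concat_factor_closed:
  assumes "\<alpha> \<in> carrier R" "\<beta> \<in> carrier R" "\<gamma> \<in> carrier R"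
  shows "concat_factor R n \<alpha> \<beta> \<gamma> d1 d2 \<in> carrier R"
  unfolding concat_factor_def using assms by (intro finprod_closed) (auto simp: component_factor_def Let_def)

lemma blob_algebra_module: "module R (blob_algebra R n \<alpha> \<beta> \<gamma>)"
proof (rule moduleI)
  let ?M = "blob_algebra R n \<alpha> \<beta> \<gamma>" and ?B = "blob_diagrams n"
  note defs = blob_algebra_def
  note ext = PiE_ext[where k = ?B and s = "\<lambda>_. carrier R"]
  have c: "x d \<in> carrier R" if "x \<in> carrier ?M" "d \<in> ?B" for x d using that by (auto simp: defs)
  show "cring R" by (rule is_cring)
  show "abelian_group ?M"
  proof (rule abelian_groupI)
    fix x y z assume x: "x \<in> carrier ?M" and y: "y \<in> carrier ?M" and z: "z \<in> carrier ?M"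
    show "x \<oplus>\<^bsub>?M\<^esub> y \<in> carrier ?M" using x y by (auto simp: defs)
    show "x \<oplus>\<^bsub>?M\<^esub> y \<oplus>\<^bsub>?M\<^esub> z = x \<oplus>\<^bsub>?M\<^esub> (y \<oplus>\<^bsub>?M\<^esub> z)"
      by (simp add: defs, rule restrict_ext, simp add: a_assoc c[OF x] c[OF y] c[OF z])
    show "x \<oplus>\<^bsub>?M\<^esub> y = y \<oplus>\<^bsub>?M\<^esub> x"
      by (simp add: defs, rule restrict_ext, simp add: a_comm c[OF x] c[OF y])
  next
    show "\<zero>\<^bsub>?M\<^esub> \<in> carrier ?M" by (simp add: defs)
  next
    fix x assume x: "x \<in> carrier ?M"
    show "\<zero>\<^bsub>?M\<^esub> \<oplus>\<^bsub>?M\<^esub> x = x"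
      by (rule ext) (use x in \<open>simp_all add: defs c[OF x]\<close>)
    show "\<exists>y\<in>carrier ?M. y \<oplus>\<^bsub>?M\<^esub> x = \<zero>\<^bsub>?M\<^esub>"
    proof
      show "(\<lambda>d\<in>?B. \<ominus> x d) \<oplus>\<^bsub>?M\<^esub> x = \<zero>\<^bsub>?M\<^esub>"
        by (simp add: defs, rule restrict_ext, simp add: l_neg c[OF x])
      show "(\<lambda>d\<in>?B. \<ominus> x d) \<in> carrier ?M" using x by (auto simp: defs)
    qed
  qed
next
  let ?M = "blob_algebra R n \<alpha> \<beta> \<gamma>" and ?B = "blob_diagrams n"
  note defs = blob_algebra_def
  note ext = PiE_ext[where k = ?B and s = "\<lambda>_. carrier R"]
  have c: "x d \<in> carrier R" if "x \<in> carrier ?M" "d \<in> ?B" for x d using that by (auto simp: defs)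
  fix a b x y assume a: "a \<in> carrier R" and b: "b \<in> carrier R" and x: "x \<in> carrier ?M" and y: "y \<in> carrier ?M"
  show "a \<odot>\<^bsub>?M\<^esub> x \<in> carrier ?M" using a x by (auto simp: defs)
  show "(a \<oplus> b) \<odot>\<^bsub>?M\<^esub> x = a \<odot>\<^bsub>?M\<^esub> x \<oplus>\<^bsub>?M\<^esub> b \<odot>\<^bsub>?M\<^esub> x"
    by (simp add: defs, rule restrict_ext, simp add: l_distr a b c[OF x])
  show "a \<odot>\<^bsub>?M\<^esub> (x \<oplus>\<^bsub>?M\<^esub> y) = a \<odot>\<^bsub>?M\<^esub> x \<oplus>\<^bsub>?M\<^esub> a \<odot>\<^bsub>?M\<^esub> y"
    by (simp add: defs, rule restrict_ext, simp add: r_distr a c[OF x] c[OF y])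
  show "(a \<otimes> b) \<odot>\<^bsub>?M\<^esub> x = a \<odot>\<^bsub>?M\<^esub> (b \<odot>\<^bsub>?M\<^esub> x)"
    by (simp add: defs, rule restrict_ext, simp add: m_assoc a b c[OF x])
next
  let ?M = "blob_algebra R n \<alpha> \<beta> \<gamma>" and ?B = "blob_diagrams n"
  fix x assume x: "x \<in> carrier ?M"
  then have c: "x d \<in> carrier R" if "d \<in> ?B" for d using that by (auto simp: blob_algebra_def)
  show "\<one> \<odot>\<^bsub>?M\<^esub> x = x"
    by (rule PiE_ext[where k = ?B and s = "\<lambda>_. carrier R"]) (use x in \<open>simp_all add: blob_algebra_def c\<close>)
qed

lemma corner_vec_apply:
  assumes "\<delta>\<^sub>e \<in> Units R" "d' \<in> blob_diagrams n"
  shows "corner_vec R n \<delta> \<delta>\<^sub>e \<kappa> d d' = (if d' = d then inv \<delta>\<^sub>e else \<zero>)"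
  using assms by (simp add: corner_vec_def blob_algebra_def diagram_vec_def)

text \<open>Functions supported on the corner diagrams form a submodule containing the generators.
  Any submodule containing these contains every such function, because its finite support can be
  built up one diagram at a time.\<close>

lemma carrier_corner_algebra:
  assumes \<delta>: "\<delta>\<^sub>e \<in> Units R"
  shows "carrier (corner_algebra R n \<delta> \<delta>\<^sub>e \<kappa>) = corner_functions R n"
proof -
  let ?M = "blob_algebra R n \<delta> \<delta>\<^sub>e \<kappa>" and ?B = "blob_diagrams n" and ?C = "corner_diagrams n"
  let ?v = "corner_vec R n \<delta> \<delta>\<^sub>e \<kappa>"
  interpret M: module R ?M by (rule blob_algebra_module)
  have carr: "carrier ?M = ?B \<rightarrow>\<^sub>E carrier R" by (simp add: blob_algebra_def)
  have dc: "\<delta>\<^sub>e \<in> carrier R" "inv \<delta>\<^sub>e \<in> carrier R" using \<delta> by auto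
  have sub: "submodule (corner_functions R n) R ?M"
  proof (rule M.submoduleI)
    show "corner_functions R n \<subseteq> carrier ?M" by (auto simp: corner_functions_def carr)
    show "\<zero>\<^bsub>?M\<^esub> \<in> corner_functions R n" by (auto simp: corner_functions_def blob_algebra_def)
    fix x assume x: "x \<in> corner_functions R n"
    then have xc: "x \<in> ?B \<rightarrow>\<^sub>E carrier R" by (simp add: corner_functions_def)
    have "\<ominus>\<^bsub>?M\<^esub> x = (\<lambda>d\<in>?B. \<ominus> x d)"
    proof (rule M.minus_equality)
      show "(\<lambda>d\<in>?B. \<ominus> x d) \<oplus>\<^bsub>?M\<^esub> x = \<zero>\<^bsub>?M\<^esub>"
        by (simp add: blob_algebra_def, rule restrict_ext, simp add: l_neg PiE_mem[OF xc])
    qed (use xc carr in auto)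
    then show "\<ominus>\<^bsub>?M\<^esub> x \<in> corner_functions R n" using x by (auto simp: corner_functions_def)
    show "a \<odot>\<^bsub>?M\<^esub> x \<in> corner_functions R n" if "a \<in> carrier R" for a
      using x that by (auto simp: corner_functions_def blob_algebra_def)
    show "x \<oplus>\<^bsub>?M\<^esub> y \<in> corner_functions R n" if "y \<in> corner_functions R n" for y
      using x that by (auto simp: corner_functions_def blob_algebra_def)
  qed
  have gen: "?v ` ?C \<subseteq> corner_functions R n"
  proof
    fix x assume "x \<in> ?v ` ?C"
    then obtain d where d: "d \<in> ?C" "x = ?v d" by blast
    have "x \<in> ?B \<rightarrow>\<^sub>E carrier R"
      using dc unfolding d(2) corner_vec_def by (auto simp: blob_algebra_def diagram_vec_def)
    moreover have "x d' = \<zero>" if "d' \<in> ?B - ?C" for d'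
      using that d corner_vec_apply[OF \<delta>, of d' n] by auto
    ultimately show "x \<in> corner_functions R n" by (simp add: corner_functions_def)
  qed
  have "x \<in> N" if x: "x \<in> corner_functions R n" and N: "submodule N R ?M" "?v ` ?C \<subseteq> N" for x N
  proof -
    interpret N: submodule N R ?M by (rule N(1))
    have xc: "x \<in> ?B \<rightarrow>\<^sub>E carrier R" using x by (simp add: corner_functions_def)
    have "finite F \<Longrightarrow> F \<subseteq> ?C \<Longrightarrow> (\<lambda>d\<in>?B. if d \<in> F then x d else \<zero>) \<in> N" for F
    proof (induction F rule: finite_induct)
      case empty
      have "(\<lambda>d\<in>?B. if d \<in> {} then x d else \<zero>) = \<zero>\<^bsub>?M\<^esub>" by (simp add: blob_algebra_def)
      then show ?case using N.one_closed by simp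
    next
      case (insert c F)
      then have c: "c \<in> ?C" "c \<in> ?B" using corner_diagrams_subset by auto
      have xd: "x c \<in> carrier R" using xc c by blast
      \<comment> \<open>The factor \<open>\<delta>\<^sub>e\<close> in the scalar undoes the
        normalisation of the generator.\<close>
      have "(\<delta>\<^sub>e \<otimes> x c) \<odot>\<^bsub>?M\<^esub> ?v c \<in> N" using N(2) c(1) dc xd by (intro N.smult_closed) auto
      moreover have "(\<lambda>d\<in>?B. if d \<in> F then x d else \<zero>) \<in> N" using insert.IH insert.prems by blast
      ultimately have mem: "(\<delta>\<^sub>e \<otimes> x c) \<odot>\<^bsub>?M\<^esub> ?v c \<oplus>\<^bsub>?M\<^esub> (\<lambda>d\<in>?B. if d \<in> F then x d else \<zero>) \<in> N"
        using N.m_closed by simp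
      have inv: "\<delta>\<^sub>e \<otimes> x c \<otimes> inv \<delta>\<^sub>e = x c"
        using \<delta> dc xd by (metis Units_r_inv m_assoc m_comm r_one)
      have "(\<delta>\<^sub>e \<otimes> x c) \<odot>\<^bsub>?M\<^esub> ?v c \<oplus>\<^bsub>?M\<^esub> (\<lambda>d\<in>?B. if d \<in> F then x d else \<zero>) =
          (\<lambda>d\<in>?B. (\<delta>\<^sub>e \<otimes> x c) \<otimes> ?v c d \<oplus> (if d \<in> F then x d else \<zero>))"
        by (simp add: blob_algebra_def cong: restrict_cong)
      also have "\<dots> = (\<lambda>d\<in>?B. if d \<in> insert c F then x d else \<zero>)"
      proof (rule restrict_ext)
        fix d assume d: "d \<in> ?B"
        then have "x d \<in> carrier R" using xc by blast
        then show "(\<delta>\<^sub>e \<otimes> x c) \<otimes> ?v c d \<oplus> (if d \<in> F then x d else \<zero>) = (if d \<in> insert c F then x d else \<zero>)"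
          unfolding corner_vec_apply[OF \<delta> d] using inv insert(2) dc xd by auto
      qed
      finally have eq: "(\<delta>\<^sub>e \<otimes> x c) \<odot>\<^bsub>?M\<^esub> ?v c \<oplus>\<^bsub>?M\<^esub> (\<lambda>d\<in>?B. if d \<in> F then x d else \<zero>) =
          (\<lambda>d\<in>?B. if d \<in> insert c F then x d else \<zero>)" .
      show ?case using mem unfolding eq .
    qed
    from this[OF _ order_refl] have "(\<lambda>d\<in>?B. if d \<in> ?C then x d else \<zero>) \<in> N"
      using finite_subset[OF corner_diagrams_subset finite_blob_diagrams] by blast
    moreover have "(\<lambda>d\<in>?B. if d \<in> ?C then x d else \<zero>) = x"
      by (rule PiE_ext[where k = ?B and s = "\<lambda>_. carrier R"])
         (use x xc in \<open>auto simp: corner_functions_def\<close>)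
    ultimately show ?thesis by simp
  qed
  then show ?thesis
    unfolding corner_algebra_def module_span_def using sub gen by auto
qed

lemma blob_algebra_mult_apply:
  assumes "d \<in> blob_diagrams n"
  shows "(x \<otimes>\<^bsub>blob_algebra R n \<alpha> \<beta> \<gamma>\<^esub> y) d =
    (\<Oplus>p\<in>{p \<in> blob_diagrams n \<times> blob_diagrams n. concat_diagram n (fst p) (snd p) = d}.
      concat_factor R n \<alpha> \<beta> \<gamma> (fst p) (snd p) \<otimes> (x (fst p) \<otimes> y (snd p)))"
  using assms by (simp add: blob_algebra_def)

lemma blob_algebra_mult_closed:
  assumes "\<alpha> \<in> carrier R" "\<beta> \<in> carrier R" "\<gamma> \<in> carrier R"
    and "x \<in> blob_diagrams n \<rightarrow>\<^sub>E carrier R" "y \<in> blob_diagrams n \<rightarrow>\<^sub>E carrier R"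
  shows "x \<otimes>\<^bsub>blob_algebra R n \<alpha> \<beta> \<gamma>\<^esub> y \<in> blob_diagrams n \<rightarrow>\<^sub>E carrier R"
proof -
  have "concat_factor R n \<alpha> \<beta> \<gamma> (fst p) (snd p) \<otimes> (x (fst p) \<otimes> y (snd p)) \<in> carrier R"
    if "p \<in> blob_diagrams n \<times> blob_diagrams n" for p
    using that by (simp add: concat_factor_closed[OF assms(1-3)] PiE_mem[OF assms(4)] PiE_mem[OF assms(5)] mem_Times_iff)
  then show ?thesis
    unfolding blob_algebra_def by (auto intro!: finsum_closed)
qed

lemma concat_corner_diagrams:
  assumes "d1 \<in> corner_diagrams (Suc m)" "d2 \<in> corner_diagrams (Suc m)"
  shows "concat_diagram (Suc m) d1 d2 \<in> corner_diagrams (Suc m)"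
    "rho1 (Suc m) (concat_diagram (Suc m) d1 d2) = concat_diagram m (rho1 (Suc m) d1) (rho1 (Suc m) d2)"
  using stack_outcome_rho1[OF assms] by (auto simp: concat_diagram_stack_outcome)

text \<open>Exponents and parameters are exchanged simultaneously, so the two products of powers
  differ only by \<open>Suc j\<close> against \<open>j\<close>.\<close>

lemma concat_factor_rho1:
  assumes d: "d1 \<in> corner_diagrams (Suc m)" "d2 \<in> corner_diagrams (Suc m)"
    and K: "\<delta> \<in> carrier R" "\<delta>\<^sub>e \<in> carrier R" "\<kappa> \<in> carrier R"
  shows "concat_factor R (Suc m) \<delta> \<delta>\<^sub>e \<kappa> d1 d2 =
    \<delta>\<^sub>e \<otimes> concat_factor R m \<delta> \<kappa> \<delta>\<^sub>e (rho1 (Suc m) d1) (rho1 (Suc m) d2)"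
proof -
  obtain d i j k where s: "stack_outcome (Suc m) d1 d2 = (d, i, Suc j, k)"
    "stack_outcome m (rho1 (Suc m) d1) (rho1 (Suc m) d2) = (rho1 (Suc m) d, i, k, j)"
    using stack_outcome_rho1[OF d] by blast
  have on: "on_vertices (Suc m) d1" "on_vertices (Suc m) d2"
    "on_vertices m (rho1 (Suc m) d1)" "on_vertices m (rho1 (Suc m) d2)"
    using d corner_diagrams_subset bij_betwE[OF rho1_bij_betw] blob_diagrams_on_vertices by blast+
  have "concat_factor R (Suc m) \<delta> \<delta>\<^sub>e \<kappa> d1 d2 = \<delta> [^] i \<otimes> \<delta>\<^sub>e [^] Suc j \<otimes> \<kappa> [^] k"
    by (rule concat_factor_stack_outcome[OF on(1,2) s(1) K])
  moreover have "concat_factor R m \<delta> \<kappa> \<delta>\<^sub>e (rho1 (Suc m) d1) (rho1 (Suc m) d2) =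
      \<delta> [^] i \<otimes> \<kappa> [^] k \<otimes> \<delta>\<^sub>e [^] j"
    by (rule concat_factor_stack_outcome[OF on(3,4) s(2) K(1,3,2)])
  ultimately show ?thesis using K by (simp add: m_ac)
qed

text \<open>Corner diagrams are closed under concatenation. A pair with product outside the corner
  thus has a member outside it, where the corresponding function vanishes.\<close>

lemma corner_functions_mult_closed:
  assumes K: "\<delta> \<in> carrier R" "\<delta>\<^sub>e \<in> carrier R" "\<kappa> \<in> carrier R"
    and x: "x \<in> corner_functions R (Suc m)" and y: "y \<in> corner_functions R (Suc m)"
  shows "x \<otimes>\<^bsub>blob_algebra R (Suc m) \<delta> \<delta>\<^sub>e \<kappa>\<^esub> y \<in> corner_functions R (Suc m)"
proof -
  let ?n = "Suc m" and ?M = "blob_algebra R (Suc m) \<delta> \<delta>\<^sub>e \<kappa>"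
  have xy: "x \<in> blob_diagrams ?n \<rightarrow>\<^sub>E carrier R" "y \<in> blob_diagrams ?n \<rightarrow>\<^sub>E carrier R"
    using x y by (auto simp: corner_functions_def)
  have "(x \<otimes>\<^bsub>?M\<^esub> y) d = \<zero>" if d: "d \<in> blob_diagrams ?n - corner_diagrams ?n" for d
  proof -
    have "concat_factor R ?n \<delta> \<delta>\<^sub>e \<kappa> (fst p) (snd p) \<otimes> (x (fst p) \<otimes> y (snd p)) = \<zero>"
      if p: "p \<in> {p \<in> blob_diagrams ?n \<times> blob_diagrams ?n. concat_diagram ?n (fst p) (snd p) = d}" for p
    proof -
      have "fst p \<notin> corner_diagrams ?n \<or> snd p \<notin> corner_diagrams ?n"
        using concat_corner_diagrams(1)[of "fst p" m "snd p"] p d by auto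
      then have "x (fst p) = \<zero> \<or> y (snd p) = \<zero>" using x y p by (auto simp: corner_functions_def mem_Times_iff)
      moreover have "x (fst p) \<in> carrier R" "y (snd p) \<in> carrier R" using xy p by (auto simp: mem_Times_iff)
      ultimately show ?thesis by (elim disjE) (simp_all add: concat_factor_closed[OF K])
    qed
    then show ?thesis
      unfolding blob_algebra_mult_apply[OF DiffD1[OF d]] by (rule add.finprod_one_eqI)
  qed
  then show ?thesis using blob_algebra_mult_closed[OF K xy] by (simp add: corner_functions_def)
qed

lemma finsum_concentrated:
  assumes "finite A" "a \<in> A" "f \<in> A \<rightarrow> carrier R" "\<And>p. p \<in> A \<Longrightarrow> p \<noteq> a \<Longrightarrow> f p = \<zero>"
  shows "finsum R f A = f a"
proof -
  have "finsum R f {a} = finsum R f A"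
    using assms by (intro add.finprod_mono_neutral_cong_left) auto
  moreover have "finsum R f {a} = f a" using assms by (simp add: Pi_iff)
  ultimately show ?thesis by simp
qed

text \<open>Among the pairs with product \<open>d\<close>, only the one formed by the identity and
  \<open>d\<close> has a nonzero term, and its concatenation factor is 1.\<close>

lemma blob_algebra_one:
  assumes K: "\<alpha> \<in> carrier R" "\<beta> \<in> carrier R" "\<gamma> \<in> carrier R"
    and id: "id_diagram n \<in> blob_diagrams n" and y: "y \<in> blob_diagrams n \<rightarrow>\<^sub>E carrier R"
  shows "diagram_vec R n (id_diagram n) \<otimes>\<^bsub>blob_algebra R n \<alpha> \<beta> \<gamma>\<^esub> y = y"
    "y \<otimes>\<^bsub>blob_algebra R n \<alpha> \<beta> \<gamma>\<^esub> diagram_vec R n (id_diagram n) = y"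
proof -
  let ?B = "blob_diagrams n" and ?M = "blob_algebra R n \<alpha> \<beta> \<gamma>"
  let ?i = "id_diagram n"
  let ?e = "diagram_vec R n ?i"
  let ?c = "\<lambda>p. concat_factor R n \<alpha> \<beta> \<gamma> (fst p) (snd p)"
  have e: "?e \<in> ?B \<rightarrow>\<^sub>E carrier R" by (auto simp: diagram_vec_def)
  have ed: "?e d = (if d = ?i then \<one> else \<zero>)" if "d \<in> ?B" for d using that by (simp add: diagram_vec_def)
  have l: "concat_diagram n ?i d = d" "?c (?i, d) = \<one>" and r: "concat_diagram n d ?i = d" "?c (d, ?i) = \<one>"
    if "d \<in> ?B" for d
    using stack_outcome_id_left[OF that] stack_outcome_id_right[OF that] K
      concat_factor_stack_outcome[OF on_vertices_id blob_diagrams_on_vertices[OF that] stack_outcome_id_left[OF that] K]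
      concat_factor_stack_outcome[OF blob_diagrams_on_vertices[OF that] on_vertices_id stack_outcome_id_right[OF that] K]
    by (simp_all add: concat_diagram_stack_outcome)
  have fin: "finite {p \<in> ?B \<times> ?B. concat_diagram n (fst p) (snd p) = d}" for d
    using finite_blob_diagrams by simp
  show "?e \<otimes>\<^bsub>?M\<^esub> y = y"
  proof (rule PiE_ext[OF blob_algebra_mult_closed[OF K e y] y])
    fix d assume d: "d \<in> ?B"
    have yc: "y (snd p) \<in> carrier R" if "p \<in> ?B \<times> ?B" for p using that y by auto
    have "(\<Oplus>p\<in>{p \<in> ?B \<times> ?B. concat_diagram n (fst p) (snd p) = d}. ?c p \<otimes> (?e (fst p) \<otimes> y (snd p)))
        = ?c (?i, d) \<otimes> (?e (fst (?i, d)) \<otimes> y (snd (?i, d)))"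
    proof (rule finsum_concentrated[OF fin])
      show "(?i, d) \<in> {p \<in> ?B \<times> ?B. concat_diagram n (fst p) (snd p) = d}" using id d l by simp
      show "(\<lambda>p. ?c p \<otimes> (?e (fst p) \<otimes> y (snd p))) \<in> {p \<in> ?B \<times> ?B. concat_diagram n (fst p) (snd p) = d} \<rightarrow> carrier R"
        using yc ed by (intro Pi_I) (simp add: concat_factor_closed[OF K] mem_Times_iff)
      fix p assume p: "p \<in> {p \<in> ?B \<times> ?B. concat_diagram n (fst p) (snd p) = d}" "p \<noteq> (?i, d)"
      then have "fst p \<noteq> ?i" using l by (cases p) auto
      then have "?e (fst p) = \<zero>" using p ed by (auto simp: mem_Times_iff)
      then show "?c p \<otimes> (?e (fst p) \<otimes> y (snd p)) = \<zero>" using yc[of p] p by (simp add: concat_factor_closed[OF K])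
    qed
    also have "\<dots> = y d" using l(2)[OF d] ed[OF id] PiE_mem[OF y d] by simp
    finally show "(?e \<otimes>\<^bsub>?M\<^esub> y) d = y d" unfolding blob_algebra_mult_apply[OF d] .
  qed
  show "y \<otimes>\<^bsub>?M\<^esub> ?e = y"
  proof (rule PiE_ext[OF blob_algebra_mult_closed[OF K y e] y])
    fix d assume d: "d \<in> ?B"
    have yc: "y (fst p) \<in> carrier R" if "p \<in> ?B \<times> ?B" for p using that y by auto
    have "(\<Oplus>p\<in>{p \<in> ?B \<times> ?B. concat_diagram n (fst p) (snd p) = d}. ?c p \<otimes> (y (fst p) \<otimes> ?e (snd p)))
        = ?c (d, ?i) \<otimes> (y (fst (d, ?i)) \<otimes> ?e (snd (d, ?i)))"
    proof (rule finsum_concentrated[OF fin])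
      show "(d, ?i) \<in> {p \<in> ?B \<times> ?B. concat_diagram n (fst p) (snd p) = d}" using id d r by simp
      show "(\<lambda>p. ?c p \<otimes> (y (fst p) \<otimes> ?e (snd p))) \<in> {p \<in> ?B \<times> ?B. concat_diagram n (fst p) (snd p) = d} \<rightarrow> carrier R"
        using yc ed by (intro Pi_I) (simp add: concat_factor_closed[OF K] mem_Times_iff)
      fix p assume p: "p \<in> {p \<in> ?B \<times> ?B. concat_diagram n (fst p) (snd p) = d}" "p \<noteq> (d, ?i)"
      then have "snd p \<noteq> ?i" using r by (cases p) auto
      then have "?e (snd p) = \<zero>" using p ed by (auto simp: mem_Times_iff)
      then show "?c p \<otimes> (y (fst p) \<otimes> ?e (snd p)) = \<zero>" using yc[of p] p by (simp add: concat_factor_closed[OF K])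
    qed
    also have "\<dots> = y d" using r(2)[OF d] ed[OF id] PiE_mem[OF y d] by simp
    finally show "(y \<otimes>\<^bsub>?M\<^esub> ?e) d = y d" unfolding blob_algebra_mult_apply[OF d] .
  qed
qed

section \<open>The linear extension of \<open>rho1\<close>\<close>

text \<open>As the normalised \<open>d\<close> goes to \<open>rho1 d\<close>, the diagram
  \<open>d\<close> itself goes to \<open>\<delta>\<^sub>e\<close> times \<open>rho1 d\<close>. On
  coefficient functions this is composition with the inverse of \<open>rho1\<close>, followed by
  multiplication by \<open>\<delta>\<^sub>e\<close>.\<close>

definition corner_iso :: "nat \<Rightarrow> 'a \<Rightarrow> (blob_diagram \<Rightarrow> 'a) \<Rightarrow> (blob_diagram \<Rightarrow> 'a)" where
  "corner_iso m \<delta>\<^sub>e x =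
     (\<lambda>d\<in>blob_diagrams m. \<delta>\<^sub>e \<otimes> x (inv_into (corner_diagrams (Suc m)) (rho1 (Suc m)) d))"

lemma corner_iso_rho1:
  assumes "d \<in> corner_diagrams (Suc m)"
  shows "corner_iso m \<delta>\<^sub>e x (rho1 (Suc m) d) = \<delta>\<^sub>e \<otimes> x d"
proof -
  have "rho1 (Suc m) d \<in> blob_diagrams m" using bij_betwE[OF rho1_bij_betw] assms by blast
  moreover have "inv_into (corner_diagrams (Suc m)) (rho1 (Suc m)) (rho1 (Suc m) d) = d"
    by (rule inv_into_f_f[OF bij_betw_imp_inj_on[OF rho1_bij_betw] assms])
  ultimately show ?thesis by (simp add: corner_iso_def)
qed

lemma rho1_cases:
  assumes "d' \<in> blob_diagrams m"
  obtains d where "d \<in> corner_diagrams (Suc m)" "d' = rho1 (Suc m) d"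
  using rho1_bij_betw assms unfolding bij_betw_def by blast

lemma corner_iso_closed:
  assumes "\<delta>\<^sub>e \<in> carrier R" "x \<in> corner_functions R (Suc m)"
  shows "corner_iso m \<delta>\<^sub>e x \<in> blob_diagrams m \<rightarrow>\<^sub>E carrier R"
proof -
  have "corner_iso m \<delta>\<^sub>e x d' \<in> carrier R" if d': "d' \<in> blob_diagrams m" for d'
  proof -
    obtain d where d: "d \<in> corner_diagrams (Suc m)" "d' = rho1 (Suc m) d" by (rule rho1_cases[OF d'])
    then have "d \<in> blob_diagrams (Suc m)" using corner_diagrams_subset by blast
    then have "x d \<in> carrier R" using assms(2) by (auto simp: corner_functions_def)
    then show ?thesis unfolding d(2) corner_iso_rho1[OF d(1)] using assms(1) by simp
  qed
  then show ?thesis unfolding corner_iso_def by (simp add: PiE_iff)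
qed

text \<open>Coefficients are moved along a bijection and multiplied by a unit; those outside the
  corner are zero by definition.\<close>

lemma corner_iso_bij_betw:
  assumes \<delta>: "\<delta>\<^sub>e \<in> Units R"
  shows "bij_betw (corner_iso m \<delta>\<^sub>e) (corner_functions R (Suc m)) (blob_diagrams m \<rightarrow>\<^sub>E carrier R)"
  unfolding bij_betw_def
proof (intro conjI inj_onI subset_antisym subsetI)
  let ?B = "blob_diagrams (Suc m)" and ?C = "corner_diagrams (Suc m)"
  have dc: "\<delta>\<^sub>e \<in> carrier R" "inv \<delta>\<^sub>e \<in> carrier R" using \<delta> by auto
  fix x y assume xy: "x \<in> corner_functions R (Suc m)" "y \<in> corner_functions R (Suc m)"
    and eq: "corner_iso m \<delta>\<^sub>e x = corner_iso m \<delta>\<^sub>e y"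
  show "x = y"
  proof (rule PiE_ext)
    show "x \<in> ?B \<rightarrow>\<^sub>E carrier R" "y \<in> ?B \<rightarrow>\<^sub>E carrier R" using xy by (auto simp: corner_functions_def)
    fix d assume d: "d \<in> ?B"
    show "x d = y d"
    proof (cases "d \<in> ?C")
      case True
      have "\<delta>\<^sub>e \<otimes> x d = \<delta>\<^sub>e \<otimes> y d" using corner_iso_rho1[OF True, of \<delta>\<^sub>e] eq by metis
      moreover have "x d \<in> carrier R" "y d \<in> carrier R" using xy d by (auto simp: corner_functions_def)
      ultimately show ?thesis using \<delta> Units_l_cancel by blast
    next
      case False
      then show ?thesis using d xy by (simp add: corner_functions_def)
    qed
  qed
next
  fix y assume "y \<in> corner_iso m \<delta>\<^sub>e ` corner_functions R (Suc m)"
  then show "y \<in> blob_diagrams m \<rightarrow>\<^sub>E carrier R" using corner_iso_closed \<delta> by blast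
next
  let ?B = "blob_diagrams (Suc m)" and ?C = "corner_diagrams (Suc m)"
  have dc: "\<delta>\<^sub>e \<in> carrier R" "inv \<delta>\<^sub>e \<in> carrier R" using \<delta> by auto
  fix y assume y: "y \<in> blob_diagrams m \<rightarrow>\<^sub>E carrier R"
  define x where "x = (\<lambda>d\<in>?B. if d \<in> ?C then inv \<delta>\<^sub>e \<otimes> y (rho1 (Suc m) d) else \<zero>)"
  have yc: "y (rho1 (Suc m) d) \<in> carrier R" if "d \<in> ?C" for d
    using that y bij_betwE[OF rho1_bij_betw] by blast
  have x: "x \<in> corner_functions R (Suc m)"
    using yc dc by (auto simp: x_def corner_functions_def)
  have "corner_iso m \<delta>\<^sub>e x = y"
  proof (rule PiE_ext[OF corner_iso_closed[OF dc(1) x] y])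
    fix d' assume "d' \<in> blob_diagrams m"
    then obtain d where d: "d \<in> ?C" "d' = rho1 (Suc m) d" by (rule rho1_cases)
    have "\<delta>\<^sub>e \<otimes> (inv \<delta>\<^sub>e \<otimes> y d') = y d'"
      using \<delta> dc yc[OF d(1)] unfolding d(2) by (simp add: m_assoc[symmetric])
    moreover have "x d = inv \<delta>\<^sub>e \<otimes> y d'" using d corner_diagrams_subset[of "Suc m"] by (auto simp: x_def)
    ultimately show "corner_iso m \<delta>\<^sub>e x d' = y d'" using corner_iso_rho1[OF d(1)] d(2) by simp
  qed
  with x show "y \<in> corner_iso m \<delta>\<^sub>e ` corner_functions R (Suc m)" by blast
qed

text \<open>Both sides carry \<open>\<delta>\<^sub>e\<close> twice. On the left, one comes from
  \<open>corner_iso\<close> and one is split off the concatenation factor by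
  \<open>concat_factor_rho1\<close>; on the right, each of the two coefficients brings one.\<close>

lemma corner_iso_mult:
  assumes K: "\<delta> \<in> carrier R" "\<delta>\<^sub>e \<in> carrier R" "\<kappa> \<in> carrier R"
    and x: "x \<in> corner_functions R (Suc m)" and y: "y \<in> corner_functions R (Suc m)"
  shows "corner_iso m \<delta>\<^sub>e (x \<otimes>\<^bsub>blob_algebra R (Suc m) \<delta> \<delta>\<^sub>e \<kappa>\<^esub> y) =
    corner_iso m \<delta>\<^sub>e x \<otimes>\<^bsub>blob_algebra R m \<delta> \<kappa> \<delta>\<^sub>e\<^esub> corner_iso m \<delta>\<^sub>e y"
proof (rule PiE_ext)
  let ?n = "Suc m"
  let ?B = "blob_diagrams ?n" and ?C = "corner_diagrams ?n" and ?B' = "blob_diagrams m"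
  let ?h = "corner_iso m \<delta>\<^sub>e" and ?\<rho> = "rho1 ?n"
  let ?c = "\<lambda>p. concat_factor R ?n \<delta> \<delta>\<^sub>e \<kappa> (fst p) (snd p)"
  let ?c' = "\<lambda>p. concat_factor R m \<delta> \<kappa> \<delta>\<^sub>e (fst p) (snd p)"
  show "?h (x \<otimes>\<^bsub>blob_algebra R ?n \<delta> \<delta>\<^sub>e \<kappa>\<^esub> y) \<in> ?B' \<rightarrow>\<^sub>E carrier R"
    by (intro corner_iso_closed corner_functions_mult_closed K x y)
  show "?h x \<otimes>\<^bsub>blob_algebra R m \<delta> \<kappa> \<delta>\<^sub>e\<^esub> ?h y \<in> ?B' \<rightarrow>\<^sub>E carrier R"
    by (intro corner_iso_closed blob_algebra_mult_closed K x y)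
  fix d' assume d': "d' \<in> ?B'"
  then obtain d where d: "d \<in> ?C" "d' = ?\<rho> d" by (rule rho1_cases)
  have dB: "d \<in> ?B" using d corner_diagrams_subset by blast
  let ?P = "{p \<in> ?B \<times> ?B. concat_diagram ?n (fst p) (snd p) = d}"
    and ?Q = "{p \<in> ?C \<times> ?C. concat_diagram ?n (fst p) (snd p) = d}"
    and ?Q' = "{p \<in> ?B' \<times> ?B'. concat_diagram m (fst p) (snd p) = d'}"
  let ?t = "\<lambda>p. ?c p \<otimes> (x (fst p) \<otimes> y (snd p))"
  let ?t' = "\<lambda>p. ?c' p \<otimes> (?h x (fst p) \<otimes> ?h y (snd p))"
  have xyc: "x (fst p) \<in> carrier R" "y (snd p) \<in> carrier R" if "p \<in> ?B \<times> ?B" for p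
    using that x y by (auto simp: corner_functions_def)
  have fin: "finite ?P" using finite_blob_diagrams by simp
  have QP: "?Q \<subseteq> ?P" using corner_diagrams_subset by auto
  \<comment> \<open>Pairs with a member outside the corner have a vanishing coefficient, so the sum
    may be restricted to the domain of \<open>rho1\<close>.\<close>
  have "finsum R ?t ?Q = finsum R ?t ?P"
  proof (rule add.finprod_mono_neutral_cong_left[OF fin QP])
    fix p assume p: "p \<in> ?P - ?Q"
    then have "fst p \<notin> ?C \<or> snd p \<notin> ?C" by (auto simp: mem_Times_iff)
    then have "x (fst p) = \<zero> \<or> y (snd p) = \<zero>" using x y p by (auto simp: corner_functions_def mem_Times_iff)
    then show "?t p = \<zero>" using xyc[of p] p
      by (elim disjE) (simp_all add: concat_factor_closed[OF K])
  qed (use xyc in \<open>simp_all add: concat_factor_closed[OF K] Pi_I\<close>)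
  then have L: "?h (x \<otimes>\<^bsub>blob_algebra R ?n \<delta> \<delta>\<^sub>e \<kappa>\<^esub> y) d' = \<delta>\<^sub>e \<otimes> finsum R ?t ?Q"
    unfolding d(2) corner_iso_rho1[OF d(1)] blob_algebra_mult_apply[OF dB] by simp
  have inj: "inj_on (map_prod ?\<rho> ?\<rho>) (?C \<times> ?C)"
    using bij_betw_imp_inj_on[OF rho1_bij_betw] by (intro map_prod_inj_on)
  \<comment> \<open>As \<open>rho1\<close> is bijective and respects concatenation, the pairs with
    product \<open>d\<close> correspond to those with product \<open>rho1 d\<close>.\<close>
  have Q': "?Q' = map_prod ?\<rho> ?\<rho> ` ?Q"
  proof (intro subset_antisym subsetI)
    fix q assume q: "q \<in> ?Q'"
    then have qB: "fst q \<in> ?B'" "snd q \<in> ?B'" by (simp_all add: mem_Times_iff)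
    obtain d1 where d1: "d1 \<in> ?C" "fst q = ?\<rho> d1" by (rule rho1_cases[OF qB(1)])
    obtain d2 where d2: "d2 \<in> ?C" "snd q = ?\<rho> d2" by (rule rho1_cases[OF qB(2)])
    have "?\<rho> (concat_diagram ?n d1 d2) = ?\<rho> d"
      using concat_corner_diagrams(2)[OF d1(1) d2(1)] q d1(2) d2(2) d(2) by simp
    then have "concat_diagram ?n d1 d2 = d"
      using bij_betw_imp_inj_on[OF rho1_bij_betw] concat_corner_diagrams(1)[OF d1(1) d2(1)] d(1) by (meson inj_onD)
    then have "(d1, d2) \<in> ?Q" using d1 d2 by simp
    moreover have "q = map_prod ?\<rho> ?\<rho> (d1, d2)" using d1(2) d2(2) by (cases q) simp
    ultimately show "q \<in> map_prod ?\<rho> ?\<rho> ` ?Q" by blast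
  next
    fix q assume "q \<in> map_prod ?\<rho> ?\<rho> ` ?Q"
    then obtain d1 d2 where "q = (?\<rho> d1, ?\<rho> d2)" "d1 \<in> ?C" "d2 \<in> ?C" "concat_diagram ?n d1 d2 = d" by auto
    then show "q \<in> ?Q'"
      using concat_corner_diagrams(2)[of d1 m d2] d(2) bij_betwE[OF rho1_bij_betw] by auto
  qed
  have t': "?t' (map_prod ?\<rho> ?\<rho> p) = \<delta>\<^sub>e \<otimes> ?t p" if "p \<in> ?Q" for p
  proof -
    have p: "fst p \<in> ?C" "snd p \<in> ?C" using that by auto
    have c: "x (fst p) \<in> carrier R" "y (snd p) \<in> carrier R" "?c' (map_prod ?\<rho> ?\<rho> p) \<in> carrier R"
      using xyc[of p] that QP by (auto simp only: concat_factor_closed[OF K(1,3,2)])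
    have cf: "?c p = \<delta>\<^sub>e \<otimes> ?c' (map_prod ?\<rho> ?\<rho> p)"
      using concat_factor_rho1[OF p K] by simp
    have "?t' (map_prod ?\<rho> ?\<rho> p) = ?c' (map_prod ?\<rho> ?\<rho> p) \<otimes> ((\<delta>\<^sub>e \<otimes> x (fst p)) \<otimes> (\<delta>\<^sub>e \<otimes> y (snd p)))"
      using corner_iso_rho1[OF p(1), of \<delta>\<^sub>e x] corner_iso_rho1[OF p(2), of \<delta>\<^sub>e y] by simp
    also have "\<dots> = \<delta>\<^sub>e \<otimes> ((\<delta>\<^sub>e \<otimes> ?c' (map_prod ?\<rho> ?\<rho> p)) \<otimes> (x (fst p) \<otimes> y (snd p)))"
      using c K(2) by (simp only: m_ac m_closed)
    finally show ?thesis unfolding cf .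
  qed
  have tc: "?t p \<in> carrier R" if "p \<in> ?Q" for p
  proof -
    have "p \<in> ?B \<times> ?B" using that QP by blast
    from xyc[OF this] show ?thesis by (simp add: concat_factor_closed[OF K])
  qed
  have "finsum R ?t' ?Q' = finsum R (\<lambda>p. ?t' (map_prod ?\<rho> ?\<rho> p)) ?Q"
    unfolding Q'
  proof (rule add.finprod_reindex)
    show "?t' \<in> map_prod ?\<rho> ?\<rho> ` ?Q \<rightarrow> carrier R" using t' tc K(2) by auto
    show "inj_on (map_prod ?\<rho> ?\<rho>) ?Q" using inj by (rule inj_on_subset) auto
  qed
  also have "\<dots> = finsum R (\<lambda>p. \<delta>\<^sub>e \<otimes> ?t p) ?Q"
    using t' tc K(2) by (intro finsum_cong') auto
  also have "\<dots> = \<delta>\<^sub>e \<otimes> finsum R ?t ?Q"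
    using finite_subset[OF QP fin] tc K(2) by (intro finsum_rdistr[symmetric]) auto
  finally have "finsum R ?t' ?Q' = \<delta>\<^sub>e \<otimes> finsum R ?t ?Q" .
  then show "?h (x \<otimes>\<^bsub>blob_algebra R ?n \<delta> \<delta>\<^sub>e \<kappa>\<^esub> y) d' = (?h x \<otimes>\<^bsub>blob_algebra R m \<delta> \<kappa> \<delta>\<^sub>e\<^esub> ?h y) d'"
    unfolding L blob_algebra_mult_apply[OF d'] by simp
qed

lemma corner_iso_corner_vec:
  assumes \<delta>: "\<delta>\<^sub>e \<in> Units R" and d: "d \<in> corner_diagrams (Suc m)"
  shows "corner_iso m \<delta>\<^sub>e (corner_vec R (Suc m) \<delta> \<delta>\<^sub>e \<kappa> d) = diagram_vec R m (rho1 (Suc m) d)"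
proof (rule extensionalityI[where A = "blob_diagrams m"])
  fix c' assume "c' \<in> blob_diagrams m"
  then obtain c where c: "c \<in> corner_diagrams (Suc m)" "c' = rho1 (Suc m) c" by (rule rho1_cases)
  have cB: "c \<in> blob_diagrams (Suc m)" using c corner_diagrams_subset by blast
  have "rho1 (Suc m) c = rho1 (Suc m) d \<longleftrightarrow> c = d"
    using bij_betw_imp_inj_on[OF rho1_bij_betw] c(1) d by (auto dest: inj_onD)
  moreover have "\<delta>\<^sub>e \<in> carrier R" using \<delta> by auto
  ultimately show "corner_iso m \<delta>\<^sub>e (corner_vec R (Suc m) \<delta> \<delta>\<^sub>e \<kappa> d) c' = diagram_vec R m (rho1 (Suc m) d) c'"
    using \<open>c' \<in> blob_diagrams m\<close> \<delta>
    unfolding c(2) corner_iso_rho1[OF c(1)] corner_vec_apply[OF \<delta> cB] by (simp add: diagram_vec_def)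
qed (auto simp: corner_iso_def diagram_vec_def)

end

theorem proposition5p1p1:
  fixes K :: "('k, 'm) ring_scheme" and \<delta> \<delta>\<^sub>e \<kappa> :: 'k and n :: nat
  assumes "cring K"
    and "\<delta> \<in> carrier K" and "\<delta>\<^sub>e \<in> Units K" and "\<kappa> \<in> carrier K"
    and "n \<ge> 1"
  defines "be \<equiv> corner_algebra K n \<delta> \<delta>\<^sub>e \<kappa>"
  shows "(\<forall>x \<in> carrier be. \<forall>y \<in> carrier be. x \<otimes>\<^bsub>be\<^esub> y \<in> carrier be) \<and>
    \<one>\<^bsub>be\<^esub> \<in> carrier be \<and>
    (\<forall>x \<in> carrier be. \<one>\<^bsub>be\<^esub> \<otimes>\<^bsub>be\<^esub> x = x \<and> x \<otimes>\<^bsub>be\<^esub> \<one>\<^bsub>be\<^esub> = x) \<and>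
    (\<exists>h \<in> algebra_iso K be (blob_algebra K (n - 1) \<delta> \<kappa> \<delta>\<^sub>e).
       \<forall>d \<in> corner_diagrams n.
         h (corner_vec K n \<delta> \<delta>\<^sub>e \<kappa> d) = diagram_vec K (n - 1) (rho1 n d))"
proof -
  interpret cring K by fact
  obtain m where n: "n = Suc m" using assms(5) by (cases n) auto
  let ?A = "blob_algebra K n \<delta> \<delta>\<^sub>e \<kappa>" and ?A' = "blob_algebra K m \<delta> \<kappa> \<delta>\<^sub>e"
  let ?F = "corner_functions K n" and ?h = "corner_iso m \<delta>\<^sub>e"
  have \<delta>: "\<delta>\<^sub>e \<in> carrier K" using assms(3) by auto
  have carr: "carrier be = ?F" unfolding be_def by (rule carrier_corner_algebra[OF assms(3)])
  have ops: "x \<otimes>\<^bsub>be\<^esub> y = x \<otimes>\<^bsub>?A\<^esub> y" "x \<oplus>\<^bsub>be\<^esub> y = x \<oplus>\<^bsub>?A\<^esub> y" "a \<odot>\<^bsub>be\<^esub> x = a \<odot>\<^bsub>?A\<^esub> x"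
    "\<one>\<^bsub>be\<^esub> = corner_vec K n \<delta> \<delta>\<^sub>e \<kappa> (e_diagram n)" for a x y
    by (simp_all add: be_def corner_algebra_def)
  have carr': "carrier ?A' = blob_diagrams m \<rightarrow>\<^sub>E carrier K" by (simp add: blob_algebra_def)
  have bij: "bij_betw ?h ?F (carrier ?A')" unfolding carr' n by (rule corner_iso_bij_betw[OF assms(3)])
  have hvec: "?h (corner_vec K n \<delta> \<delta>\<^sub>e \<kappa> d) = diagram_vec K m (rho1 n d)" if "d \<in> corner_diagrams n" for d
    using corner_iso_corner_vec[OF assms(3)] that unfolding n by blast
  have e: "e_diagram n \<in> corner_diagrams n" unfolding n by (rule e_diagram_corner)
  have hone: "?h \<one>\<^bsub>be\<^esub> = \<one>\<^bsub>?A'\<^esub>"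
    unfolding ops hvec[OF e] unfolding n rho1_e_diagram by (simp add: blob_algebra_def)
  have closed: "x \<otimes>\<^bsub>be\<^esub> y \<in> ?F" if "x \<in> ?F" "y \<in> ?F" for x y
    using corner_functions_mult_closed[OF assms(2) \<delta> assms(4)] that unfolding ops n by blast
  have hmult: "?h (x \<otimes>\<^bsub>be\<^esub> y) = ?h x \<otimes>\<^bsub>?A'\<^esub> ?h y" if "x \<in> ?F" "y \<in> ?F" for x y
    using corner_iso_mult[OF assms(2) \<delta> assms(4)] that unfolding ops n by blast
  have one: "\<one>\<^bsub>be\<^esub> \<in> ?F"
  proof -
    have "corner_vec K n \<delta> \<delta>\<^sub>e \<kappa> ` corner_diagrams n \<subseteq> carrier be"
      unfolding be_def corner_algebra_def module_span_def by auto
    then show ?thesis using e unfolding carr ops by blast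
  qed
  \<comment> \<open>The identity is obtained as the image of \<open>e_diagram\<close>, which covers
    \<open>m = 0\<close> as well.\<close>
  have id: "id_diagram m \<in> blob_diagrams m"
    using bij_betwE[OF rho1_bij_betw] e_diagram_corner rho1_e_diagram by metis
  \<comment> \<open>The unit laws are pulled back along the injective map \<open>?h\<close> from
    those of the identity diagram in the target algebra.\<close>
  have unit: "\<one>\<^bsub>be\<^esub> \<otimes>\<^bsub>be\<^esub> x = x \<and> x \<otimes>\<^bsub>be\<^esub> \<one>\<^bsub>be\<^esub> = x" if x: "x \<in> ?F" for x
  proof -
    have hx: "?h x \<in> blob_diagrams m \<rightarrow>\<^sub>E carrier K" using bij_betwE[OF bij] x carr' by blast
    have A'one: "\<one>\<^bsub>?A'\<^esub> = diagram_vec K m (id_diagram m)" by (simp add: blob_algebra_def)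
    note one' = blob_algebra_one[OF assms(2,4) \<delta> id hx]
    have "?h (\<one>\<^bsub>be\<^esub> \<otimes>\<^bsub>be\<^esub> x) = ?h x" "?h (x \<otimes>\<^bsub>be\<^esub> \<one>\<^bsub>be\<^esub>) = ?h x"
      unfolding hmult[OF one x] hmult[OF x one] hone A'one using one' by simp_all
    then show ?thesis
      using bij_betw_imp_inj_on[OF bij] closed[OF one x] closed[OF x one] x by (meson inj_onD)
  qed
  have hlin: "?h (x \<oplus>\<^bsub>be\<^esub> y) = ?h x \<oplus>\<^bsub>?A'\<^esub> ?h y" "?h (a \<odot>\<^bsub>be\<^esub> x) = a \<odot>\<^bsub>?A'\<^esub> ?h x"
    if xy: "x \<in> ?F" "y \<in> ?F" and a: "a \<in> carrier K" for x y a
  proof -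
    have inv: "inv_into (corner_diagrams n) (rho1 n) d \<in> blob_diagrams n" if "d \<in> blob_diagrams m" for d
      using bij_betwE[OF bij_betw_inv_into[OF rho1_bij_betw]] that corner_diagrams_subset unfolding n by blast
    have c: "z (inv_into (corner_diagrams n) (rho1 n) d) \<in> carrier K" if "d \<in> blob_diagrams m" "z \<in> ?F" for d z
      using inv[OF that(1)] that(2) by (auto simp: corner_functions_def)
    show "?h (x \<oplus>\<^bsub>be\<^esub> y) = ?h x \<oplus>\<^bsub>?A'\<^esub> ?h y"
      unfolding ops corner_iso_def n[symmetric] using inv c xy \<delta>
      by (simp add: blob_algebra_def) (rule restrict_ext, simp add: r_distr)
    show "?h (a \<odot>\<^bsub>be\<^esub> x) = a \<odot>\<^bsub>?A'\<^esub> ?h x"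
      unfolding ops corner_iso_def n[symmetric] using inv c xy \<delta> a
      by (simp add: blob_algebra_def) (rule restrict_ext, simp add: m_lcomm)
  qed
  have "?h \<in> ring_hom be ?A'"
  proof (rule ring_hom_memI)
    show "?h x \<in> carrier ?A'" if "x \<in> carrier be" for x using bij_betwE[OF bij] that unfolding carr by blast
  \<comment> \<open>Additivity was stated together with homogeneity, so a scalar must be supplied;
    zero serves.\<close>
  qed (use hmult hlin(1)[OF _ _ zero_closed] hone in \<open>simp_all add: carr\<close>)
  then have "?h \<in> algebra_iso K be ?A'"
    unfolding algebra_iso_def ring_iso_def using bij hlin(2) by (auto simp: carr)
  then have "\<exists>h\<in>algebra_iso K be ?A'. \<forall>d\<in>corner_diagrams n.
      h (corner_vec K n \<delta> \<delta>\<^sub>e \<kappa> d) = diagram_vec K m (rho1 n d)"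
    using hvec by blast
  moreover have "n - 1 = m" using n by simp
  ultimately show ?thesis using closed one unit unfolding carr by simp
qed

end
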